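(* Let $\rho,u$ be a solution in the sense of distributions on $(0,T)\times\mathbb{T}^d$ of the isentropic compressible Euler system $$\partial_t(\rho u)+\operatorname{div}(\rho u\otimes u)+\nabla p(\rho)=0,\qquad \partial_t\rho+\operatorname{div}(\rho u)=0.$$ Assume $$u\in B_3^{\alpha,\infty}((0,T)\times\mathbb{T}^d),\qquad \rho,\ \rho u\in B_3^{\beta,\infty}((0,T)\times\mathbb{T}^d),\qquad 0\le\underline{\rho}\le\rho\le\overline{\rho}\ \text{ a.e. in }(0,T)\times\mathbb{T}^d,$$ for some constants $\underline{\rho},\overline{\rho}$ and $0\le\alpha,\beta\le1$ such that $$\beta>\max\left\{1-2\alpha;\ \frac{1-\alpha}{2}\right\}.$$ Assume further that $\operatorname{div}u\in\mathcal{M}((0,T)\times\mathbb{T}^d)$ and $p\in C[\underline{\rho},\overline{\rho}]$. Then the energy is locally conserved, i.e. $$\partial_t\left(\tfrac12\rho|u|^2+P(\rho)\right)+\operatorname{div}\left[\left(\tfrac12\rho|u|^2+p(\rho)+P(\rho)\right)u\right]=0$$ in the sense of distributions on $(0,T)\times\mathbb{T}^d$.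
   Context: $\mathbb{T}^d$ is the $d$-dimensional torus; $u$ is the (vector-valued) velocity, $\rho\ge0$ the (scalar) density, and $p=p(\rho)$ the pressure law. $\operatorname{div}$ and $\nabla$ act in the space variable $x$. The pressure potential is $P(\rho)=\rho\int_1^\rho\frac{p(r)}{r^2}\,dr$, with the value at $\rho=0$ understood as the limit $\rho\to0^+$; the pressure is understood to be given on an interval for which this integral makes sense. For $\Omega=(0,T)\times\mathbb{T}^d$, the Besov space $B_q^{\alpha,\infty}(\Omega)$ consists of those $w$ for which $$\|w\|_{B_q^{\alpha,\infty}(\Omega)}:=\|w\|_{L^q(\Omega)}+\sup_{\xi\in\Omega}\frac{\|w(\cdot+\xi)-w\|_{L^q(\Omega\cap(\Omega-\xi))}}{|\xi|^\alpha}<\infty,$$ where $\xi$ ranges over (nonzero) space-time shifts. $\mathcal{M}(\Omega)$ is the space of signed Radon measures on $\Omega$ with finite total variation norm $\|\mu\|_{TV}=\int_\Omega d|\mu|$. *)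

theory Defs
  imports "HOL-Analysis.Analysis"
begin

section \<open>Space-time over the torus\<close>

text \<open>
  The torus is \<open>\<real>\<^sup>d / \<int>\<^sup>d\<close> with \<open>d = CARD('n)\<close>. A function on
  \<open>(0,T) \<times> \<real>\<^sup>d / \<int>\<^sup>d\<close> is rendered as a function on \<open>\<real> \<times> \<real>\<^sup>d\<close> that is \<open>\<int>\<^sup>d\<close>-periodic
  in the second argument (its values at times outside \<open>(0,T)\<close> are never used), and integration over
  the torus is integration over the half-open unit cube, a fundamental domain.
\<close>

type_synonym 'n spacetime = "real \<times> (real ^ 'n)"

definition space_periodic :: "('n::finite spacetime \<Rightarrow> 'b) \<Rightarrow> bool" where
  "space_periodic f \<longleftrightarrow>
     (\<forall>t x k. (\<forall>i. k $ i \<in> \<int>) \<longrightarrow> f (t, x + k) = f (t, x))"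

definition unit_cell :: "(real ^ 'n::finite) set" where
  "unit_cell = {x. \<forall>i. 0 \<le> x $ i \<and> x $ i < 1}"

definition cylinder :: "real \<Rightarrow> ('n::finite spacetime) set" where
  "cylinder T = {0<..<T} \<times> unit_cell"


section \<open>Besov spaces\<close>

definition Lq_norm :: "real \<Rightarrow> 'a::euclidean_space set \<Rightarrow> ('a \<Rightarrow> 'b::euclidean_space) \<Rightarrow> ennreal" where
  "Lq_norm q S f =
     (let I = (\<integral>\<^sup>+z\<in>S. ennreal (norm (f z) powr q) \<partial>lebesgue)
      in if I = \<infinity> then \<infinity> else ennreal (enn2real I powr (1 / q)))"

text \<open>
  \<open>\<Omega> \<inter> (\<Omega> - \<xi>)\<close> restricts only the time component, the torus being invariant under shifts. The
  spatial part of a shift ranges over all of \<open>\<real>\<^sup>d\<close>: lifts of the same torus element give the same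
  numerator, so the shortest lift decides, and the supremum is the one for the torus distance.
\<close>

definition besov_norm ::
  "real \<Rightarrow> real \<Rightarrow> real \<Rightarrow> ('n::finite spacetime \<Rightarrow> 'b::euclidean_space) \<Rightarrow> ennreal" where
  "besov_norm q \<alpha> T w =
     Lq_norm q (cylinder T) w +
     (SUP \<xi>\<in>UNIV - {0}.
        Lq_norm q {z \<in> cylinder T. fst (z + \<xi>) \<in> {0<..<T}} (\<lambda>z. w (z + \<xi>) - w z)
        / ennreal (norm \<xi> powr \<alpha>))"

definition in_besov ::
  "real \<Rightarrow> real \<Rightarrow> real \<Rightarrow> ('n::finite spacetime \<Rightarrow> 'b::euclidean_space) \<Rightarrow> bool" where
  "in_besov q \<alpha> T w \<longleftrightarrow>
     space_periodic w \<and> set_borel_measurable lebesgue (cylinder T) w \<and> besov_norm q \<alpha> T w < \<infinity>"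


section \<open>Distributions on space-time\<close>

fun times_cont_diff :: "nat \<Rightarrow> ('a::euclidean_space \<Rightarrow> 'b::real_normed_vector) \<Rightarrow> bool" where
  "times_cont_diff 0 f \<longleftrightarrow> continuous_on UNIV f"
| "times_cont_diff (Suc k) f \<longleftrightarrow>
     (\<forall>x. f differentiable (at x)) \<and>
     (\<forall>v. times_cont_diff k (\<lambda>x. frechet_derivative f (at x) v))"

definition smooth :: "('a::euclidean_space \<Rightarrow> 'b::real_normed_vector) \<Rightarrow> bool" where
  "smooth f \<longleftrightarrow> (\<forall>k. times_cont_diff k f)"

text \<open>Since the torus is compact, compact support in \<open>(0,T) \<times> \<real>\<^sup>d / \<int>\<^sup>d\<close> constrains only time.\<close>

definition test_functions :: "real \<Rightarrow> ('n::finite spacetime \<Rightarrow> real) set" where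
  "test_functions T =
     {\<phi>. smooth \<phi> \<and> space_periodic \<phi> \<and>
         (\<exists>a b. 0 < a \<and> b < T \<and> (\<forall>t x. t \<notin> {a..b} \<longrightarrow> \<phi> (t, x) = 0))}"

definition dt :: "('n::finite spacetime \<Rightarrow> real) \<Rightarrow> 'n spacetime \<Rightarrow> real" where
  "dt \<phi> z = frechet_derivative \<phi> (at z) (1, 0)"

definition grad :: "('n::finite spacetime \<Rightarrow> real) \<Rightarrow> 'n spacetime \<Rightarrow> real ^ 'n" where
  "grad \<phi> z = (\<chi> i. frechet_derivative \<phi> (at z) (0, axis i 1))"

definition locally_integrable ::
  "real \<Rightarrow> ('n::finite spacetime \<Rightarrow> 'b::euclidean_space) \<Rightarrow> bool" where
  "locally_integrable T f \<longleftrightarrow>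
     (\<forall>a b. 0 < a \<longrightarrow> b < T \<longrightarrow> set_integrable lebesgue ({a..b} \<times> unit_cell) f)"

text \<open>
  \<open>\<partial>\<^sub>t g + div F = 0\<close> in the sense of distributions. Local integrability is part of the definition so
  that \<open>g\<close> and \<open>F\<close> are distributions (the integral of a non-integrable function is \<open>0\<close> by
  convention).
\<close>

definition distributional_balance ::
  "real \<Rightarrow> ('n::finite spacetime \<Rightarrow> real) \<Rightarrow> ('n spacetime \<Rightarrow> real ^ 'n) \<Rightarrow> bool" where
  "distributional_balance T g F \<longleftrightarrow>
     locally_integrable T g \<and> locally_integrable T F \<and>
     (\<forall>\<phi>\<in>test_functions T.
        (LINT z:cylinder T|lebesgue. g z * dt \<phi> z + F z \<bullet> grad \<phi> z) = 0)"

text \<open>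
  The distributional divergence of \<open>v\<close> is a signed Radon measure of finite total variation. Such a
  measure is a difference of two finite Borel measures (Jordan decomposition), finite Borel measures
  being automatically Radon here. A Borel measure on \<open>(0,T) \<times> \<real>\<^sup>d / \<int>\<^sup>d\<close> is
  rendered as one concentrated on the fundamental domain, which is Borel isomorphic to it.
\<close>

definition finite_measure_on_cylinder :: "real \<Rightarrow> ('n::finite spacetime) measure \<Rightarrow> bool" where
  "finite_measure_on_cylinder T \<mu> \<longleftrightarrow>
     sets \<mu> = sets borel \<and> finite_measure \<mu> \<and> emeasure \<mu> (- cylinder T) = 0"

definition div_is_finite_measure :: "real \<Rightarrow> ('n::finite spacetime \<Rightarrow> real ^ 'n) \<Rightarrow> bool" where
  "div_is_finite_measure T v \<longleftrightarrow>
     locally_integrable T v \<and>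
     (\<exists>\<mu>1 \<mu>2. finite_measure_on_cylinder T \<mu>1 \<and> finite_measure_on_cylinder T \<mu>2 \<and>
        (\<forall>\<phi>\<in>test_functions T.
           - (LINT z:cylinder T|lebesgue. v z \<bullet> grad \<phi> z) =
           (LINT z|\<mu>1. \<phi> z) - (LINT z|\<mu>2. \<phi> z)))"


section \<open>Isentropic compressible Euler system\<close>

text \<open>
  The \<open>i\<close>-th component of the momentum equation has flux \<open>\<rho> u\<^sub>i u + p(\<rho>) e\<^sub>i\<close>.
\<close>

definition euler_solution ::
  "real \<Rightarrow> (real \<Rightarrow> real) \<Rightarrow> ('n::finite spacetime \<Rightarrow> real) \<Rightarrow> ('n spacetime \<Rightarrow> real ^ 'n) \<Rightarrow> bool" where
  "euler_solution T p \<rho> u \<longleftrightarrow>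
     (\<forall>i. distributional_balance T
            (\<lambda>z. \<rho> z * u z $ i)
            (\<lambda>z. (\<rho> z * u z $ i) *\<^sub>R u z + p (\<rho> z) *\<^sub>R axis i 1)) \<and>
     distributional_balance T \<rho> (\<lambda>z. \<rho> z *\<^sub>R u z)"

definition pressure_potential :: "(real \<Rightarrow> real) \<Rightarrow> real \<Rightarrow> real" where
  "pressure_potential p r =
     (if r = 0 then Lim (at_right 0) (\<lambda>s. s * (LBINT y=1..ereal s. p y / y\<^sup>2))
      else r * (LBINT y=1..ereal r. p y / y\<^sup>2))"

text \<open>
  The interval on which the pressure is given must reach from \<open>[a,b]\<close> to \<open>1\<close>, the base point of
  the integral in the pressure potential; outside \<open>[a,b]\<close> only the integrability that this integral
  needs is required. The last conjunct matters only when \<open>b = 0\<close> (pure vacuum): continuity on the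
  one-point interval \<open>{0}\<close> would then say nothing about the limit defining the potential at \<open>0\<close>,
  while for \<open>a = 0 < b\<close> its conclusion follows from continuity on \<open>[a,b]\<close>.
\<close>

definition pressure_potential_defined :: "(real \<Rightarrow> real) \<Rightarrow> real \<Rightarrow> real \<Rightarrow> bool" where
  "pressure_potential_defined p a b \<longleftrightarrow>
     (\<forall>r\<in>{min a 1..max b 1}. 0 < r \<longrightarrow>
        interval_lebesgue_integrable lborel 1 (ereal r) (\<lambda>y. p y / y\<^sup>2)) \<and>
     (b = 0 \<longrightarrow> (p \<longlongrightarrow> p 0) (at_right 0))"

end

theory Submission
  imports Defs "HOL-Computational_Algebra.Polynomial"
begin

text \<open>
  For smooth solutions the energy equation is the sum of the momentum equation multiplied by \<open>u\<close> and
  the mass equation multiplied by \<open>- |u|\<^sup>2 / 2\<close> and by \<open>P'(\<rho>)\<close>. Here these multipliers are formed from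
  mollifications: \<open>U\<close> of \<open>u\<close> and \<open>r\<close> of \<open>\<rho>\<close>, at scale \<open>\<epsilon>\<close>. The mollified equations then give the energy
  balance up to remainders (\<open>energy_identity\<close>). In the dangerous ones, a commutator such as
  \<open>mol \<epsilon> (\<rho> u) - r U\<close>, \<open>mol \<epsilon> (\<rho> u \<otimes> u) - mol \<epsilon> (\<rho> u) \<otimes> U\<close> or \<open>mol \<epsilon> (Q(\<rho>)) - Q(r)\<close> multiplies a first
  derivative of \<open>U\<close> or \<open>r\<close>. By the Besov conditions, increments over distances up to \<open>\<epsilon>\<close> have the size
  \<open>\<epsilon> powr \<alpha>\<close> for \<open>u\<close> and \<open>\<epsilon> powr \<beta>\<close> for \<open>\<rho>\<close> and \<open>\<rho> u\<close>; a commutator is quadratic in the increments, and a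
  derivative is an increment divided by \<open>\<epsilon>\<close>. The dangerous remainders therefore are of order
  \<open>\<epsilon> powr (2 * \<alpha> + \<beta> - 1)\<close> or \<open>\<epsilon> powr (\<alpha> + 2 * \<beta> - 1)\<close>, and the hypothesis on \<open>\<beta>\<close> says that both exponents
  are positive (\<open>energy_remainder_bound\<close>).

  The commutator estimate for the pressure needs a pressure with a Lipschitz continuous derivative,
  whereas \<open>p\<close> is only continuous, and the potential of a smooth pressure may still be singular at
  vacuum. Both difficulties are met by approximating \<open>p\<close> uniformly, within \<open>\<delta>\<close>, by an even polynomial
  \<open>Q\<close>. It has a polynomial potential \<open>P\<close> with \<open>r P' - P = Q\<close>, which is within \<open>\<delta>\<close> of the given potential
  on the whole range of the density (\<open>pressure_approximation\<close>). Replacing \<open>p\<close> by \<open>Q\<close> leaves an error term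
  in which \<open>mol \<epsilon> (p(\<rho>) - Q(\<rho>))\<close> multiplies \<open>div U\<close>. Regularity does not make this small, but \<open>div u\<close> is a
  finite measure, and so the integral of the error term is at most \<open>\<delta>\<close> times a constant that depends neither on \<open>\<epsilon>\<close> nor on \<open>Q\<close>
  (\<open>energy_defect_at_scale\<close>). Let first \<open>\<epsilon>\<close> and then \<open>\<delta>\<close> tend to \<open>0\<close> (\<open>energy_defect\<close>,
  \<open>energy_balance\<close>).

  The products of three factors in \<open>L\<^sup>3\<close> are estimated pointwise: one function \<open>w \<ge> 1\<close>, with the
  integral of \<open>w\<^sup>3\<close> bounded uniformly in \<open>\<epsilon>\<close>, dominates \<open>|u|\<close>, \<open>|\<rho> u|\<close> and the rescaled increments, and
  every remainder is at most a multiple of \<open>w\<^sup>3\<close>. The multipliers are admissible because mollified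
  equations accept test functions that are merely continuously differentiable: mollifying the
  equation is mollifying the test function (\<open>weak_bound_mol\<close>). All this is carried out for exactly
  periodic Borel fields that vanish at times outside \<open>(0,T)\<close>; a given solution agrees with such fields
  almost everywhere inside.
\<close>

section \<open>Smooth functions and a smooth kernel\<close>

lemma times_cont_diff_continuous: "times_cont_diff k f \<Longrightarrow> continuous_on UNIV f"
proof (cases k)
  case (Suc j)
  assume "times_cont_diff k f"
  then show ?thesis
    using Suc by (auto intro!: differentiable_imp_continuous_on simp: differentiable_on_def
        intro: differentiable_at_imp_differentiable_on)
qed simp

lemma times_cont_diff_lower: "times_cont_diff (Suc k) f \<Longrightarrow> times_cont_diff k f"
proof (induction k arbitrary: f)
  case 0
  then show ?case using times_cont_diff_continuous[of "Suc 0" f] by simp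
next
  case (Suc k)
  then show ?case by (metis times_cont_diff.simps(2))
qed

lemma times_cont_diff_Suc_iff:
  assumes "\<And>x. (f has_derivative f' x) (at x)"
  shows "times_cont_diff (Suc k) f \<longleftrightarrow> (\<forall>v. times_cont_diff k (\<lambda>x. f' x v))"
proof -
  have "frechet_derivative f (at x) = f' x" for x
    using frechet_derivative_at[OF assms] by metis
  then show ?thesis using assms by (auto simp: differentiable_def)
qed

lemma times_cont_diff_const: "times_cont_diff k (\<lambda>x. c)"
proof (induction k arbitrary: c)
  case (Suc k)
  show ?case
    by (subst times_cont_diff_Suc_iff[where f' = "\<lambda>_ _. 0"]) (auto simp: Suc)
qed simp

lemma times_cont_diff_bounded_linear:
  assumes "bounded_linear f"
  shows "times_cont_diff k f"
proof (cases k)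
  case 0
  then show ?thesis using assms by (simp add: linear_continuous_on)
next
  case (Suc j)
  show ?thesis unfolding Suc
    by (subst times_cont_diff_Suc_iff[where f' = "\<lambda>_. f"])
       (auto simp: times_cont_diff_const bounded_linear_imp_has_derivative assms)
qed

lemma times_cont_diff_add:
  "times_cont_diff k f \<Longrightarrow> times_cont_diff k g \<Longrightarrow> times_cont_diff k (\<lambda>x. f x + g x)"
proof (induction k arbitrary: f g)
  case 0
  then show ?case by (simp add: continuous_on_add)
next
  case (Suc k)
  then have d: "f differentiable (at x)" "g differentiable (at x)" for x by auto
  have "((\<lambda>x. f x + g x) has_derivative
        (\<lambda>v. frechet_derivative f (at x) v + frechet_derivative g (at x) v)) (at x)" for x
    using d[unfolded frechet_derivative_works] by (intro has_derivative_add) auto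
  then show ?case
    using Suc by (subst times_cont_diff_Suc_iff) auto
qed

lemma times_cont_diff_mult:
  fixes f g :: "'a::euclidean_space \<Rightarrow> real"
  shows "times_cont_diff k f \<Longrightarrow> times_cont_diff k g \<Longrightarrow> times_cont_diff k (\<lambda>x. f x * g x)"
proof (induction k arbitrary: f g)
  case 0
  then show ?case by (simp add: continuous_on_mult)
next
  case (Suc k)
  then have d: "f differentiable (at x)" "g differentiable (at x)" for x by auto
  have D: "((\<lambda>x. f x * g x) has_derivative
        (\<lambda>v. f x * frechet_derivative g (at x) v + frechet_derivative f (at x) v * g x)) (at x)" for x
    using d[unfolded frechet_derivative_works] by (intro has_derivative_mult) auto
  have "times_cont_diff k f" "times_cont_diff k g"
    using Suc.prems times_cont_diff_lower by blast+
  then show ?case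
    using Suc by (subst times_cont_diff_Suc_iff[OF D]) (auto intro!: times_cont_diff_add Suc.IH)
qed

lemma smooth_differentiable: "smooth f \<Longrightarrow> f differentiable (at x)"
  unfolding smooth_def by (metis times_cont_diff.simps(2))

lemma smooth_directional: "smooth f \<Longrightarrow> smooth (\<lambda>x. frechet_derivative f (at x) v)"
  unfolding smooth_def by (metis times_cont_diff.simps(2))

lemma smooth_continuous: "smooth f \<Longrightarrow> continuous_on UNIV f"
  unfolding smooth_def using times_cont_diff_continuous by blast

text \<open>The function \<open>exp (- 1 / s)\<close>, extended by \<open>0\<close> to \<open>s \<le> 0\<close>, is \<open>flat 0\<close>; the powers of \<open>1 / s\<close> are the
  ones that its derivatives produce.\<close>

definition flat :: "nat \<Rightarrow> real \<Rightarrow> real" where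
  "flat j s = (if 0 < s then (1 / s) ^ j * exp (- (1 / s)) else 0)"

lemma flat_nonneg: "0 \<le> flat j s"
  by (simp add: flat_def)

lemma flat_over_tendsto: "((\<lambda>s. flat j s / s) \<longlongrightarrow> 0) (at_right 0)"
proof -
  have "((\<lambda>x::real. x ^ Suc j / exp x) \<longlongrightarrow> 0) at_top"
    by (rule tendsto_power_div_exp_0)
  then have "((\<lambda>s::real. (inverse s) ^ Suc j / exp (inverse s)) \<longlongrightarrow> 0) (at_right 0)"
    by (rule filterlim_compose[OF _ filterlim_inverse_at_top_right])
  then show ?thesis
    by (rule Lim_transform_eventually)
       (auto simp: eventually_at_filter flat_def exp_minus field_simps intro!: always_eventually)
qed

text \<open>The functions \<open>flat j\<close> are closed under differentiation up to linear combinations, so all of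
  them are smooth at once.\<close>

lemma flat_deriv: "(flat j has_real_derivative flat (j + 2) s - j * flat (j + 1) s) (at s)"
proof (cases s "0::real" rule: linorder_cases)
  case greater
  have "((\<lambda>s. (1 / s) ^ j * exp (- (1 / s))) has_real_derivative
          flat (j + 2) s - j * flat (j + 1) s) (at s)"
  proof -
    define y where "y = 1 / s"
    have 1: "((\<lambda>s. 1 / s) has_real_derivative - y\<^sup>2) (at s)"
      using greater by (auto intro!: derivative_eq_intros simp: y_def power2_eq_square)
    have 2: "((\<lambda>y. y ^ j * exp (- y)) has_real_derivative
        (j * y ^ (j - 1) * exp (- y) - y ^ j * exp (- y))) (at (1 / s))"
      by (auto intro!: derivative_eq_intros simp: y_def)
    have "(j * y ^ (j - 1) * exp (- y) - y ^ j * exp (- y)) * - y\<^sup>2 = flat (j + 2) s - j * flat (j + 1) s"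
      using greater by (cases j) (auto simp: flat_def y_def[symmetric] power2_eq_square algebra_simps)
    then show ?thesis
      using DERIV_chain2[OF 2 1] by metis
  qed
  then show ?thesis
    by (rule has_field_derivative_transform_within_open[of _ _ _ "{0<..}"])
       (use greater in \<open>auto simp: flat_def\<close>)
next
  case less
  have "((\<lambda>s. 0) has_real_derivative 0) (at s)" by simp
  then have "(flat j has_real_derivative 0) (at s)"
    by (rule has_field_derivative_transform_within_open[of _ _ _ "{..<0}"])
       (use less in \<open>auto simp: flat_def\<close>)
  then show ?thesis using less by (simp add: flat_def)
next
  case equal
  have l: "((\<lambda>s. flat j s / s) \<longlongrightarrow> 0) (at_left 0)"
    by (rule Lim_transform_eventually[of "\<lambda>_. 0"])
       (auto simp: eventually_at_filter flat_def intro!: always_eventually)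
  have "((\<lambda>s. flat j s / s) \<longlongrightarrow> 0) (at 0)"
    using l flat_over_tendsto[of j] by (simp add: filterlim_split_at)
  then show ?thesis
    using equal by (simp add: has_field_derivative_iff flat_def)
qed

lemma flat_ball_times_cont_diff:
  fixes c :: real
  shows "times_cont_diff k (\<lambda>z::'a::euclidean_space. flat j (1 - c * (z \<bullet> z)))"
proof (induction k arbitrary: j)
  case 0
  have "continuous_on UNIV (flat j)"
    using flat_deriv by (metis DERIV_isCont continuous_at_imp_continuous_on)
  then have "continuous_on UNIV (flat j \<circ> (\<lambda>z::'a. 1 - c * (z \<bullet> z)))"
    by (intro continuous_on_compose continuous_intros) (auto intro: continuous_on_subset)
  then show ?case by (simp add: o_def)
next
  case (Suc k)
  define f' where "f' x v = (flat (j + 2) (1 - c * (x \<bullet> x)) - j * flat (j + 1) (1 - c * (x \<bullet> x))) *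
                        (- 2 * c * (x \<bullet> v))" for x v :: 'a
  have D: "((\<lambda>z::'a. flat j (1 - c * (z \<bullet> z))) has_derivative f' x) (at x)" for x
  proof -
    have 1: "((\<lambda>z::'a. 1 - c * (z \<bullet> z)) has_derivative (\<lambda>v. - 2 * c * (x \<bullet> v))) (at x)"
      by (auto intro!: derivative_eq_intros simp: inner_commute)
    have 2: "(flat j has_derivative
        (\<lambda>t. t * (flat (j + 2) (1 - c * (x \<bullet> x)) - j * flat (j + 1) (1 - c * (x \<bullet> x)))))
        (at (1 - c * (x \<bullet> x)))"
      using flat_deriv[of j "1 - c * (x \<bullet> x)"] unfolding has_field_derivative_def
      by (metis (no_types, lifting) ext mult.commute)
    show ?thesis
      using has_derivative_compose[OF 1 2] by (simp add: f'_def[abs_def] mult.commute)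
  qed
  have lin: "times_cont_diff k (\<lambda>x::'a. - 2 * c * (x \<bullet> v))" for v
    by (intro times_cont_diff_bounded_linear bounded_linear_mult_const bounded_linear_const_mult bounded_linear_inner_left)
  have 3: "times_cont_diff k (\<lambda>x::'a. flat (j + 2) (1 - c * (x \<bullet> x)) + (- real j) * flat (j + 1) (1 - c * (x \<bullet> x)))"
    by (intro times_cont_diff_add times_cont_diff_mult times_cont_diff_const Suc.IH)
  show ?case
    unfolding times_cont_diff_Suc_iff[OF D] f'_def
    using times_cont_diff_mult[OF 3 lin] by simp
qed

definition bump0 :: "'a::euclidean_space \<Rightarrow> real" where
  "bump0 h = flat 0 (1 - h \<bullet> h)"

definition bump :: "'a::euclidean_space \<Rightarrow> real" where
  "bump h = bump0 h / (LINT x|lborel. bump0 (x::'a))"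

lemma smooth_bump0_scaled:
  "smooth (\<lambda>z::'a::euclidean_space. c * bump0 (e *\<^sub>R z))"
proof -
  have "(\<lambda>z::'a. c * bump0 (e *\<^sub>R z)) = (\<lambda>z. c * flat 0 (1 - e\<^sup>2 * (z \<bullet> z)))"
    by (auto simp: bump0_def power2_eq_square algebra_simps)
  then show ?thesis
    unfolding smooth_def by (simp only:) (intro allI times_cont_diff_mult times_cont_diff_const flat_ball_times_cont_diff)
qed

lemma bump0_outside: "1 \<le> norm h \<Longrightarrow> bump0 h = 0"
  by (simp add: bump0_def flat_def dot_square_norm not_less one_le_power)

lemma bump0_pos: "norm h < 1 \<Longrightarrow> 0 < bump0 h"
  by (simp add: bump0_def flat_def dot_square_norm abs_square_less_1)

lemma continuous_bump0: "continuous_on S (bump0 :: 'a::euclidean_space \<Rightarrow> real)"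
  using smooth_continuous[OF smooth_bump0_scaled[of 1 1]] continuous_on_subset
  by (metis (no_types, lifting) UNIV_I continuous_on_cong mult_1 scaleR_one subsetI)

lemma bump0_nonneg: "0 \<le> bump0 h"
  by (simp add: bump0_def flat_nonneg)

lemma integrable_compact_support:
  fixes f :: "'a::euclidean_space \<Rightarrow> 'b::euclidean_space"
  assumes "continuous_on UNIV f" "\<And>x. norm x > R \<Longrightarrow> f x = 0"
  shows "integrable lborel f"
proof -
  have "integrable lborel (\<lambda>x. indicator (cball 0 R) x *\<^sub>R f x)"
    using assms by (intro borel_integrable_compact) (auto intro: continuous_on_subset)
  also have "(\<lambda>x. indicator (cball 0 R) x *\<^sub>R f x) = f"
    using assms by (auto simp: indicator_def not_le intro!: ext)
  finally show ?thesis .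
qed

lemma integrable_bump0: "integrable lborel (bump0 :: 'a::euclidean_space \<Rightarrow> real)"
  by (rule integrable_compact_support[of _ 1]) (auto simp: continuous_bump0 bump0_outside)

lemma bump0_integral_pos: "0 < (LINT x|lborel. bump0 (x::'a::euclidean_space))"
proof -
  have "(LINT x|lborel. bump0 (x::'a)) \<noteq> 0"
  proof
    assume "(LINT x|lborel. bump0 (x::'a)) = 0"
    then have "AE x in lborel. bump0 (x::'a) = 0"
      by (subst (asm) integral_nonneg_eq_0_iff_AE[OF integrable_bump0]) (auto simp: bump0_nonneg)
    then have "AE x in lebesgue. x \<notin> ball (0::'a) 1"
      using bump0_pos by (intro AE_completion) force
    then have "negligible (ball (0::'a) 1)"
      by (subst negligible_iff_null_sets, subst (asm) AE_iff_null_sets[symmetric]) auto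
    then show False
      using open_not_negligible[of "ball (0::'a) 1"] by simp
  qed
  moreover have "0 \<le> (LINT x|lborel. bump0 (x::'a))"
    by (simp add: bump0_nonneg)
  ultimately show ?thesis by linarith
qed

lemma bump_nonneg: "0 \<le> bump h"
  using bump0_integral_pos by (simp add: bump_def bump0_nonneg less_imp_le)

lemma bump_outside: "1 \<le> norm h \<Longrightarrow> bump h = 0"
  by (simp add: bump_def bump0_outside)

lemma bump_even: "bump (- h) = bump h"
  by (simp add: bump_def bump0_def)

lemma integral_bump: "(LINT h|lborel. bump (h::'a::euclidean_space)) = 1"
  using bump0_integral_pos[where 'a='a] by (simp add: bump_def)

lemma integrable_bump: "integrable lborel (bump :: 'a::euclidean_space \<Rightarrow> real)"
  unfolding bump_def by (intro integrable_divide_zero integrable_bump0)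

lemma smooth_bump_scaled: "smooth (\<lambda>z::'a::euclidean_space. c * bump (e *\<^sub>R z))"
  using smooth_bump0_scaled[of "c / (LINT x|lborel. bump0 (x::'a))" e] by (simp add: bump_def)

lemma smooth_bump: "smooth (bump :: 'a::euclidean_space \<Rightarrow> real)"
  using smooth_bump_scaled[of 1 1] by simp

lemma bump_measurable[measurable]: "bump \<in> borel_measurable (borel::'a::euclidean_space measure)"
  using smooth_continuous[OF smooth_bump] by (rule borel_measurable_continuous_onI)

section \<open>Gradients\<close>

text \<open>The gradient is an argument, so that the product and chain rules deliver it as an explicit vector
  field; the inner product with it then covers time and space derivatives at once.\<close>

definition c1 :: "('a::euclidean_space \<Rightarrow> real) \<Rightarrow> ('a \<Rightarrow> 'a) \<Rightarrow> bool" where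
  "c1 g Dg \<longleftrightarrow> (\<forall>z. (g has_derivative (\<lambda>v. Dg z \<bullet> v)) (at z)) \<and> continuous_on UNIV Dg"

definition nabla :: "('a::euclidean_space \<Rightarrow> real) \<Rightarrow> 'a \<Rightarrow> 'a" where
  "nabla g z = (\<Sum>b\<in>Basis. frechet_derivative g (at z) b *\<^sub>R b)"

lemma c1D: "c1 g Dg \<Longrightarrow> (g has_derivative (\<lambda>v. Dg z \<bullet> v)) (at z)"
  by (simp add: c1_def)

lemma c1_cont: "c1 g Dg \<Longrightarrow> continuous_on UNIV Dg"
  by (simp add: c1_def)

lemma c1_continuous: "c1 g Dg \<Longrightarrow> continuous_on UNIV g"
  by (meson c1D continuous_at_imp_continuous_on has_derivative_continuous)

lemma nabla_inner:
  assumes "g differentiable (at z)"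
  shows "nabla g z \<bullet> v = frechet_derivative g (at z) v"
proof -
  have l: "linear (frechet_derivative g (at z))"
    using assms by (rule linear_frechet_derivative)
  have "frechet_derivative g (at z) v = frechet_derivative g (at z) (\<Sum>b\<in>Basis. (v \<bullet> b) *\<^sub>R b)"
    by (simp add: euclidean_representation)
  also have "\<dots> = (\<Sum>b\<in>Basis. (v \<bullet> b) * frechet_derivative g (at z) b)"
    by (simp add: linear_sum[OF l] linear_cmul[OF l])
  also have "\<dots> = nabla g z \<bullet> v"
    by (simp add: nabla_def inner_sum_left inner_commute[of v] mult.commute)
  finally show ?thesis ..
qed

lemma smooth_c1:
  assumes "smooth g"
  shows "c1 g (nabla g)"
proof -
  have "continuous_on UNIV (nabla g)"
    unfolding nabla_def using smooth_continuous[OF smooth_directional[OF assms]]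
    by (intro continuous_intros)
  moreover have "(g has_derivative (\<lambda>v. nabla g z \<bullet> v)) (at z)" for z
    using smooth_differentiable[OF assms, of z]
    by (simp add: nabla_inner frechet_derivative_works[symmetric])
  ultimately show ?thesis by (simp add: c1_def)
qed

lemma has_gradient_unique:
  fixes a b :: "'a::euclidean_space"
  assumes "(g has_derivative (\<lambda>v. a \<bullet> v)) (at z)" "(g has_derivative (\<lambda>v. b \<bullet> v)) (at z)"
  shows "a = b"
  using has_derivative_unique[OF assms] by (metis inner_commute vector_eq_rdot)

lemma c1_nabla: "c1 g Dg \<Longrightarrow> nabla g = Dg"
proof
  fix z assume g: "c1 g Dg"
  have d: "g differentiable (at z)" using c1D[OF g] by (auto simp: differentiable_def)
  have "(g has_derivative (\<lambda>v. nabla g z \<bullet> v)) (at z)"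
    using d by (simp add: nabla_inner frechet_derivative_works[symmetric])
  then show "nabla g z = Dg z" using c1D[OF g] has_gradient_unique by blast
qed

lemma c1_const: "c1 (\<lambda>_. c) (\<lambda>_. 0)"
  by (simp add: c1_def)

lemma c1_add: "c1 f Df \<Longrightarrow> c1 g Dg \<Longrightarrow> c1 (\<lambda>z. f z + g z) (\<lambda>z. Df z + Dg z)"
  unfolding c1_def inner_add_left by (auto intro!: has_derivative_add continuous_intros)

lemma c1_sum:
  "finite I \<Longrightarrow> (\<And>i. i \<in> I \<Longrightarrow> c1 (f i) (Df i)) \<Longrightarrow> c1 (\<lambda>z. \<Sum>i\<in>I. f i z) (\<lambda>z. \<Sum>i\<in>I. Df i z)"
  by (induction I rule: finite_induct) (auto simp: c1_const c1_add)

lemma c1_mult: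
  assumes "c1 f Df" "c1 g Dg"
  shows "c1 (\<lambda>z. f z * g z) (\<lambda>z. f z *\<^sub>R Dg z + g z *\<^sub>R Df z)"
proof -
  have "((\<lambda>z. f z * g z) has_derivative (\<lambda>v. (f z *\<^sub>R Dg z + g z *\<^sub>R Df z) \<bullet> v)) (at z)" for z
    using has_derivative_mult[OF c1D[OF assms(1)] c1D[OF assms(2)], of z]
    by (simp add: inner_add_left mult.commute)
  moreover have "continuous_on UNIV (\<lambda>z. f z *\<^sub>R Dg z + g z *\<^sub>R Df z)"
    using c1_cont[OF assms(1)] c1_cont[OF assms(2)] c1_continuous[OF assms(1)] c1_continuous[OF assms(2)]
    by (intro continuous_intros)
  ultimately show ?thesis by (simp add: c1_def)
qed

lemma c1_compose:
  assumes "c1 g Dg" "\<And>x. (P has_real_derivative P1 x) (at x)" "continuous_on UNIV P1"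
  shows "c1 (\<lambda>z. P (g z)) (\<lambda>z. P1 (g z) *\<^sub>R Dg z)"
proof -
  have "((\<lambda>z. P (g z)) has_derivative (\<lambda>v. (P1 (g z) *\<^sub>R Dg z) \<bullet> v)) (at z)" for z
    using has_derivative_compose[OF c1D[OF assms(1), of z] assms(2)[unfolded has_field_derivative_def, of "g z"]]
    by simp
  moreover have "continuous_on UNIV (\<lambda>z. P1 (g z) *\<^sub>R Dg z)"
    using c1_cont[OF assms(1)] c1_continuous[OF assms(1)] assms(3)
    by (intro continuous_intros) (auto intro: continuous_on_compose2)
  ultimately show ?thesis by (simp add: c1_def)
qed

lemma gradient_zero_on_open:
  fixes D :: "'a::euclidean_space"
  assumes "(g has_derivative (\<lambda>v. D \<bullet> v)) (at z)" "open S" "z \<in> S" "\<And>y. y \<in> S \<Longrightarrow> g y = 0"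
  shows "D = 0"
proof -
  have "(g has_derivative (\<lambda>v. 0 \<bullet> v)) (at z)"
    by (rule has_derivative_transform_within_open[of "\<lambda>_. 0" _ _ _ S]) (use assms in auto)
  then show ?thesis using has_gradient_unique assms(1) by blast
qed

section \<open>Convolution with a smooth kernel\<close>

definition locint :: "('a::euclidean_space \<Rightarrow> 'b::euclidean_space) \<Rightarrow> bool" where
  "locint f \<longleftrightarrow> f \<in> borel_measurable borel \<and> (\<forall>R. set_integrable lborel (cball 0 R) f)"

text \<open>The kernel is not reflected; the one used below is even.\<close>

definition conv :: "('a::euclidean_space \<Rightarrow> real) \<Rightarrow> ('a \<Rightarrow> real) \<Rightarrow> 'a \<Rightarrow> real" where
  "conv \<psi> f z = (LINT w|lborel. \<psi> (w - z) * f w)"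

lemma bounded_of_compact_support:
  fixes f :: "'a::euclidean_space \<Rightarrow> 'b::real_normed_vector"
  assumes "continuous_on UNIV f" "\<And>x. norm x > R \<Longrightarrow> f x = 0"
  obtains B where "0 \<le> B" "\<And>x. norm (f x) \<le> B"
proof -
  have "compact (f ` cball 0 R)"
    by (rule compact_continuous_image) (use assms in \<open>auto intro: continuous_on_subset\<close>)
  then obtain B where B: "\<And>x. x \<in> cball 0 R \<Longrightarrow> norm (f x) \<le> B"
    using compact_imp_bounded by (fastforce simp: bounded_iff)
  have "norm (f x) \<le> max B 0" for x
    using B[of x] assms(2)[of x] by (cases "norm x \<le> R") (auto simp: le_max_iff_disj)
  then show ?thesis using that[of "max B 0"] by simp
qed

lemma uniformly_continuous_of_compact_support:
  fixes f :: "'a::euclidean_space \<Rightarrow> 'b::real_normed_vector"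
  assumes "continuous_on UNIV f" "\<And>x. norm x > R \<Longrightarrow> f x = 0" "0 < e"
  obtains d where "0 < d" "\<And>x y. dist x y < d \<Longrightarrow> dist (f x) (f y) < e"
proof -
  have "uniformly_continuous_on (cball 0 (R + 2)) f"
    by (rule compact_uniformly_continuous) (use assms in \<open>auto intro: continuous_on_subset\<close>)
  then obtain d where d: "0 < d"
    "\<And>x y. x \<in> cball 0 (R + 2) \<Longrightarrow> y \<in> cball 0 (R + 2) \<Longrightarrow> dist x y < d \<Longrightarrow> dist (f x) (f y) < e"
    using \<open>0 < e\<close> unfolding uniformly_continuous_on_def by meson
  have "dist (f x) (f y) < e" if "dist x y < min d 1" for x y
  proof (cases "x \<in> cball 0 (R + 2) \<and> y \<in> cball 0 (R + 2)")
    case True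
    then show ?thesis using d that by auto
  next
    case False
    have "norm x \<le> norm y + dist x y" "norm y \<le> norm x + dist x y"
      by (simp_all add: dist_norm norm_triangle_sub norm_minus_commute[of x y])
         (metis norm_minus_commute norm_triangle_sub)
    then have "norm x > R \<and> norm y > R" using False that by auto
    then show ?thesis using assms by simp
  qed
  then show ?thesis using that[of "min d 1"] d by simp
qed

lemma conv_integrable:
  fixes \<psi> :: "'a::euclidean_space \<Rightarrow> 'b::euclidean_space" and f :: "'a \<Rightarrow> real"
  assumes "continuous_on UNIV \<psi>" "\<And>x. norm x > R \<Longrightarrow> \<psi> x = 0" "locint f"
  shows "integrable lborel (\<lambda>w. f w *\<^sub>R \<psi> (w - z))"
proof -
  obtain B where B: "0 \<le> B" "\<And>x. norm (\<psi> x) \<le> B"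
    using bounded_of_compact_support[OF assms(1,2)] by metis
  have fm: "f \<in> borel_measurable borel" using assms(3) by (simp add: locint_def)
  have pm: "\<psi> \<in> borel_measurable borel" using assms(1) by (rule borel_measurable_continuous_onI)
  have i: "integrable lborel (\<lambda>w. B * (indicator (cball 0 (norm z + R)) w *\<^sub>R f w))"
    using assms(3) by (intro integrable_mult_right) (auto simp: locint_def set_integrable_def)
  show ?thesis
  proof (rule Bochner_Integration.integrable_bound[OF i])
    show "AE w in lborel. norm (f w *\<^sub>R \<psi> (w - z)) \<le> norm (B * (indicator (cball 0 (norm z + R)) w *\<^sub>R f w))"
    proof (rule AE_I2)
      fix w
      show "norm (f w *\<^sub>R \<psi> (w - z)) \<le> norm (B * (indicator (cball 0 (norm z + R)) w *\<^sub>R f w))"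
      proof (cases "norm w \<le> norm z + R")
        case True
        then show ?thesis using B mult_left_mono[OF B(2)[of "w - z"], of "\<bar>f w\<bar>"]
          by (simp add: mult.commute abs_mult)
      next
        case False
        then have "norm (w - z) > R" using norm_triangle_ineq2[of w z] by linarith
        then show ?thesis using assms(2) by simp
      qed
    qed
  qed (use fm pm in measurable)
qed

text \<open>Differentiation under the integral sign: the difference quotients of the kernel converge
  uniformly, with supports in one bounded set.\<close>

lemma conv_has_derivative:
  fixes \<psi> :: "'a::euclidean_space \<Rightarrow> real"
  assumes \<psi>: "c1 \<psi> D\<psi>" and R: "\<And>x. norm x > R \<Longrightarrow> \<psi> x = 0" and f: "locint f"
  shows "(conv \<psi> f has_derivative (\<lambda>v. - (LINT w|lborel. f w *\<^sub>R D\<psi> (w - z)) \<bullet> v)) (at z)"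
proof -
  have R': "D\<psi> x = 0" if "norm x > R" for x
  proof (rule gradient_zero_on_open[OF c1D[OF \<psi>], of "{y. norm y > R}"])
    show "open {y::'a. R < norm y}" by (intro open_Collect_less continuous_intros)
  qed (use R that in auto)
  note contD = c1_cont[OF \<psi>] and cont = c1_continuous[OF \<psi>]
  note int = conv_integrable[where R = R, OF cont R f, simplified]
  note intD = conv_integrable[where R = R, OF contD R' f]
  let ?S = "cball (0::'a) (norm z + R + 1)"
  define I where "I = (LINT w|lborel. indicator ?S w * \<bar>f w\<bar>)"
  have Ii: "integrable lborel (\<lambda>w. indicator ?S w * \<bar>f w\<bar>)"
  proof -
    have "integrable lborel (\<lambda>w. norm (indicator ?S w *\<^sub>R f w))"
      using f by (intro integrable_norm) (auto simp: locint_def set_integrable_def)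
    then show ?thesis by (simp add: abs_mult)
  qed
  have I0: "0 \<le> I" unfolding I_def by (simp add: integral_nonneg_AE)
  have "\<exists>d>0. \<forall>y. norm (y - z) < d \<longrightarrow>
      norm (conv \<psi> f y - conv \<psi> f z - - (LINT w|lborel. f w *\<^sub>R D\<psi> (w - z)) \<bullet> (y - z))
      \<le> e * norm (y - z)" if e: "0 < e" for e
  proof -
    have e': "0 < e / (I + 1)" using e I0 by simp
    obtain d where d: "0 < d" "\<And>x y. dist x y < d \<Longrightarrow> dist (D\<psi> x) (D\<psi> y) < e / (I + 1)"
      using uniformly_continuous_of_compact_support[OF contD R' e'] by metis
    have "norm (conv \<psi> f y - conv \<psi> f z - - (LINT w|lborel. f w *\<^sub>R D\<psi> (w - z)) \<bullet> (y - z))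
      \<le> e * norm (y - z)" if y: "norm (y - z) < min d 1" for y
    proof -
      define E where "E w = \<psi> (w - y) - \<psi> (w - z) + D\<psi> (w - z) \<bullet> (y - z)" for w
      have E: "\<bar>E w\<bar> \<le> indicator ?S w * (norm (y - z) * (e / (I + 1)))" for w
      proof (cases "w \<in> ?S")
        case True
        have "norm (\<psi> (w - y) - \<psi> (w - z) - D\<psi> (w - z) \<bullet> ((w - y) - (w - z)))
              \<le> norm ((w - y) - (w - z)) * (e / (I + 1))"
        proof (rule differentiable_bound_linearization[where S = "ball (w - z) d" and f' = "\<lambda>x v. D\<psi> x \<bullet> v"])
          show "w - z + t *\<^sub>R (w - y - (w - z)) \<in> ball (w - z) d" if "t \<in> {0..1}" for t
          proof -
            have "norm (t *\<^sub>R (y - z)) \<le> norm (y - z)"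
              using that by (auto intro: mult_left_le_one_le)
            then show ?thesis using y by (simp add: dist_norm norm_minus_commute)
          qed
          show "(\<psi> has_derivative (\<bullet>) (D\<psi> x)) (at x within ball (w - z) d)" for x
            using c1D[OF \<psi>] by (rule has_derivative_at_withinI)
          show "onorm ((\<bullet>) (D\<psi> x) - (\<bullet>) (D\<psi> (w - z))) \<le> e / (I + 1)" if "x \<in> ball (w - z) d" for x
          proof (rule onorm_le)
            fix v
            have "norm (((\<bullet>) (D\<psi> x) - (\<bullet>) (D\<psi> (w - z))) v) \<le> norm (D\<psi> x - D\<psi> (w - z)) * norm v"
              using Cauchy_Schwarz_ineq2[of "D\<psi> x - D\<psi> (w - z)" v] by (simp add: inner_diff_left)
            also have "\<dots> \<le> e / (I + 1) * norm v"
              using d(2)[of "w - z" x] that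
              by (intro mult_right_mono) (auto simp: dist_norm norm_minus_commute)
            finally show "norm (((\<bullet>) (D\<psi> x) - (\<bullet>) (D\<psi> (w - z))) v) \<le> e / (I + 1) * norm v" .
          qed
        qed (use d in auto)
        moreover have "E w = \<psi> (w - y) - \<psi> (w - z) - D\<psi> (w - z) \<bullet> ((w - y) - (w - z))"
          by (simp add: E_def inner_diff_right)
        ultimately show ?thesis using True by (simp add: norm_minus_commute)
      next
        case False
        have "norm w \<le> norm (w - y) + norm (y - z) + norm z" "norm w \<le> norm (w - z) + norm z"
          using norm_triangle_ineq[of "w - y" "y - z"] norm_triangle_ineq[of "w - z" z] by simp_all
        then have "norm (w - y) > R" "norm (w - z) > R" using False y by auto
        then show ?thesis using False R R' by (simp add: E_def)
      qed
      have "conv \<psi> f y - conv \<psi> f z - - (LINT w|lborel. f w *\<^sub>R D\<psi> (w - z)) \<bullet> (y - z)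
          = (LINT w|lborel. f w * E w)"
      proof -
        have "(LINT w|lborel. f w *\<^sub>R D\<psi> (w - z)) \<bullet> (y - z) = (LINT w|lborel. f w * (D\<psi> (w - z) \<bullet> (y - z)))"
          using integral_inner_left[of "y - z" lborel "\<lambda>w. f w *\<^sub>R D\<psi> (w - z)"] intD by simp
        moreover have "integrable lborel (\<lambda>w. f w * (D\<psi> (w - z) \<bullet> (y - z)))"
          using integrable_inner_left[of "y - z" lborel "\<lambda>w. f w *\<^sub>R D\<psi> (w - z)"] intD by simp
        moreover have "(LINT w|lborel. f w * E w) = (LINT w|lborel. f w * \<psi> (w - y) - f w * \<psi> (w - z)
            + f w * (D\<psi> (w - z) \<bullet> (y - z)))"
          by (simp only: E_def ring_distribs)
        ultimately show ?thesis
          using int[of y] int[of z] by (simp add: conv_def mult.commute[of "\<psi> _"])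
      qed
      also have "\<bar>\<dots>\<bar> \<le> (LINT w|lborel. (indicator ?S w * \<bar>f w\<bar>) * (norm (y - z) * (e / (I + 1))))"
      proof -
        have "\<bar>f w * E w\<bar> \<le> (indicator ?S w * \<bar>f w\<bar>) * (norm (y - z) * (e / (I + 1)))" for w
          using mult_left_mono[OF E[of w], of "\<bar>f w\<bar>"] by (simp add: abs_mult algebra_simps)
        then show ?thesis
          using Ii Bochner_Integration.integral_norm_bound_integral[of lborel "\<lambda>w. f w * E w" "\<lambda>w. (indicator ?S w * \<bar>f w\<bar>) * (norm (y - z) * (e / (I + 1)))"]
          by (cases "integrable lborel (\<lambda>w. f w * E w)")
             (auto simp: not_integrable_integral_eq I0 e integral_nonneg_AE less_imp_le intro!: integral_nonneg_AE)
      qed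
      also have "\<dots> = I * (norm (y - z) * (e / (I + 1)))"
        by (simp add: I_def)
      also have "\<dots> \<le> e * norm (y - z)"
      proof -
        have "I * (e / (I + 1)) \<le> e" using I0 e by (simp add: field_simps)
        then show ?thesis using mult_right_mono[of "I * (e / (I + 1))" e "norm (y - z)"] by (simp add: mult.assoc mult.commute mult.left_commute)
      qed
      finally show ?thesis by simp
    qed
    then show ?thesis using d by (intro exI[of _ "min d 1"]) simp
  qed
  then show ?thesis
    unfolding has_derivative_at_alt by (auto intro: bounded_linear_inner_right)
qed

lemma conv_times_cont_diff:
  fixes \<psi> :: "'a::euclidean_space \<Rightarrow> real"
  assumes f: "locint f"
  shows "smooth \<psi> \<Longrightarrow> (\<And>x. norm x > R \<Longrightarrow> \<psi> x = 0) \<Longrightarrow> times_cont_diff k (conv \<psi> f)"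
proof (induction k arbitrary: \<psi>)
  case 0
  have "isCont (conv \<psi> f) z" for z
    using conv_has_derivative[OF smooth_c1[OF 0(1)] 0(2) f] has_derivative_continuous by blast
  then show ?case by (simp add: continuous_at_imp_continuous_on)
next
  case (Suc k)
  note c = smooth_c1[OF Suc(2)]
  have R': "nabla \<psi> x = 0" if "norm x > R" for x
  proof (rule gradient_zero_on_open[OF c1D[OF c], of "{y. norm y > R}"])
    show "open {y::'a. R < norm y}" by (intro open_Collect_less continuous_intros)
  qed (use Suc that in auto)
  have D: "- (LINT w|lborel. f w *\<^sub>R nabla \<psi> (w - z)) \<bullet> v
      = conv (\<lambda>y. - 1 * frechet_derivative \<psi> (at y) v) f z" for v z
    using integral_inner_left[of v lborel "\<lambda>w. f w *\<^sub>R nabla \<psi> (w - z)"] conv_integrable[where R = R and z = z, OF c1_cont[OF c] R' f]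
    by (simp add: conv_def nabla_inner smooth_differentiable[OF Suc(2)] mult.commute)
  have DD: "(conv \<psi> f has_derivative (\<lambda>v. conv (\<lambda>y. - 1 * frechet_derivative \<psi> (at y) v) f z)) (at z)" for z
    using conv_has_derivative[where R = R and z = z, OF c Suc(3) f] unfolding D .
  show ?case
  proof (subst times_cont_diff_Suc_iff[OF DD], intro allI Suc.IH)
    fix v
    show "smooth (\<lambda>y. - 1 * frechet_derivative \<psi> (at y) v)"
      unfolding smooth_def using smooth_directional[OF Suc(2)]
      by (intro allI times_cont_diff_mult times_cont_diff_const) (simp add: smooth_def)
    show "- 1 * frechet_derivative \<psi> (at x) v = 0" if "norm x > R" for x
      using R'[OF that] nabla_inner[OF smooth_differentiable[OF Suc(2)], of x v] by simp
  qed
qed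

section \<open>Mollification\<close>

text \<open>The scale sits in the argument of \<open>f\<close>, so that averages at all scales are taken over the same unit
  ball.\<close>

definition mol :: "real \<Rightarrow> ('a::euclidean_space \<Rightarrow> 'b::euclidean_space) \<Rightarrow> 'a \<Rightarrow> 'b" where
  "mol \<epsilon> f z = (LINT h|lborel. bump h *\<^sub>R f (z + \<epsilon> *\<^sub>R h))"

text \<open>The gradient of \<open>mol \<epsilon> f\<close>, with the derivative moved onto the kernel.\<close>

definition dmol :: "real \<Rightarrow> ('a::euclidean_space \<Rightarrow> real) \<Rightarrow> 'a \<Rightarrow> 'a" where
  "dmol \<epsilon> f z = - (1 / \<epsilon>) *\<^sub>R (LINT h|lborel. f (z + \<epsilon> *\<^sub>R h) *\<^sub>R nabla bump h)"

lemma integral_affine: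
  fixes G :: "'a::euclidean_space \<Rightarrow> 'b::euclidean_space"
  assumes [measurable]: "G \<in> borel_measurable borel" and "c \<noteq> 0"
  shows "(LINT w|lborel. G w) = \<bar>c\<bar> ^ DIM('a) *\<^sub>R (LINT h|lborel. G (t + c *\<^sub>R h))"
    and "integrable lborel (\<lambda>h. G (t + c *\<^sub>R h)) \<longleftrightarrow> integrable lborel G"
proof -
  have "(LINT w|lborel. G w) = (LINT w|density (distr lborel borel (\<lambda>x. t + c *\<^sub>R x)) (\<lambda>_. \<bar>c\<bar> ^ DIM('a)). G w)"
    using lborel_affine[OF \<open>c \<noteq> 0\<close>, of t] by simp
  also have "\<dots> = (LINT w|(distr lborel borel (\<lambda>x. t + c *\<^sub>R x)). \<bar>c\<bar> ^ DIM('a) *\<^sub>R G w)"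
    by (subst integral_density) auto
  also have "\<dots> = \<bar>c\<bar> ^ DIM('a) *\<^sub>R (LINT h|lborel. G (t + c *\<^sub>R h))"
    by (subst integral_distr) auto
  finally show "(LINT w|lborel. G w) = \<bar>c\<bar> ^ DIM('a) *\<^sub>R (LINT h|lborel. G (t + c *\<^sub>R h))" .
  have "integrable lborel G \<longleftrightarrow> integrable (density (distr lborel borel (\<lambda>x. t + c *\<^sub>R x)) (\<lambda>_. \<bar>c\<bar> ^ DIM('a))) G"
    using lborel_affine[OF \<open>c \<noteq> 0\<close>, of t] by simp
  also have "\<dots> \<longleftrightarrow> integrable (distr lborel borel (\<lambda>x. t + c *\<^sub>R x)) (\<lambda>w. \<bar>c\<bar> ^ DIM('a) *\<^sub>R G w)"
    by (subst integrable_density) auto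
  also have "\<dots> \<longleftrightarrow> integrable lborel (\<lambda>h. \<bar>c\<bar> ^ DIM('a) *\<^sub>R G (t + c *\<^sub>R h))"
    by (subst integrable_distr_eq) auto
  also have "\<dots> \<longleftrightarrow> integrable lborel (\<lambda>h. G (t + c *\<^sub>R h))"
    using \<open>c \<noteq> 0\<close> integrable_scaleR_right[of "\<bar>c\<bar> ^ DIM('a)" lborel "\<lambda>h. G (t + c *\<^sub>R h)"]
      integrable_scaleR_right[of "1 / \<bar>c\<bar> ^ DIM('a)" lborel "\<lambda>h. \<bar>c\<bar> ^ DIM('a) *\<^sub>R G (t + c *\<^sub>R h)"] by auto
  finally show "integrable lborel (\<lambda>h. G (t + c *\<^sub>R h)) \<longleftrightarrow> integrable lborel G" ..
qed

lemma locint_shift: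
  fixes f :: "'a::euclidean_space \<Rightarrow> 'b::euclidean_space"
  assumes "locint f" "\<epsilon> \<noteq> 0"
  shows "locint (\<lambda>h. f (z + \<epsilon> *\<^sub>R h))"
  unfolding locint_def
proof (intro conjI allI)
  have [measurable]: "f \<in> borel_measurable borel" using assms by (simp add: locint_def)
  show m[measurable]: "(\<lambda>h. f (z + \<epsilon> *\<^sub>R h)) \<in> borel_measurable borel" by measurable
  fix R
  have "integrable lborel (\<lambda>w. indicator (cball 0 (norm z + \<bar>\<epsilon>\<bar> * R)) w *\<^sub>R f w)"
    using assms by (simp add: locint_def set_integrable_def)
  then have i: "integrable lborel (\<lambda>h. indicator (cball 0 (norm z + \<bar>\<epsilon>\<bar> * R)) (z + \<epsilon> *\<^sub>R h) *\<^sub>R f (z + \<epsilon> *\<^sub>R h))"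
    by (subst integral_affine(2)[OF _ assms(2), where G = "\<lambda>w. indicator (cball 0 (norm z + \<bar>\<epsilon>\<bar> * R)) w *\<^sub>R f w"]) auto
  show "set_integrable lborel (cball 0 R) (\<lambda>h. f (z + \<epsilon> *\<^sub>R h))"
    unfolding set_integrable_def
  proof (rule Bochner_Integration.integrable_bound[OF i])
    show "AE h in lborel. norm (indicator (cball 0 R) h *\<^sub>R f (z + \<epsilon> *\<^sub>R h)) \<le>
       norm (indicator (cball 0 (norm z + \<bar>\<epsilon>\<bar> * R)) (z + \<epsilon> *\<^sub>R h) *\<^sub>R f (z + \<epsilon> *\<^sub>R h))"
    proof (rule AE_I2)
      fix h
      have "norm (z + \<epsilon> *\<^sub>R h) \<le> norm z + \<bar>\<epsilon>\<bar> * R" if "norm h \<le> R"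
        using norm_triangle_ineq[of z "\<epsilon> *\<^sub>R h"] mult_left_mono[OF that, of "\<bar>\<epsilon>\<bar>"] by simp
      then show "norm (indicator (cball 0 R) h *\<^sub>R f (z + \<epsilon> *\<^sub>R h)) \<le>
         norm (indicator (cball 0 (norm z + \<bar>\<epsilon>\<bar> * R)) (z + \<epsilon> *\<^sub>R h) *\<^sub>R f (z + \<epsilon> *\<^sub>R h))"
        by (auto simp: indicator_def)
    qed
  qed (intro borel_measurable_scaleR borel_measurable_indicator, use m in auto)
qed

lemma locint_kernel_integrable:
  fixes f :: "'a::euclidean_space \<Rightarrow> 'b::euclidean_space" and k :: "'a \<Rightarrow> real"
  assumes "locint f" "continuous_on UNIV k" "\<And>x. norm x > R \<Longrightarrow> k x = 0"
  shows "integrable lborel (\<lambda>h. k h *\<^sub>R f h)"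
proof -
  obtain B where B: "0 \<le> B" "\<And>x. norm (k x) \<le> B"
    using bounded_of_compact_support[OF assms(2,3)] by metis
  have fm[measurable]: "f \<in> borel_measurable borel" using assms(1) by (simp add: locint_def)
  have pm[measurable]: "k \<in> borel_measurable borel" using assms(2) by (rule borel_measurable_continuous_onI)
  have i: "integrable lborel (\<lambda>w. B *\<^sub>R (indicator (cball 0 R) w *\<^sub>R f w))"
    using assms(1) by (intro integrable_scaleR_right) (auto simp: locint_def set_integrable_def)
  show ?thesis
    by (rule Bochner_Integration.integrable_bound[OF i])
       (use B assms(3) in \<open>auto simp: indicator_def not_le intro!: AE_I2 mult_right_mono\<close>)
qed

lemma bump_outside': "1 < norm h \<Longrightarrow> bump h = 0"
  using bump_outside[of h] by simp

lemma mol_integrable: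
  "locint f \<Longrightarrow> \<epsilon> \<noteq> 0 \<Longrightarrow> integrable lborel (\<lambda>h. bump h *\<^sub>R f (z + \<epsilon> *\<^sub>R h))"
  using locint_kernel_integrable[OF locint_shift smooth_continuous[OF smooth_bump] bump_outside'] by blast

lemma mol_conv:
  fixes f :: "'a::euclidean_space \<Rightarrow> real"
  assumes f: "locint f" and \<epsilon>: "0 < \<epsilon>"
  shows "mol \<epsilon> f z = conv (\<lambda>y. (1 / \<epsilon>) ^ DIM('a) * bump ((1 / \<epsilon>) *\<^sub>R y)) f z"
proof -
  have [measurable]: "f \<in> borel_measurable borel" using f by (simp add: locint_def)
  have "conv (\<lambda>y. (1 / \<epsilon>) ^ DIM('a) * bump ((1 / \<epsilon>) *\<^sub>R y)) f z
    = \<epsilon> ^ DIM('a) *\<^sub>R (LINT h|lborel. (1 / \<epsilon>) ^ DIM('a) * bump ((1 / \<epsilon>) *\<^sub>R (z + \<epsilon> *\<^sub>R h - z)) * f (z + \<epsilon> *\<^sub>R h))"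
    unfolding conv_def using \<epsilon> by (subst integral_affine(1)[where c = \<epsilon> and t = z]) auto
  also have "\<dots> = mol \<epsilon> f z"
    using \<epsilon> by (simp add: mol_def mult.assoc power_divide)
  finally show ?thesis ..
qed

lemma scaled_bump_outside:
  fixes x :: "'a::euclidean_space"
  assumes "0 < \<epsilon>" "norm x > \<epsilon>"
  shows "(1 / \<epsilon>) ^ DIM('a) * bump ((1 / \<epsilon>) *\<^sub>R x) = 0"
  using assms by (auto intro!: bump_outside simp: field_simps)

lemma smooth_mol:
  fixes f :: "'a::euclidean_space \<Rightarrow> real"
  assumes "locint f" "0 < \<epsilon>"
  shows "smooth (mol \<epsilon> f)"
proof -
  have "mol \<epsilon> f = conv (\<lambda>y. (1 / \<epsilon>) ^ DIM('a) * bump ((1 / \<epsilon>) *\<^sub>R y)) f"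
    using mol_conv[OF assms] by blast
  then show ?thesis
    unfolding smooth_def
    using conv_times_cont_diff[OF assms(1) smooth_bump_scaled scaled_bump_outside[OF assms(2)]] by metis
qed

lemma nabla_bump_outside: "1 < norm h \<Longrightarrow> nabla bump (h::'a::euclidean_space) = 0"
proof (rule gradient_zero_on_open[OF c1D[OF smooth_c1[OF smooth_bump]], of "{y. norm y > 1}"])
  show "open {y::'a. 1 < norm y}" by (intro open_Collect_less continuous_intros)
qed (auto simp: bump_outside')

lemma continuous_nabla_bump: "continuous_on UNIV (nabla (bump::'a::euclidean_space \<Rightarrow> real))"
  by (rule c1_cont[OF smooth_c1[OF smooth_bump]])

lemma nabla_bump_measurable[measurable]: "nabla bump \<in> borel_measurable (borel::'a::euclidean_space measure)"
  using continuous_nabla_bump by (rule borel_measurable_continuous_onI)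

lemma mol_c1:
  fixes f :: "'a::euclidean_space \<Rightarrow> real"
  assumes f: "locint f" and \<epsilon>: "0 < \<epsilon>"
  shows "c1 (mol \<epsilon> f) (dmol \<epsilon> f)"
proof -
  have [measurable]: "f \<in> borel_measurable borel" using f by (simp add: locint_def)
  define k :: "'a \<Rightarrow> real" where "k y = (1 / \<epsilon>) ^ DIM('a) * bump ((1 / \<epsilon>) *\<^sub>R y)" for y
  define Dk :: "'a \<Rightarrow> 'a" where "Dk y = (1 / \<epsilon>) ^ DIM('a) *\<^sub>R (1 / \<epsilon>) *\<^sub>R nabla bump ((1 / \<epsilon>) *\<^sub>R y)" for y
  have kD: "(k has_derivative (\<lambda>v. Dk y \<bullet> v)) (at y)" for y
  proof -
    have "((\<lambda>y::'a. (1 / \<epsilon>) *\<^sub>R y) has_derivative (\<lambda>v. (1 / \<epsilon>) *\<^sub>R v)) (at y)"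
      by (auto intro!: derivative_eq_intros)
    from has_derivative_compose[OF this c1D[OF smooth_c1[OF smooth_bump]]]
    have "((\<lambda>y::'a. bump ((1 / \<epsilon>) *\<^sub>R y)) has_derivative
            (\<lambda>v. nabla bump ((1 / \<epsilon>) *\<^sub>R y) \<bullet> ((1 / \<epsilon>) *\<^sub>R v))) (at y)" .
    from has_derivative_mult_right[OF this, of "(1 / \<epsilon>) ^ DIM('a)"]
    show ?thesis unfolding k_def[abs_def] Dk_def by simp
  qed
  have "continuous_on UNIV Dk"
    unfolding Dk_def[abs_def]
    by (intro continuous_intros continuous_on_compose2[OF continuous_nabla_bump]) auto
  then have c: "c1 k Dk" using kD by (simp add: c1_def)
  have ks: "k x = 0" if "norm x > \<epsilon>" for x
    unfolding k_def by (rule scaled_bump_outside[OF \<epsilon> that])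
  have mk: "mol \<epsilon> f = conv k f"
    using mol_conv[OF f \<epsilon>] unfolding k_def[abs_def] by blast
  have "- (LINT w|lborel. f w *\<^sub>R Dk (w - z)) = dmol \<epsilon> f z" for z
  proof -
    have "(LINT w|lborel. f w *\<^sub>R Dk (w - z))
        = \<epsilon> ^ DIM('a) *\<^sub>R (LINT h|lborel. f (z + \<epsilon> *\<^sub>R h) *\<^sub>R Dk (z + \<epsilon> *\<^sub>R h - z))"
      using \<epsilon> borel_measurable_continuous_onI[OF c1_cont[OF c]]
      by (subst integral_affine(1)[where c = \<epsilon> and t = z]) auto
    also have "(\<lambda>h. f (z + \<epsilon> *\<^sub>R h) *\<^sub>R Dk (z + \<epsilon> *\<^sub>R h - z))
       = (\<lambda>h. ((1 / \<epsilon>) ^ DIM('a) * (1 / \<epsilon>)) *\<^sub>R (f (z + \<epsilon> *\<^sub>R h) *\<^sub>R nabla bump h))"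
      using \<epsilon> by (simp add: Dk_def algebra_simps)
    finally have "(LINT w|lborel. f w *\<^sub>R Dk (w - z)) = \<epsilon> ^ DIM('a) *\<^sub>R
        (((1 / \<epsilon>) ^ DIM('a) * (1 / \<epsilon>)) *\<^sub>R (LINT h|lborel. f (z + \<epsilon> *\<^sub>R h) *\<^sub>R nabla bump h))"
      by (simp only: integral_scaleR_right)
    then show ?thesis
      using \<epsilon> by (simp add: dmol_def power_divide)
  qed
  then have "(mol \<epsilon> f has_derivative (\<lambda>v. dmol \<epsilon> f z \<bullet> v)) (at z)" for z
    using conv_has_derivative[where z = z, OF c ks f] mk by simp
  moreover from this have "nabla (mol \<epsilon> f) = dmol \<epsilon> f"
    using c1D[OF smooth_c1[OF smooth_mol[OF f \<epsilon>]]] has_gradient_unique by blast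
  ultimately show ?thesis
    using smooth_c1[OF smooth_mol[OF f \<epsilon>]] by simp
qed

lemma locint_const: "locint (\<lambda>_. c)"
  using emeasure_lborel_cball_finite unfolding locint_def set_integrable_def
  by (auto intro!: integrable_scaleR_left integrable_real_indicator)

text \<open>The mollification of a constant is constant. This is what allows values of a function under \<open>dmol\<close>
  to be replaced by its increments.\<close>

lemma integral_nabla_bump: "(LINT h|lborel. nabla bump (h::'a::euclidean_space)) = 0"
proof -
  have "c1 (mol 1 (\<lambda>_::'a. 1::real)) (dmol 1 (\<lambda>_. 1))"
    by (rule mol_c1) (auto simp: locint_const)
  moreover have "mol 1 (\<lambda>_::'a. 1::real) = (\<lambda>_. 1)"
    by (rule ext) (simp add: mol_def integral_bump)
  ultimately have "nabla (\<lambda>_::'a. 1) = dmol 1 (\<lambda>_. 1::real)" "nabla (\<lambda>_::'a. 1) = (\<lambda>_. 0)"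
    using c1_nabla c1_const by metis+
  then have "dmol 1 (\<lambda>_::'a. 1::real) 0 = 0" by metis
  then show ?thesis by (simp add: dmol_def)
qed

section \<open>Commutator estimates at a point\<close>

definition ball_measure :: "'a::euclidean_space measure" where
  "ball_measure = restrict_space lborel (cball 0 1)"

definition kernel_bound :: "'a::euclidean_space itself \<Rightarrow> real \<Rightarrow> bool" where
  "kernel_bound _ A \<longleftrightarrow> 1 \<le> A \<and> (\<forall>h::'a. bump h \<le> A) \<and> (\<forall>h::'a. norm (nabla bump h) \<le> A) \<and>
     measure lborel (cball (0::'a) 1) \<le> A"

lemma kernel_bound_exists: "\<exists>A. kernel_bound TYPE('a::euclidean_space) A"
proof -
  obtain B1 where B1: "\<And>h::'a. norm (bump h) \<le> B1"
    using bounded_of_compact_support[OF smooth_continuous[OF smooth_bump] bump_outside'] by metis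
  obtain B2 where B2: "\<And>h::'a. norm (nabla bump h) \<le> B2"
    using bounded_of_compact_support[OF continuous_nabla_bump nabla_bump_outside] by metis
  define A where "A = 1 + \<bar>B1\<bar> + \<bar>B2\<bar> + measure lborel (cball (0::'a) 1)"
  have m: "0 \<le> measure lborel (cball (0::'a) 1)" by simp
  have "bump h \<le> A" "norm (nabla bump h) \<le> A" for h :: 'a
    using B1[of h] B2[of h] m unfolding A_def by (simp_all, linarith+)
  then have "kernel_bound TYPE('a) A"
    using m by (auto simp: kernel_bound_def A_def)
  then show ?thesis by blast
qed

lemma space_ball_measure: "space ball_measure = cball 0 1"
  by (simp add: ball_measure_def space_restrict_space)

lemma measurable_ball_measure[measurable (raw)]:
  "f \<in> borel_measurable borel \<Longrightarrow> f \<in> borel_measurable (ball_measure :: 'a::euclidean_space measure)"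
  by (simp add: ball_measure_def measurable_restrict_space1)

lemma measure_ball_measure: "measure ball_measure (space (ball_measure::'a measure)) = measure lborel (cball (0::'a::euclidean_space) 1)"
  by (simp add: space_ball_measure ball_measure_def measure_restrict_space)

lemma finite_measure_ball_measure: "finite_measure (ball_measure :: 'a::euclidean_space measure)"
  by (rule finite_measureI)
     (use emeasure_lborel_cball_finite[of "0::'a" 1] in
       \<open>simp add: space_ball_measure ball_measure_def emeasure_restrict_space space_restrict_space\<close>)

lemma kernel_boundD:
  assumes "kernel_bound TYPE('a::euclidean_space) A"
  shows "1 \<le> A" "bump (h::'a) \<le> A" "norm (nabla bump (h::'a)) \<le> A"
    "measure ball_measure (space (ball_measure::'a measure)) \<le> A"
  using assms by (auto simp: kernel_bound_def measure_ball_measure)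

lemma integral_ball_measure:
  fixes F :: "'a::euclidean_space \<Rightarrow> 'b::euclidean_space"
  assumes "\<And>h. 1 < norm h \<Longrightarrow> F h = 0"
  shows "(LINT h|lborel. F h) = (LINT h|ball_measure. F h)"
    and "integrable lborel F \<longleftrightarrow> integrable ball_measure F"
proof -
  have "(\<lambda>h. indicator (cball 0 1) h *\<^sub>R F h) = F"
    using assms by (auto simp: indicator_def not_le intro!: ext)
  then show "(LINT h|lborel. F h) = (LINT h|ball_measure. F h)" "integrable lborel F \<longleftrightarrow> integrable ball_measure F"
    by (simp_all add: ball_measure_def integral_restrict_space integrable_restrict_space)
qed

text \<open>At one point \<open>z\<close>, the increments of \<open>f\<close> over distances up to \<open>\<epsilon>\<close> are of size \<open>\<sigma>\<close> in the cubic mean. The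
  estimates of this part are all pointwise in \<open>z\<close>.\<close>

definition osc_bound :: "real \<Rightarrow> ('a::euclidean_space \<Rightarrow> real) \<Rightarrow> 'a \<Rightarrow> real \<Rightarrow> bool" where
  "osc_bound \<epsilon> f z \<sigma> \<longleftrightarrow> 0 < \<sigma> \<and> f \<in> borel_measurable borel \<and>
     integrable ball_measure (\<lambda>h. \<bar>f (z + \<epsilon> *\<^sub>R h) - f z\<bar> ^ 3) \<and>
     (LINT h|ball_measure. \<bar>f (z + \<epsilon> *\<^sub>R h) - f z\<bar> ^ 3) \<le> \<sigma> ^ 3"

lemma osc_bound_measurable:
  assumes "osc_bound \<epsilon> f z \<sigma>"
  shows "(\<lambda>h. f (z + \<epsilon> *\<^sub>R h)) \<in> borel_measurable ball_measure"
proof -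
  have [measurable]: "f \<in> borel_measurable borel" using assms by (simp add: osc_bound_def)
  show ?thesis by measurable
qed

lemma cube_ge_linear:
  fixes x :: real
  assumes "0 \<le> x"
  shows "x \<le> 1 + x ^ 3"
proof (cases "x \<le> 1")
  case False
  then have "x * 1 \<le> x * x\<^sup>2" by (intro mult_left_mono) (auto simp: one_le_power)
  then show ?thesis by (simp add: power3_eq_cube power2_eq_square)
qed (use assms zero_le_power[of x 3] in linarith)

lemma cube_ge_product:
  fixes x y :: real
  assumes "0 \<le> x" "0 \<le> y"
  shows "x * y \<le> 1 + x ^ 3 + y ^ 3"
proof -
  define m where "m = max x y"
  have m: "x \<le> m" "y \<le> m" "0 \<le> m" "m ^ 3 \<le> x ^ 3 + y ^ 3"
    using assms by (auto simp: m_def max_def)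
  have "x * y \<le> m * m" using m assms by (intro mult_mono) auto
  also have "\<dots> \<le> 1 + m ^ 3"
  proof (cases "m \<le> 1")
    case True
    then show ?thesis using m mult_le_one[of m m] by (smt (verit) zero_le_power)
  next
    case False
    then have "m * m * 1 \<le> m * m * m" by (intro mult_left_mono) auto
    then show ?thesis by (simp add: power3_eq_cube)
  qed
  finally show ?thesis using m by simp
qed

lemma scaled_cubes:
  fixes a b s t :: real
  assumes "0 < s" "0 < t"
  shows "(s * t) * (1 + (a / s) ^ 3 + (b / t) ^ 3) = s * t + (a ^ 3 * (t / s\<^sup>2) + b ^ 3 * (s / t\<^sup>2))"
  using assms by (simp add: field_simps power2_eq_square power3_eq_cube)

text \<open>Scaling \<open>x \<le> 1 + x\<^sup>3\<close> and \<open>x y \<le> 1 + x\<^sup>3 + y\<^sup>3\<close> by the sizes \<open>\<sigma>\<close>, \<open>\<tau>\<close> of the oscillations gives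
  the two averaged bounds from which all commutator estimates follow.\<close>

lemma osc_bound_linear:
  fixes z :: "'a::euclidean_space"
  assumes o: "osc_bound \<epsilon> f z \<sigma>" and A: "kernel_bound TYPE('a) A"
  shows "integrable ball_measure (\<lambda>h. \<bar>f (z + \<epsilon> *\<^sub>R h) - f z\<bar>)"
    and "(LINT h|ball_measure. \<bar>f (z + \<epsilon> *\<^sub>R h) - f z\<bar>) \<le> 2 * A * \<sigma>"
proof -
  interpret finite_measure "ball_measure::'a measure" by (rule finite_measure_ball_measure)
  note [measurable] = osc_bound_measurable[OF o]
  let ?d = "\<lambda>h. \<bar>f (z + \<epsilon> *\<^sub>R h) - f z\<bar>"
  have s: "0 < \<sigma>" and i: "integrable ball_measure (\<lambda>h. ?d h ^ 3)" and le: "(LINT h|ball_measure. ?d h ^ 3) \<le> \<sigma> ^ 3"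
    using o by (auto simp: osc_bound_def)
  have b: "?d h \<le> \<sigma> + ?d h ^ 3 / \<sigma>\<^sup>2" for h
    using cube_ge_linear[of "?d h / \<sigma>"] s by (simp add: field_simps power2_eq_square power3_eq_cube)
  have ib: "integrable ball_measure (\<lambda>h. \<sigma> + ?d h ^ 3 / \<sigma>\<^sup>2)"
    using i by (intro Bochner_Integration.integrable_add integrable_divide_zero) auto
  show id: "integrable ball_measure ?d"
  proof (rule Bochner_Integration.integrable_bound[OF ib])
    show "AE h in ball_measure. norm (?d h) \<le> norm (\<sigma> + ?d h ^ 3 / \<sigma>\<^sup>2)"
      using b by (intro AE_I2) (smt (verit) real_norm_def)
  qed measurable
  have "(LINT h|ball_measure. ?d h) \<le> (LINT h|ball_measure. \<sigma> + ?d h ^ 3 / \<sigma>\<^sup>2)"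
    by (rule integral_mono[OF id ib b])
  also have "\<dots> = \<sigma> * measure ball_measure (space (ball_measure::'a measure)) + (LINT h|ball_measure. ?d h ^ 3) / \<sigma>\<^sup>2"
    using i by (subst Bochner_Integration.integral_add) (auto simp: mult.commute)
  also have "\<dots> \<le> \<sigma> * A + \<sigma> ^ 3 / \<sigma>\<^sup>2"
    using le s kernel_boundD[OF A] by (intro add_mono mult_left_mono divide_right_mono) auto
  also have "\<sigma> ^ 3 / \<sigma>\<^sup>2 = \<sigma> * 1" using s by (simp add: power2_eq_square power3_eq_cube)
  also have "\<sigma> * A + \<sigma> * 1 \<le> 2 * A * \<sigma>"
    using mult_left_mono[OF kernel_boundD(1)[OF A], of \<sigma>] s by (simp add: algebra_simps)
  finally show "(LINT h|ball_measure. ?d h) \<le> 2 * A * \<sigma>" .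
qed

lemma osc_bound_product:
  fixes z :: "'a::euclidean_space"
  assumes o: "osc_bound \<epsilon> f z \<sigma>" and o': "osc_bound \<epsilon> g z \<tau>" and A: "kernel_bound TYPE('a) A"
  shows "integrable ball_measure (\<lambda>h. \<bar>f (z + \<epsilon> *\<^sub>R h) - f z\<bar> * \<bar>g (z + \<epsilon> *\<^sub>R h) - g z\<bar>)"
    and "(LINT h|ball_measure. \<bar>f (z + \<epsilon> *\<^sub>R h) - f z\<bar> * \<bar>g (z + \<epsilon> *\<^sub>R h) - g z\<bar>) \<le> 3 * A * (\<sigma> * \<tau>)"
proof -
  interpret finite_measure "ball_measure::'a measure" by (rule finite_measure_ball_measure)
  note [measurable] = osc_bound_measurable[OF o] osc_bound_measurable[OF o']
  let ?d = "\<lambda>h. \<bar>f (z + \<epsilon> *\<^sub>R h) - f z\<bar>"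
  let ?e = "\<lambda>h. \<bar>g (z + \<epsilon> *\<^sub>R h) - g z\<bar>"
  have s: "0 < \<sigma>" and i: "integrable ball_measure (\<lambda>h. ?d h ^ 3)" and le: "(LINT h|ball_measure. ?d h ^ 3) \<le> \<sigma> ^ 3"
    using o by (auto simp: osc_bound_def)
  have t: "0 < \<tau>" and j: "integrable ball_measure (\<lambda>h. ?e h ^ 3)" and le': "(LINT h|ball_measure. ?e h ^ 3) \<le> \<tau> ^ 3"
    using o' by (auto simp: osc_bound_def)
  let ?b = "\<lambda>h. \<sigma> * \<tau> + (?d h ^ 3 * (\<tau> / \<sigma>\<^sup>2) + ?e h ^ 3 * (\<sigma> / \<tau>\<^sup>2))"
  have b: "?d h * ?e h \<le> ?b h" for h
  proof -
    have "(\<sigma> * \<tau>) * (?d h / \<sigma> * (?e h / \<tau>)) \<le> (\<sigma> * \<tau>) * (1 + (?d h / \<sigma>) ^ 3 + (?e h / \<tau>) ^ 3)"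
      using s t by (intro mult_left_mono cube_ge_product) auto
    also have "(\<sigma> * \<tau>) * (?d h / \<sigma> * (?e h / \<tau>)) = ?d h * ?e h" using s t by simp
    also have "(\<sigma> * \<tau>) * (1 + (?d h / \<sigma>) ^ 3 + (?e h / \<tau>) ^ 3) = ?b h"
      by (rule scaled_cubes[OF s t])
    finally show ?thesis .
  qed
  have ij: "integrable ball_measure (\<lambda>h. ?d h ^ 3 * (\<tau> / \<sigma>\<^sup>2))" "integrable ball_measure (\<lambda>h. ?e h ^ 3 * (\<sigma> / \<tau>\<^sup>2))"
    by (rule integrable_mult_left[OF i]) (rule integrable_mult_left[OF j])
  have ib: "integrable ball_measure ?b"
    using ij by (intro Bochner_Integration.integrable_add) auto
  show id: "integrable ball_measure (\<lambda>h. ?d h * ?e h)"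
  proof (rule Bochner_Integration.integrable_bound[OF ib])
    show "AE h in ball_measure. norm (?d h * ?e h) \<le> norm (?b h)"
    proof (rule AE_I2)
      fix h
      have "0 \<le> ?d h * ?e h" by simp
      then show "norm (?d h * ?e h) \<le> norm (?b h)" using b[of h] by (simp only: real_norm_def) linarith
    qed
  qed measurable
  have "(LINT h|ball_measure. ?d h * ?e h) \<le> (LINT h|ball_measure. ?b h)"
    by (rule integral_mono[OF id ib b])
  also have "\<dots> = \<sigma> * \<tau> * measure ball_measure (space (ball_measure::'a measure)) + ((LINT h|ball_measure. ?d h ^ 3) * (\<tau> / \<sigma>\<^sup>2) + (LINT h|ball_measure. ?e h ^ 3) * (\<sigma> / \<tau>\<^sup>2))"
    using ij by (simp add: Bochner_Integration.integral_add Bochner_Integration.integrable_add mult.commute)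
  also have "\<dots> \<le> \<sigma> * \<tau> * A + (\<sigma> ^ 3 * (\<tau> / \<sigma>\<^sup>2) + \<tau> ^ 3 * (\<sigma> / \<tau>\<^sup>2))"
    using le le' s t kernel_boundD[OF A] by (intro add_mono mult_left_mono mult_right_mono) auto
  also have "\<dots> = \<sigma> * \<tau> * (A + 2)"
    using s t by (simp add: power2_eq_square power3_eq_cube algebra_simps)
  also have "\<dots> \<le> 3 * A * (\<sigma> * \<tau>)"
    using mult_left_mono[of "A + 2" "3 * A" "\<sigma> * \<tau>"] kernel_boundD(1)[OF A] s t by (simp add: mult.commute)
  finally show "(LINT h|ball_measure. ?d h * ?e h) \<le> 3 * A * (\<sigma> * \<tau>)" .
qed

lemma bump_average_bound:
  fixes F G :: "'a::euclidean_space \<Rightarrow> real"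
  assumes "integrable ball_measure G" "\<And>h. \<bar>F h\<bar> \<le> G h" "F \<in> borel_measurable ball_measure"
    and A: "kernel_bound TYPE('a) A"
  shows "integrable lborel (\<lambda>h. bump h * F h)" "\<bar>LINT h|lborel. bump h * F h\<bar> \<le> A * (LINT h|ball_measure. G h)"
proof -
  have [measurable]: "F \<in> borel_measurable ball_measure" by fact
  have b: "norm (bump h * F h) \<le> A * G h" for h
    using mult_mono[OF kernel_boundD(2)[OF A, of h] assms(2)[of h]] bump_nonneg[of h] kernel_boundD(1)[OF A]
    by (simp add: abs_mult)
  have iG: "integrable ball_measure (\<lambda>h. A * G h)" using assms(1) by simp
  have i: "integrable ball_measure (\<lambda>h. bump h * F h)"
    by (rule Bochner_Integration.integrable_bound[OF iG])
       (measurable, rule AE_I2, unfold real_norm_def[of "A * _"], rule order_trans[OF b abs_ge_self])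
  note N = integral_ball_measure[of "\<lambda>h. bump h * F h"]
  show "integrable lborel (\<lambda>h. bump h * F h)"
    using i by (subst N(2)) (auto simp: bump_outside')
  have "(LINT h|lborel. bump h * F h) = (LINT h|ball_measure. bump h * F h)"
    by (rule N(1)) (simp add: bump_outside')
  also have "\<bar>\<dots>\<bar> \<le> (LINT h|ball_measure. A * G h)"
    using Bochner_Integration.integral_norm_bound_integral[OF i iG b] by simp
  finally show "\<bar>LINT h|lborel. bump h * F h\<bar> \<le> A * (LINT h|ball_measure. G h)" by simp
qed

lemma bump_const_integrable: "integrable lborel (\<lambda>h::'a::euclidean_space. bump h * c)"
  using integrable_bump by (rule integrable_mult_left)

lemma mol_minus:
  fixes f :: "'a::euclidean_space \<Rightarrow> real"
  assumes o: "osc_bound \<epsilon> f z \<sigma>" and A: "kernel_bound TYPE('a) A"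
  shows "mol \<epsilon> f z - f z = (LINT h|lborel. bump h * (f (z + \<epsilon> *\<^sub>R h) - f z))"
    and "\<bar>mol \<epsilon> f z - f z\<bar> \<le> 2 * A\<^sup>2 * \<sigma>"
    and "integrable lborel (\<lambda>h. bump h * (f (z + \<epsilon> *\<^sub>R h) - f z))"
    and "integrable lborel (\<lambda>h. bump h * f (z + \<epsilon> *\<^sub>R h))"
proof -
  note [measurable] = osc_bound_measurable[OF o]
  note b = bump_average_bound[OF osc_bound_linear(1)[OF o A] order_refl _ A]
  show i: "integrable lborel (\<lambda>h. bump h * (f (z + \<epsilon> *\<^sub>R h) - f z))"
    by (rule b(1)) measurable
  have i2: "integrable lborel (\<lambda>h. bump h * (f (z + \<epsilon> *\<^sub>R h) - f z) + bump h * f z)"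
    using i bump_const_integrable by (rule Bochner_Integration.integrable_add)
  then show "integrable lborel (\<lambda>h. bump h * f (z + \<epsilon> *\<^sub>R h))"
    by (simp add: algebra_simps)
  have "mol \<epsilon> f z = (LINT h|lborel. bump h * (f (z + \<epsilon> *\<^sub>R h) - f z) + bump h * f z)"
    by (simp add: mol_def algebra_simps)
  also have "\<dots> = (LINT h|lborel. bump h * (f (z + \<epsilon> *\<^sub>R h) - f z)) + f z"
    using i bump_const_integrable by (subst Bochner_Integration.integral_add) (auto simp: integral_bump)
  finally show e: "mol \<epsilon> f z - f z = (LINT h|lborel. bump h * (f (z + \<epsilon> *\<^sub>R h) - f z))" by simp
  have "\<bar>mol \<epsilon> f z - f z\<bar> \<le> A * (LINT h|ball_measure. \<bar>f (z + \<epsilon> *\<^sub>R h) - f z\<bar>)"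
    unfolding e by (rule b(2)) measurable
  also have "\<dots> \<le> A * (2 * A * \<sigma>)"
    using osc_bound_linear(2)[OF o A] kernel_boundD(1)[OF A] by (intro mult_left_mono) auto
  finally show "\<bar>mol \<epsilon> f z - f z\<bar> \<le> 2 * A\<^sup>2 * \<sigma>" by (simp add: power2_eq_square mult_ac)
qed

text \<open>Since the gradient of the kernel has mean zero, only increments of \<open>f\<close> contribute.\<close>

lemma dmol_bound:
  fixes f :: "'a::euclidean_space \<Rightarrow> real"
  assumes o: "osc_bound \<epsilon> f z \<sigma>" and A: "kernel_bound TYPE('a) A" and \<epsilon>: "0 < \<epsilon>"
  shows "norm (dmol \<epsilon> f z) \<le> 2 * A\<^sup>2 * (\<sigma> / \<epsilon>)"
proof -
  note [measurable] = osc_bound_measurable[OF o]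
  let ?d = "\<lambda>h. f (z + \<epsilon> *\<^sub>R h) - f z"
  have b: "norm (?d h *\<^sub>R nabla bump h) \<le> A * \<bar>?d h\<bar>" for h
    using mult_left_mono[OF kernel_boundD(3)[OF A, of h], of "\<bar>?d h\<bar>"] by (simp add: mult.commute)
  have iG: "integrable ball_measure (\<lambda>h. A * \<bar>?d h\<bar>)" using osc_bound_linear(1)[OF o A] by simp
  have i: "integrable ball_measure (\<lambda>h. ?d h *\<^sub>R nabla bump h)"
    by (rule Bochner_Integration.integrable_bound[OF iG])
       (measurable, rule AE_I2, unfold real_norm_def[of "A * _"], rule order_trans[OF b abs_ge_self])
  have N: "(LINT h|lborel. ?d h *\<^sub>R nabla bump h) = (LINT h|ball_measure. ?d h *\<^sub>R nabla bump h)"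
     "integrable lborel (\<lambda>h. ?d h *\<^sub>R nabla bump h)"
    using i by (subst integral_ball_measure; simp add: nabla_bump_outside)+
  have ic: "integrable lborel (\<lambda>h. f z *\<^sub>R nabla bump (h::'a))"
    by (intro integrable_scaleR_right integrable_compact_support[OF continuous_nabla_bump nabla_bump_outside])
  have "(LINT h|lborel. f (z + \<epsilon> *\<^sub>R h) *\<^sub>R nabla bump h)
      = (LINT h|lborel. ?d h *\<^sub>R nabla bump h + f z *\<^sub>R nabla bump h)"
    by (simp add: algebra_simps)
  also have "\<dots> = (LINT h|ball_measure. ?d h *\<^sub>R nabla bump h)"
    using N ic by (simp add: integral_nabla_bump)
  finally have "norm (LINT h|lborel. f (z + \<epsilon> *\<^sub>R h) *\<^sub>R nabla bump h) \<le> (LINT h|ball_measure. A * \<bar>?d h\<bar>)"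
    using Bochner_Integration.integral_norm_bound_integral[OF i iG b] by simp
  also have "\<dots> \<le> A * (2 * A * \<sigma>)"
    using osc_bound_linear(2)[OF o A] kernel_boundD(1)[OF A] by simp
  finally have "norm (LINT h|lborel. f (z + \<epsilon> *\<^sub>R h) *\<^sub>R nabla bump h) / \<epsilon> \<le> (A * (2 * A * \<sigma>)) / \<epsilon>"
    using \<epsilon> by (intro divide_right_mono) auto
  then show ?thesis
    using \<epsilon> by (simp add: dmol_def power2_eq_square mult_ac)
qed

text \<open>The commutator is \<open>\<integral> k \<delta>f \<delta>g - (\<integral> k \<delta>f) (\<integral> k \<delta>g)\<close> with the increments \<open>\<delta>\<close> taken at the point.\<close>

lemma mol_mult_commutator:
  fixes f g :: "'a::euclidean_space \<Rightarrow> real"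
  assumes o: "osc_bound \<epsilon> f z \<sigma>" and o': "osc_bound \<epsilon> g z \<tau>" and A: "kernel_bound TYPE('a) A"
  shows "\<bar>mol \<epsilon> (\<lambda>z. f z * g z) z - mol \<epsilon> f z * mol \<epsilon> g z\<bar> \<le> 7 * A ^ 4 * (\<sigma> * \<tau>)"
proof -
  note [measurable] = osc_bound_measurable[OF o] osc_bound_measurable[OF o']
  let ?d = "\<lambda>h. f (z + \<epsilon> *\<^sub>R h) - f z"
  let ?e = "\<lambda>h. g (z + \<epsilon> *\<^sub>R h) - g z"
  have s: "0 < \<sigma>" "0 < \<tau>" using o o' by (auto simp: osc_bound_def)
  note b = bump_average_bound[OF osc_bound_product(1)[OF o o' A] eq_refl[OF abs_mult] _ A]
  have i: "integrable lborel (\<lambda>h. bump h * (?d h * ?e h))"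
    by (rule b(1)) measurable
  note f1 = mol_minus[OF o A] and g1 = mol_minus[OF o' A]
  have "mol \<epsilon> (\<lambda>z. f z * g z) z
      = (LINT h|lborel. bump h * (?d h * ?e h) + (bump h * ?d h) * g z + (bump h * ?e h) * f z + bump h * (f z * g z))"
    by (simp add: mol_def algebra_simps)
  also have "\<dots> = (LINT h|lborel. bump h * (?d h * ?e h)) + (mol \<epsilon> f z - f z) * g z + (mol \<epsilon> g z - g z) * f z + f z * g z"
    unfolding f1(1) g1(1)
  proof -
    note I = i integrable_mult_left[OF f1(3), of "g z"] integrable_mult_left[OF g1(3), of "f z"]
      bump_const_integrable[of "f z * g z"]
    note I2 = Bochner_Integration.integrable_add[OF I(1,2)]
    note I3 = Bochner_Integration.integrable_add[OF I2 I(3)]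
    show "(LINT h|lborel. bump h * (?d h * ?e h) + bump h * ?d h * g z + bump h * ?e h * f z + bump h * (f z * g z))
      = (LINT h|lborel. bump h * (?d h * ?e h)) + (LINT h|lborel. bump h * ?d h) * g z + (LINT h|lborel. bump h * ?e h) * f z + f z * g z"
      unfolding Bochner_Integration.integral_add[OF I3 I(4)] Bochner_Integration.integral_add[OF I2 I(3)]
        Bochner_Integration.integral_add[OF I(1,2)]
      by (simp add: integral_bump)
  qed
  finally have e: "mol \<epsilon> (\<lambda>z. f z * g z) z - mol \<epsilon> f z * mol \<epsilon> g z
     = (LINT h|lborel. bump h * (?d h * ?e h)) - (mol \<epsilon> f z - f z) * (mol \<epsilon> g z - g z)"
    by (simp add: algebra_simps)
  have A1: "1 \<le> A" by (rule kernel_boundD(1)[OF A])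
  have "\<bar>LINT h|lborel. bump h * (?d h * ?e h)\<bar> \<le> A * (LINT h|ball_measure. \<bar>?d h\<bar> * \<bar>?e h\<bar>)"
    by (rule b(2)) measurable
  also have "\<dots> \<le> A * (3 * A * (\<sigma> * \<tau>))"
    using osc_bound_product(2)[OF o o' A] A1 by (intro mult_left_mono) auto
  also have "\<dots> = A ^ 2 * (3 * (\<sigma> * \<tau>))" by (simp add: power2_eq_square)
  also have "\<dots> \<le> A ^ 4 * (3 * (\<sigma> * \<tau>))"
    using A1 s by (intro mult_right_mono power_increasing) auto
  finally have 1: "\<bar>LINT h|lborel. bump h * (?d h * ?e h)\<bar> \<le> A ^ 4 * (3 * (\<sigma> * \<tau>))" .
  have "\<bar>(mol \<epsilon> f z - f z) * (mol \<epsilon> g z - g z)\<bar> \<le> (2 * A\<^sup>2 * \<sigma>) * (2 * A\<^sup>2 * \<tau>)"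
    unfolding abs_mult using f1(2) g1(2) s by (intro mult_mono) auto
  also have "\<dots> = A ^ 4 * (4 * (\<sigma> * \<tau>))" by (simp add: power2_eq_square power4_eq_xxxx)
  finally show ?thesis using 1 unfolding e by (simp add: algebra_simps)
qed

lemma osc_bound_lipschitz_average:
  fixes f :: "'a::euclidean_space \<Rightarrow> real"
  assumes o: "osc_bound \<epsilon> f z \<sigma>" and A: "kernel_bound TYPE('a) A"
    and [measurable]: "F \<in> borel_measurable borel"
    and F: "\<And>h. \<bar>F (f (z + \<epsilon> *\<^sub>R h)) - F (f z)\<bar> \<le> L * \<bar>f (z + \<epsilon> *\<^sub>R h) - f z\<bar>" and L: "0 \<le> L"
  shows "\<bar>mol \<epsilon> (\<lambda>z. F (f z)) z - F (f z)\<bar> \<le> L * (2 * A\<^sup>2 * \<sigma>)"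
proof -
  note [measurable] = osc_bound_measurable[OF o]
  let ?G = "\<lambda>h. F (f (z + \<epsilon> *\<^sub>R h)) - F (f z)"
  have iL: "integrable ball_measure (\<lambda>h. L * \<bar>f (z + \<epsilon> *\<^sub>R h) - f z\<bar>)" using osc_bound_linear(1)[OF o A] by simp
  note b = bump_average_bound[OF iL F _ A]
  have i: "integrable lborel (\<lambda>h. bump h * ?G h)" by (rule b(1)) measurable
  have "mol \<epsilon> (\<lambda>z. F (f z)) z = (LINT h|lborel. bump h * ?G h + bump h * F (f z))"
    by (simp add: mol_def algebra_simps)
  also have "\<dots> = (LINT h|lborel. bump h * ?G h) + F (f z)"
    using i bump_const_integrable by (subst Bochner_Integration.integral_add) (auto simp: integral_bump)
  finally have "\<bar>mol \<epsilon> (\<lambda>z. F (f z)) z - F (f z)\<bar> = \<bar>LINT h|lborel. bump h * ?G h\<bar>" by simp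
  also have "\<dots> \<le> A * (LINT h|ball_measure. L * \<bar>f (z + \<epsilon> *\<^sub>R h) - f z\<bar>)" by (rule b(2)) measurable
  also have "\<dots> \<le> A * (L * (2 * A * \<sigma>))"
    using osc_bound_linear(2)[OF o A] kernel_boundD(1)[OF A] L by (simp add: mult_left_mono)
  finally show ?thesis by (simp add: power2_eq_square mult_ac)
qed

text \<open>Expanding around the average \<open>mol \<epsilon> f z\<close> makes the first-order term vanish, which turns the
  commutator of a composition into a quadratic one.\<close>

lemma mol_compose_commutator:
  fixes f :: "'a::euclidean_space \<Rightarrow> real"
  assumes o: "osc_bound \<epsilon> f z \<sigma>" and A: "kernel_bound TYPE('a) A"
    and [measurable]: "F \<in> borel_measurable borel"
    and F: "\<And>h. \<bar>F (f (z + \<epsilon> *\<^sub>R h)) - F (mol \<epsilon> f z) - F1 * (f (z + \<epsilon> *\<^sub>R h) - mol \<epsilon> f z)\<bar>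
                 \<le> L * (f (z + \<epsilon> *\<^sub>R h) - mol \<epsilon> f z)\<^sup>2"
    and L: "0 \<le> L"
  shows "\<bar>mol \<epsilon> (\<lambda>z. F (f z)) z - F (mol \<epsilon> f z)\<bar> \<le> L * (14 * A ^ 6 * (\<sigma> * \<sigma>))"
proof -
  interpret finite_measure "ball_measure::'a measure" by (rule finite_measure_ball_measure)
  note [measurable] = osc_bound_measurable[OF o]
  define y where "y = mol \<epsilon> f z"
  have s: "0 < \<sigma>" using o by (auto simp: osc_bound_def)
  have A1: "1 \<le> A" by (rule kernel_boundD(1)[OF A])
  let ?G = "\<lambda>h. F (f (z + \<epsilon> *\<^sub>R h)) - F y - F1 * (f (z + \<epsilon> *\<^sub>R h) - y)"
  let ?d = "\<lambda>h. \<bar>f (z + \<epsilon> *\<^sub>R h) - f z\<bar>"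
  let ?B = "\<lambda>h. L * (2 * (?d h * ?d h) + 8 * A ^ 4 * \<sigma>\<^sup>2)"
  note f1 = mol_minus[OF o A]
  have iB: "integrable ball_measure ?B"
    using osc_bound_product(1)[OF o o A] by (intro integrable_mult_right Bochner_Integration.integrable_add) auto
  have GB: "\<bar>?G h\<bar> \<le> ?B h" for h
  proof -
    have "\<bar>y - f z\<bar>\<^sup>2 \<le> (2 * A\<^sup>2 * \<sigma>)\<^sup>2"
      using f1(2) unfolding y_def by (intro power_mono) auto
    also have "(2 * A\<^sup>2 * \<sigma>)\<^sup>2 = 4 * A ^ 4 * \<sigma>\<^sup>2"
      by (simp add: power_mult_distrib)
    finally have 1: "(y - f z)\<^sup>2 \<le> 4 * A ^ 4 * \<sigma>\<^sup>2" by (simp only: power2_abs)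
    have "(f (z + \<epsilon> *\<^sub>R h) - y)\<^sup>2 \<le> 2 * (?d h * ?d h) + 2 * (y - f z)\<^sup>2"
      using sum_squares_ge_zero[of "(f (z + \<epsilon> *\<^sub>R h) - f z) + (y - f z)" 0]
      by (simp add: power2_eq_square algebra_simps)
    also have "\<dots> \<le> 2 * (?d h * ?d h) + 8 * A ^ 4 * \<sigma>\<^sup>2" using 1 by (simp only: mult.assoc)
    finally show ?thesis using F[of h] mult_left_mono[OF _ L] unfolding y_def by (meson order_trans)
  qed
  note b = bump_average_bound[OF iB GB _ A]
  have i: "integrable lborel (\<lambda>h. bump h * ?G h)" by (rule b(1)) measurable
  have i2: "integrable lborel (\<lambda>h. bump h * f (z + \<epsilon> *\<^sub>R h) * F1)"
    using f1(4) by (rule integrable_mult_left)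
  have "mol \<epsilon> (\<lambda>z. F (f z)) z = (LINT h|lborel. bump h * ?G h + bump h * f (z + \<epsilon> *\<^sub>R h) * F1 + bump h * (F y - F1 * y))"
    by (simp add: mol_def algebra_simps)
  also have "\<dots> = (LINT h|lborel. bump h * ?G h) + (LINT h|lborel. bump h * f (z + \<epsilon> *\<^sub>R h) * F1) + (F y - F1 * y)"
  proof -
    have "(LINT h|lborel. (bump h * ?G h + bump h * f (z + \<epsilon> *\<^sub>R h) * F1) + bump h * (F y - F1 * y))
       = (LINT h|lborel. bump h * ?G h + bump h * f (z + \<epsilon> *\<^sub>R h) * F1) + (LINT h|lborel. bump (h::'a) * (F y - F1 * y))"
      using i i2 bump_const_integrable by (intro Bochner_Integration.integral_add Bochner_Integration.integrable_add)
    also have "(LINT h|lborel. bump h * ?G h + bump h * f (z + \<epsilon> *\<^sub>R h) * F1) = (LINT h|lborel. bump h * ?G h) + (LINT h|lborel. bump h * f (z + \<epsilon> *\<^sub>R h) * F1)"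
      using i i2 by (intro Bochner_Integration.integral_add)
    finally show ?thesis by (simp add: integral_bump)
  qed
  also have "(LINT h|lborel. bump h * f (z + \<epsilon> *\<^sub>R h) * F1) = y * F1"
    by (simp add: y_def mol_def)
  finally have "\<bar>mol \<epsilon> (\<lambda>z. F (f z)) z - F y\<bar> = \<bar>LINT h|lborel. bump h * ?G h\<bar>" by simp
  also have "\<dots> \<le> A * (LINT h|ball_measure. ?B h)" by (rule b(2)) measurable
  also have "(LINT h|ball_measure. ?B h) = L * (2 * (LINT h|ball_measure. ?d h * ?d h) + 8 * A ^ 4 * \<sigma>\<^sup>2 * measure ball_measure (space (ball_measure::'a measure)))"
    using osc_bound_product(1)[OF o o A] by (simp add: Bochner_Integration.integral_add mult_ac)
  also have "A * \<dots> \<le> A * (L * (2 * (3 * A * (\<sigma> * \<sigma>)) + 8 * A ^ 4 * \<sigma>\<^sup>2 * A))"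
    using osc_bound_product(2)[OF o o A] kernel_boundD(4)[OF A] L A1
    by (intro mult_left_mono add_mono) auto
  also have "\<dots> = L * ((6 * A\<^sup>2 + 8 * A ^ 6) * (\<sigma> * \<sigma>))"
    by (simp add: power2_eq_square algebra_simps numeral_eq_Suc)
  also have "\<dots> \<le> L * (14 * A ^ 6 * (\<sigma> * \<sigma>))"
    using L power_increasing[of 2 6 A] A1 by (intro mult_left_mono mult_right_mono) auto
  finally show ?thesis by (simp add: y_def)
qed

section \<open>Integration over the torus\<close>

text \<open>A fundamental domain for functions on all of \<open>\<real>\<close> times the torus. Fields are extended by \<open>0\<close> to times
  outside \<open>(0,T)\<close>, so that every field can be shifted in time.\<close>

definition slab :: "('n::finite spacetime) set" where
  "slab = UNIV \<times> unit_cell"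

definition lattice :: "int ^ 'n::finite \<Rightarrow> 'n spacetime" where
  "lattice k = (0, \<chi> i. of_int (k $ i))"

lemma periodic_lattice:
  assumes "space_periodic f"
  shows "f (z + lattice k) = f z" "f (z - lattice k) = f z"
proof -
  have *: "f (z + lattice k) = f z" for z k
    using assms by (cases z) (simp add: space_periodic_def lattice_def)
  show "f (z + lattice k) = f z" by (rule *)
  show "f (z - lattice k) = f z" using *[of "z - lattice k" k] by simp
qed

lemma unit_cell_measurable[measurable]: "unit_cell \<in> sets borel"
proof -
  have "unit_cell = (\<Inter>i. {x. 0 \<le> x $ i} \<inter> {x::real^'n. x $ i < 1})"
    by (auto simp: unit_cell_def)
  also have "\<dots> \<in> sets borel"
    by (intro sets.countable_INT'' sets.Int borel_closed borel_open closed_Collect_le open_Collect_less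
          continuous_intros) auto
  finally show ?thesis .
qed

lemma slab_measurable[measurable]: "slab \<in> sets borel"
proof -
  have "slab = snd -` unit_cell \<inter> space (borel :: 'a spacetime measure)"
    by (auto simp: slab_def)
  also have "\<dots> \<in> sets borel"
    by (rule measurable_sets[OF borel_measurable_continuous_onI]) (auto intro: continuous_intros)
  finally show ?thesis .
qed

definition floor_vec :: "'n::finite spacetime \<Rightarrow> int ^ 'n" where
  "floor_vec z = (\<chi> i. \<lfloor>snd z $ i\<rfloor>)"

lemma slab_lattice_iff: "z - lattice k \<in> slab \<longleftrightarrow> k = floor_vec z"
proof
  assume "z - lattice k \<in> slab"
  then have "0 \<le> snd z $ i - of_int (k $ i)" "snd z $ i - of_int (k $ i) < 1" for i
    by (auto simp: slab_def unit_cell_def lattice_def mem_Times_iff)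
  then have "\<lfloor>snd z $ i\<rfloor> = k $ i" for i
    by (intro floor_unique) (smt (verit))+
  then show "k = floor_vec z" by (simp add: floor_vec_def vec_eq_iff)
next
  assume "k = floor_vec z"
  moreover have "r - of_int \<lfloor>r\<rfloor> < 1" for r :: real by linarith
  ultimately show "z - lattice k \<in> slab"
    by (auto simp: slab_def unit_cell_def lattice_def mem_Times_iff floor_vec_def)
qed

lemma lattice_minus: "lattice (- k) = - lattice k"
  by (simp add: lattice_def vec_eq_iff)

lemma tiling_count:
  "(\<integral>\<^sup>+k. indicator slab (z - lattice k) \<partial>count_space UNIV) = 1"
  "(\<integral>\<^sup>+k. indicator slab (z + lattice k) \<partial>count_space UNIV) = 1"
proof -
  have "(\<lambda>k. indicator slab (z - lattice k) :: ennreal) = indicator {floor_vec z}"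
    by (auto simp: slab_lattice_iff indicator_def)
  then show "(\<integral>\<^sup>+k. indicator slab (z - lattice k) \<partial>count_space UNIV) = 1" by simp
  have "z + lattice k \<in> slab \<longleftrightarrow> - k = floor_vec z" for k
    using slab_lattice_iff[of z "- k"] by (simp add: lattice_minus)
  moreover have "- k = floor_vec z \<longleftrightarrow> k = - floor_vec z" for k
    by (metis minus_minus)
  ultimately have "(\<lambda>k. indicator slab (z + lattice k) :: ennreal) = indicator {- floor_vec z}"
    by (simp add: indicator_def fun_eq_iff)
  then show "(\<integral>\<^sup>+k. indicator slab (z + lattice k) \<partial>count_space UNIV) = 1" by simp
qed

lemma nn_integral_shift:
  fixes F :: "'a::euclidean_space \<Rightarrow> ennreal"
  assumes "F \<in> borel_measurable borel"
  shows "(\<integral>\<^sup>+z. F (z + h) \<partial>lborel) = (\<integral>\<^sup>+z. F z \<partial>lborel)"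
proof -
  have "(\<integral>\<^sup>+z. F z \<partial>lborel) = (\<integral>\<^sup>+z. F z \<partial>distr lborel borel ((+) h))"
    by (simp add: lborel_distr_plus)
  also have "\<dots> = (\<integral>\<^sup>+z. F (h + z) \<partial>lborel)"
    using assms by (subst nn_integral_distr) auto
  finally show ?thesis by (simp add: add.commute)
qed

lemma nn_integral_tiling:
  fixes G :: "'n::finite spacetime \<Rightarrow> ennreal"
  assumes [measurable]: "G \<in> borel_measurable borel"
  shows "(\<integral>\<^sup>+z. G z \<partial>lborel)
       = (\<integral>\<^sup>+k. \<integral>\<^sup>+z. G (z + lattice k) * indicator slab z \<partial>lborel \<partial>count_space UNIV)"
proof -
  have "(\<integral>\<^sup>+z. G z \<partial>lborel)
      = (\<integral>\<^sup>+z. \<integral>\<^sup>+k. G z * indicator slab (z - lattice k) \<partial>count_space UNIV \<partial>lborel)"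
    by (simp add: nn_integral_cmult tiling_count)
  also have "\<dots> = (\<integral>\<^sup>+k. \<integral>\<^sup>+z. G z * indicator slab (z - lattice k) \<partial>lborel \<partial>count_space UNIV)"
    by (rule nn_integral_count_space_nn_integral) auto
  also have "\<dots> = (\<integral>\<^sup>+k. \<integral>\<^sup>+z. G (z + lattice k) * indicator slab z \<partial>lborel \<partial>count_space UNIV)"
  proof (rule nn_integral_cong)
    fix k :: "int ^ 'n"
    show "(\<integral>\<^sup>+z. G z * indicator slab (z - lattice k) \<partial>lborel) = (\<integral>\<^sup>+z. G (z + lattice k) * indicator slab z \<partial>lborel)"
      by (subst nn_integral_shift[of "\<lambda>z. G z * indicator slab (z - lattice k)" "lattice k", symmetric]) auto
  qed
  finally show ?thesis .
qed

text \<open>Cut the domain of integration along the lattice translates of the cell and move every piece back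
  into the cell: the pieces of a shifted cell fill the cell exactly once.\<close>

lemma slab_shift_nn:
  fixes F :: "'n::finite spacetime \<Rightarrow> ennreal"
  assumes [measurable]: "F \<in> borel_measurable borel" and per: "space_periodic F"
  shows "(\<integral>\<^sup>+z. F (z + h) * indicator slab z \<partial>lborel) = (\<integral>\<^sup>+z. F z * indicator slab z \<partial>lborel)"
proof -
  have "(\<integral>\<^sup>+z. F (z + h) * indicator slab z \<partial>lborel) = (\<integral>\<^sup>+z. F z * indicator slab (z - h) \<partial>lborel)"
    by (subst nn_integral_shift[of "\<lambda>z. F z * indicator slab (z - h)" h, symmetric]) auto
  also have "\<dots> = (\<integral>\<^sup>+k. \<integral>\<^sup>+z. F z * indicator slab z * indicator slab ((z - h) + lattice k) \<partial>lborel \<partial>count_space UNIV)"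
    by (subst nn_integral_tiling) (auto simp: periodic_lattice[OF per] algebra_simps)
  also have "\<dots> = (\<integral>\<^sup>+z. \<integral>\<^sup>+k. F z * indicator slab z * indicator slab ((z - h) + lattice k) \<partial>count_space UNIV \<partial>lborel)"
    by (rule nn_integral_count_space_nn_integral[symmetric]) auto
  also have "\<dots> = (\<integral>\<^sup>+z. F z * indicator slab z \<partial>lborel)"
    by (simp add: nn_integral_cmult tiling_count)
  finally show ?thesis .
qed

lemma slab_shift:
  fixes F :: "'n::finite spacetime \<Rightarrow> real"
  assumes [measurable]: "F \<in> borel_measurable borel" and per: "space_periodic F"
  shows "set_integrable lborel slab (\<lambda>z. F (z + h)) \<longleftrightarrow> set_integrable lborel slab F"
    and "(LINT z:slab|lborel. F (z + h)) = (LINT z:slab|lborel. F z)"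
proof -
  have nn: "(\<integral>\<^sup>+z. ennreal (G (indicator slab z *\<^sub>R F (z + h))) \<partial>lborel)
      = (\<integral>\<^sup>+z. ennreal (G (indicator slab z *\<^sub>R F z)) \<partial>lborel)"
    if G: "G 0 = 0" and [measurable]: "G \<in> borel_measurable borel" for G :: "real \<Rightarrow> real"
  proof -
    have "space_periodic (\<lambda>z. ennreal (G (F z)))"
      using per by (simp add: space_periodic_def)
    from slab_shift_nn[OF _ this, of h]
    have "(\<integral>\<^sup>+z. ennreal (G (F (z + h))) * indicator slab z \<partial>lborel) = (\<integral>\<^sup>+z. ennreal (G (F z)) * indicator slab z \<partial>lborel)"
      by simp
    moreover have "ennreal (G (indicator slab z *\<^sub>R x)) = ennreal (G x) * indicator slab z" for z :: "'n spacetime" and x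
      using G by (simp add: indicator_def)
    ultimately show ?thesis by simp
  qed
  have [measurable]: "(\<lambda>z. F (z + h)) \<in> borel_measurable borel" by measurable
  show iff: "set_integrable lborel slab (\<lambda>z. F (z + h)) \<longleftrightarrow> set_integrable lborel slab F"
    unfolding set_integrable_def integrable_iff_bounded
    using nn[of norm] by simp
  show "(LINT z:slab|lborel. F (z + h)) = (LINT z:slab|lborel. F z)"
  proof (cases "set_integrable lborel slab F")
    case True
    then show ?thesis
      using iff unfolding set_lebesgue_integral_def set_integrable_def
      using nn[of "\<lambda>x. x"] nn[of "\<lambda>x. - x"] by (simp add: real_lebesgue_integral_def)
  next
    case False
    then show ?thesis
      using iff unfolding set_lebesgue_integral_def set_integrable_def
      by (simp add: not_integrable_integral_eq)
  qed
qed

lemma finite_int_vec_box: "finite {k :: int ^ 'n::finite. \<forall>i. \<bar>k $ i\<bar> \<le> N}"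
proof -
  have "inj_on vec_nth {k :: int ^ 'n. \<forall>i. \<bar>k $ i\<bar> \<le> N}"
    by (auto simp: inj_on_def vec_eq_iff)
  moreover have "vec_nth ` {k :: int ^ 'n. \<forall>i. \<bar>k $ i\<bar> \<le> N} \<subseteq> (\<Pi>\<^sub>E i\<in>UNIV. {-N..N})"
    by (auto simp: abs_le_iff) (metis minus_le_iff)
  ultimately show ?thesis
    by (meson finite_PiE finite_atLeastAtMost_int finite_class.finite_UNIV inj_on_finite)
qed

text \<open>A ball meets only finitely many translates of the cell.\<close>

lemma locint_periodic:
  fixes f :: "'n::finite spacetime \<Rightarrow> 'b::euclidean_space"
  assumes m[measurable]: "f \<in> borel_measurable borel" and per: "space_periodic f"
    and int: "set_integrable lborel slab f"
  shows "locint f"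
  unfolding locint_def
proof (intro conjI allI)
  fix R :: real
  have [measurable]: "cball 0 R \<in> sets (borel :: 'n spacetime measure)" by simp
  have fR[measurable]: "(\<lambda>z. indicator (cball 0 R) z *\<^sub>R f z) \<in> borel_measurable borel" by measurable
  define K where "K = {k :: int ^ 'n. \<forall>i. \<bar>k $ i\<bar> \<le> \<lceil>R\<rceil> + 1}"
  have K: "k \<in> K" if "z \<in> slab" "z + lattice k \<in> cball 0 R" for z :: "'n spacetime" and k
  proof -
    have "\<bar>k $ i\<bar> \<le> \<lceil>R\<rceil> + 1" for i
    proof -
      have "\<bar>snd (z + lattice k) $ i\<bar> \<le> norm (snd (z + lattice k))" by (rule component_le_norm_cart)
      also have "\<dots> \<le> norm (z + lattice k)" by (metis norm_snd_le prod.collapse)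
      also have "\<dots> \<le> R" using that(2) by simp
      finally have "\<bar>snd z $ i + of_int (k $ i)\<bar> \<le> R" by (simp add: lattice_def)
      moreover have "0 \<le> snd z $ i" "snd z $ i < 1"
        using that(1) by (auto simp: slab_def unit_cell_def mem_Times_iff)
      ultimately show ?thesis by linarith
    qed
    then show ?thesis by (simp add: K_def)
  qed
  define C where "C = (\<integral>\<^sup>+z. ennreal (norm (f z)) * indicator slab z \<partial>lborel)"
  have C: "C < \<infinity>"
  proof -
    have "C = (\<integral>\<^sup>+z. ennreal (norm (indicator slab z *\<^sub>R f z)) \<partial>lborel)"
      unfolding C_def by (intro nn_integral_cong) (simp add: indicator_def)
    then show ?thesis using int unfolding set_integrable_def integrable_iff_bounded by simp
  qed
  have "(\<integral>\<^sup>+z. ennreal (norm (indicator (cball 0 R) z *\<^sub>R f z)) \<partial>lborel)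
      = (\<integral>\<^sup>+k. \<integral>\<^sup>+z. ennreal (norm (indicator (cball 0 R) (z + lattice k) *\<^sub>R f (z + lattice k))) * indicator slab z \<partial>lborel \<partial>count_space UNIV)"
  proof (rule nn_integral_tiling)
    show "(\<lambda>z. ennreal (norm (indicator (cball 0 R) z *\<^sub>R f z))) \<in> borel_measurable borel" by measurable
  qed
  also have "\<dots> \<le> (\<integral>\<^sup>+k. C * indicator K k \<partial>count_space UNIV)"
  proof (rule nn_integral_mono)
    fix k :: "int ^ 'n"
    have "(\<integral>\<^sup>+z. ennreal (norm (indicator (cball 0 R) (z + lattice k) *\<^sub>R f (z + lattice k))) * indicator slab z \<partial>lborel)
      \<le> (\<integral>\<^sup>+z. (ennreal (norm (f z)) * indicator slab z) * indicator K k \<partial>lborel)"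
      by (rule nn_integral_mono) (use K in \<open>auto simp: indicator_def periodic_lattice[OF per]\<close>)
    also have "\<dots> = C * indicator K k" unfolding C_def by (rule nn_integral_multc) measurable
    finally show "(\<integral>\<^sup>+z. ennreal (norm (indicator (cball 0 R) (z + lattice k) *\<^sub>R f (z + lattice k))) * indicator slab z \<partial>lborel) \<le> C * indicator K k" .
  qed
  also have "\<dots> = C * of_nat (card K)"
    using finite_int_vec_box[of "\<lceil>R\<rceil> + 1"]
    by (subst nn_integral_cmult_indicator) (auto simp: K_def emeasure_count_space)
  also have "\<dots> < \<infinity>" using C by (simp add: ennreal_mult_less_top of_nat_less_top)
  finally show "set_integrable lborel (cball 0 R) f"
    unfolding set_integrable_def integrable_iff_bounded using fR by simp
qed (rule m)

section \<open>Continuously differentiable test functions on the torus\<close>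

definition c1_torus :: "real \<Rightarrow> real \<Rightarrow> ('n::finite spacetime \<Rightarrow> real) \<Rightarrow> ('n spacetime \<Rightarrow> 'n spacetime) \<Rightarrow> bool" where
  "c1_torus a b g Dg \<longleftrightarrow> c1 g Dg \<and> space_periodic g \<and> (\<forall>z. fst z \<notin> {a..b} \<longrightarrow> g z = 0)"

lemma periodic_bounded:
  fixes F :: "'n::finite spacetime \<Rightarrow> 'b::real_normed_vector"
  assumes cont: "continuous_on UNIV F" and per: "space_periodic F" and z0: "\<And>z. fst z \<notin> {a..b} \<Longrightarrow> F z = 0"
  obtains B where "0 \<le> B" "\<And>z. norm (F z) \<le> B"
proof -
  have "compact (F ` ({a..b} \<times> cbox 0 1))"
    using cont by (intro compact_continuous_image compact_Times) (auto intro: continuous_on_subset)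
  then obtain B where B: "\<And>z. z \<in> {a..b} \<times> cbox 0 1 \<Longrightarrow> norm (F z) \<le> B"
    using compact_imp_bounded by (fastforce simp: bounded_iff)
  have "norm (F z) \<le> max B 0" for z
  proof (cases "fst z \<in> {a..b}")
    case True
    define y where "y = z - lattice (floor_vec z)"
    have "y \<in> slab" using slab_lattice_iff[of z "floor_vec z"] by (simp add: y_def)
    moreover have "fst y = fst z" by (simp add: y_def lattice_def)
    ultimately have "y \<in> {a..b} \<times> cbox 0 1"
      using True by (auto simp: slab_def unit_cell_def mem_Times_iff mem_box_cart less_imp_le)
    then have "norm (F y) \<le> B" by (rule B)
    then show ?thesis by (simp add: y_def periodic_lattice[OF per])
  qed (simp add: z0)
  then show ?thesis using that[of "max B 0"] by simp
qed

lemma c1_shift: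
  assumes "c1 g Dg" shows "c1 (\<lambda>z. g (z + h)) (\<lambda>z. Dg (z + h))"
proof -
  have "((\<lambda>z. g (z + h)) has_derivative (\<lambda>v. Dg (z + h) \<bullet> v)) (at z)" for z
  proof -
    have "((\<lambda>z. z + h) has_derivative (\<lambda>v. v)) (at z)" by (auto intro!: derivative_eq_intros)
    from has_derivative_compose[OF this c1D[OF assms]] show ?thesis .
  qed
  moreover have "continuous_on UNIV (\<lambda>z. Dg (z + h))"
    by (rule continuous_on_compose2[OF c1_cont[OF assms]]) (auto intro: continuous_intros)
  ultimately show ?thesis by (simp add: c1_def)
qed

lemma c1_gradient_periodic:
  fixes g :: "'n::finite spacetime \<Rightarrow> real"
  assumes "c1 g Dg" "space_periodic g"
  shows "space_periodic Dg"
  unfolding space_periodic_def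
proof (intro allI impI)
  fix t x and k :: "real ^ 'n" assume k: "\<forall>i. k $ i \<in> \<int>"
  have "(\<lambda>z. g (z + (0, k))) = g"
    using assms(2) k by (auto simp: space_periodic_def)
  then have "c1 g (\<lambda>z. Dg (z + (0, k)))"
    using c1_shift[OF assms(1), of "(0, k)"] by simp
  then have "Dg = (\<lambda>z. Dg (z + (0, k)))" using c1_nabla assms(1) by metis
  then show "Dg (t, x + k) = Dg (t, x)" by (simp add: fun_eq_iff)
qed

lemma c1_torusD:
  assumes "c1_torus a b g Dg"
  shows "c1 g Dg" "space_periodic g" "space_periodic Dg"
    "fst z \<notin> {a..b} \<Longrightarrow> g z = 0" "fst z \<notin> {a..b} \<Longrightarrow> Dg z = 0"
    "g \<in> borel_measurable borel" "Dg \<in> borel_measurable borel"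
proof -
  show c: "c1 g Dg" "space_periodic g" and z: "fst z \<notin> {a..b} \<Longrightarrow> g z = 0" for z
    using assms unfolding c1_torus_def by blast+
  show "space_periodic Dg" using c c1_gradient_periodic by blast
  show "Dg z = 0" if "fst z \<notin> {a..b}"
  proof (rule gradient_zero_on_open[OF c1D[OF c(1)], of "{z. fst z \<notin> {a..b}}"])
    have "{z::'a spacetime. fst z \<notin> {a..b}} = - (fst -` {a..b})" by auto
    then show "open {z::'a spacetime. fst z \<notin> {a..b}}"
      by (metis closed_atLeastAtMost closed_vimage_fst open_Compl)
  qed (use z that in auto)
  show "g \<in> borel_measurable borel" "Dg \<in> borel_measurable borel"
    using c1_continuous[OF c(1)] c1_cont[OF c(1)] by (auto intro: borel_measurable_continuous_onI)
qed

lemma c1_torus_bounds: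
  assumes "c1_torus a b g Dg"
  obtains B where "0 \<le> B" "\<And>z. \<bar>g z\<bar> \<le> B" "\<And>z. norm (Dg z) \<le> B"
proof -
  note D = c1_torusD[OF assms]
  obtain B1 where B1: "0 \<le> B1" "\<And>z. norm (g z) \<le> B1"
    using periodic_bounded[OF c1_continuous[OF D(1)] D(2,4)] by metis
  obtain B2 where B2: "0 \<le> B2" "\<And>z. norm (Dg z) \<le> B2"
    using periodic_bounded[OF c1_cont[OF D(1)] D(3,5)] by metis
  have "norm (g z) \<le> B1 + B2" "norm (Dg z) \<le> B1 + B2" for z
    using B1(1) B1(2)[of z] B2(1) B2(2)[of z] by linarith+
  then show ?thesis using that[of "B1 + B2"] B1(1) B2(1) by simp
qed

lemma strip_finite: "emeasure lborel ({a..b::real} \<times> (unit_cell :: (real^'n::finite) set)) < \<infinity>"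
  by (rule emeasure_bounded_finite, rule bounded_subset[of "{a..b} \<times> cbox 0 1"])
     (auto intro!: bounded_Times bounded_closed_interval simp: unit_cell_def mem_box_cart less_imp_le)

lemma strip_measurable[measurable]: "{a..b::real} \<times> (unit_cell :: (real^'n::finite) set) \<in> sets borel"
  unfolding borel_prod[symmetric] by (rule pair_measureI) auto

lemma slab_integrable_bounded:
  fixes F :: "'n::finite spacetime \<Rightarrow> 'b::euclidean_space"
  assumes [measurable]: "F \<in> borel_measurable borel" and z0: "\<And>z. fst z \<notin> {a..b} \<Longrightarrow> F z = 0"
    and B: "\<And>z. z \<in> slab \<Longrightarrow> norm (F z) \<le> B"
  shows "set_integrable lborel slab F"
proof -
  have i: "integrable lborel (\<lambda>z. indicator ({a..b} \<times> (unit_cell::(real^'n) set)) z * B)"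
    using strip_finite[of a b] by (intro integrable_mult_left integrable_real_indicator) auto
  show ?thesis
    unfolding set_integrable_def
  proof (rule Bochner_Integration.integrable_bound[OF i])
    show "AE z in lborel. norm (indicator slab z *\<^sub>R F z) \<le> norm (indicator ({a..b} \<times> unit_cell) z * B)"
    proof (rule AE_I2)
      fix z :: "'n spacetime"
      show "norm (indicator slab z *\<^sub>R F z) \<le> norm (indicator ({a..b} \<times> unit_cell) z * B)"
        using B[of z] z0[of z] norm_ge_zero[of "F z"]
        by (cases "z \<in> slab"; cases "fst z \<in> {a..b}") (auto simp: indicator_def slab_def mem_Times_iff abs_of_nonneg)
    qed
  qed measurable
qed

definition step_size :: "nat \<Rightarrow> real" where "step_size n = 1 / real (Suc n)"

lemma step_size_pos: "0 < step_size n" "step_size n \<le> 1"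
  by (simp_all add: step_size_def)

text \<open>Stated along a sequence of steps, as the dominated convergence theorem needs it.\<close>

lemma directional_quotient:
  assumes "c1 g Dg"
  shows "(\<lambda>n. (g (z + step_size n *\<^sub>R v) - g z) / step_size n) \<longlonglongrightarrow> Dg z \<bullet> v"
proof -
  have "((\<lambda>s. z + s *\<^sub>R v) has_derivative (\<lambda>s. s *\<^sub>R v)) (at (0::real))"
    by (auto intro!: derivative_eq_intros)
  from has_derivative_compose[OF this c1D[OF assms]]
  have "((\<lambda>s. g (z + s *\<^sub>R v)) has_real_derivative Dg z \<bullet> v) (at 0)"
    by (simp add: has_field_derivative_def mult.commute[of _ "Dg z \<bullet> v"])
  then have l: "((\<lambda>s. (g (z + s *\<^sub>R v) - g z) / s) \<longlongrightarrow> Dg z \<bullet> v) (at 0)"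
    by (simp add: DERIV_def)
  have "filterlim step_size (at 0) sequentially"
    unfolding filterlim_at using LIMSEQ_inverse_real_of_nat
    by (auto simp: step_size_def[abs_def] inverse_eq_divide intro!: always_eventually)
  from filterlim_compose[OF l this] show ?thesis by simp
qed

lemma quotient_bound:
  assumes "c1 g Dg" "\<And>z. norm (Dg z) \<le> B" "0 < s"
  shows "\<bar>(g (z + s *\<^sub>R v) - g z) / s\<bar> \<le> B * norm v"
proof -
  have "norm (g (z + s *\<^sub>R v) - g z) \<le> B * norm (z + s *\<^sub>R v - z)"
  proof (rule differentiable_bound[of UNIV g "\<lambda>x v. Dg x \<bullet> v"])
    show "(g has_derivative (\<bullet>) (Dg x)) (at x within UNIV)" for x using c1D[OF assms(1)] by simp
    show "onorm ((\<bullet>) (Dg x)) \<le> B" for x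
    proof (rule onorm_le)
      fix v show "norm (Dg x \<bullet> v) \<le> B * norm v"
        using Cauchy_Schwarz_ineq2[of "Dg x" v] mult_right_mono[OF assms(2)[of x], of "norm v"] by simp
    qed
  qed auto
  then show ?thesis using assms(3) by (simp add: field_simps abs_mult)
qed

text \<open>By translation invariance all difference quotients have integral zero; let the step tend to \<open>0\<close>.\<close>

lemma integral_gradient_zero:
  fixes v :: "'n::finite spacetime"
  assumes g: "c1_torus a b g Dg"
  shows "(LINT z:slab|lborel. Dg z \<bullet> v) = 0"
proof -
  note D = c1_torusD[OF g]
  have [measurable]: "g \<in> borel_measurable borel" "Dg \<in> borel_measurable borel" by (rule D)+
  obtain B where B: "0 \<le> B" "\<And>z. \<bar>g z\<bar> \<le> B" "\<And>z. norm (Dg z) \<le> B" using c1_torus_bounds[OF g] by metis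
  define q where "q n z = (g (z + step_size n *\<^sub>R v) - g z) / step_size n" for n z
  have gi: "set_integrable lborel slab g"
    using D(4) B(2) by (intro slab_integrable_bounded[where a = a and b = b and B = B]) auto
  have q0: "(LINT z:slab|lborel. q n z) = 0" for n
  proof -
    have "set_integrable lborel slab (\<lambda>z. g (z + step_size n *\<^sub>R v))"
      using gi by (subst slab_shift(1)) (auto simp: D)
    then have "(LINT z:slab|lborel. g (z + step_size n *\<^sub>R v) - g z) = 0"
      using gi by (subst set_integral_diff(2)) (auto simp: slab_shift(2) D)
    then show ?thesis by (simp add: q_def set_integral_divide_zero)
  qed
  define S where "S = {a - norm v .. b + norm v} \<times> (unit_cell :: (real^'n) set)"
  have "(\<lambda>n. LINT z|lborel. indicator slab z *\<^sub>R q n z) \<longlonglongrightarrow> (LINT z|lborel. indicator slab z *\<^sub>R (Dg z \<bullet> v))"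
  proof (rule integral_dominated_convergence[where w = "\<lambda>z. indicator S z * (B * norm v)"])
    show "integrable lborel (\<lambda>z. indicator S z * (B * norm v))"
      unfolding S_def using strip_finite[of "a - norm v" "b + norm v"]
      by (intro integrable_mult_left integrable_real_indicator) auto
    show "AE z in lborel. (\<lambda>n. indicator slab z *\<^sub>R q n z) \<longlonglongrightarrow> indicator slab z *\<^sub>R (Dg z \<bullet> v)"
      unfolding q_def using directional_quotient[OF D(1)] by (intro AE_I2 tendsto_intros)
    show "AE z in lborel. norm (indicator slab z *\<^sub>R q n z) \<le> indicator S z * (B * norm v)" for n
    proof (rule AE_I2)
      fix z :: "'n spacetime"
      show "norm (indicator slab z *\<^sub>R q n z) \<le> indicator S z * (B * norm v)"
      proof (cases "z \<in> slab \<and> z \<notin> S")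
        case True
        have "\<bar>step_size n * fst v\<bar> \<le> 1 * norm v"
          unfolding abs_mult using step_size_pos[of n] norm_fst_le[of "fst v" "snd v"] by (intro mult_mono) auto
        then have "\<bar>fst (z + step_size n *\<^sub>R v) - fst z\<bar> \<le> norm v" by simp
        moreover have "fst z \<notin> {a - norm v .. b + norm v}"
          using True by (auto simp: S_def slab_def mem_Times_iff)
        ultimately have "fst (z + step_size n *\<^sub>R v) \<notin> {a..b}" "fst z \<notin> {a..b}"
          using norm_ge_zero[of v] by (auto simp del: fst_add)
        then show ?thesis using B by (simp add: q_def D(4))
      next
        case False
        then show ?thesis
          using quotient_bound[OF D(1) B(3) step_size_pos(1)[of n], of z v] B(1) by (auto simp: q_def indicator_def)
      qed
    qed
  qed (auto simp: S_def q_def)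
  then have "(\<lambda>n::nat. 0) \<longlonglongrightarrow> (LINT z:slab|lborel. Dg z \<bullet> v)"
    using q0 by (simp add: set_lebesgue_integral_def)
  then show ?thesis using LIMSEQ_unique tendsto_const by blast
qed

section \<open>Conservation laws for mollified fields\<close>

lemma periodic_mol:
  assumes "space_periodic f" shows "space_periodic (mol \<epsilon> f)"
  unfolding space_periodic_def
proof (intro allI impI)
  fix t x and k :: "real ^ 'a" assume k: "\<forall>i. k $ i \<in> \<int>"
  have "f ((t, x + k) + w) = f ((t, x) + w)" for w
  proof -
    have "(t, x + k) + w = (t + fst w, (x + snd w) + k)" "(t, x) + w = (t + fst w, x + snd w)"
      by (simp_all add: plus_prod_def add_ac)
    then show ?thesis using assms k unfolding space_periodic_def by simp
  qed
  then show "mol \<epsilon> f (t, x + k) = mol \<epsilon> f (t, x)" by (simp only: mol_def)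
qed

lemma mol_time_support:
  fixes f :: "'n::finite spacetime \<Rightarrow> 'b::euclidean_space"
  assumes "\<And>z. fst z \<notin> {a..b} \<Longrightarrow> f z = 0" "0 < \<epsilon>" "fst z \<notin> {a - \<epsilon> .. b + \<epsilon>}"
  shows "mol \<epsilon> f z = 0"
proof -
  have "bump h *\<^sub>R f (z + \<epsilon> *\<^sub>R h) = 0" for h :: "'n spacetime"
  proof (cases "norm h < 1")
    case True
    have "\<bar>\<epsilon> * fst h\<bar> \<le> \<epsilon> * 1"
      unfolding abs_mult using assms(2) True norm_fst_le[of "fst h" "snd h"] by (intro mult_mono) auto
    then have "fst (z + \<epsilon> *\<^sub>R h) \<notin> {a..b}" using assms(3) by auto
    then show ?thesis using assms(1) by simp
  qed (simp add: bump_outside)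
  then show ?thesis by (simp only: mol_def Bochner_Integration.integral_zero)
qed

lemma locint_bounded:
  fixes f :: "'a::euclidean_space \<Rightarrow> 'b::euclidean_space"
  assumes [measurable]: "f \<in> borel_measurable borel" and B: "\<And>z. norm (f z) \<le> B"
  shows "locint f"
proof -
  have "set_integrable lborel (cball 0 R) f" for R
    unfolding set_integrable_def
  proof (rule Bochner_Integration.integrable_bound)
    show "integrable lborel (\<lambda>z::'a. indicator (cball 0 R) z *\<^sub>R B)"
      using locint_const[of B] by (auto simp: locint_def set_integrable_def)
    have "norm (f z) \<le> \<bar>B\<bar>" for z using B[of z] by simp
    then show "AE z in lborel. norm (indicator (cball 0 R) z *\<^sub>R f z) \<le> norm (indicator (cball 0 R) z *\<^sub>R B)"
      by (auto simp: indicator_def)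
  qed (intro borel_measurable_scaleR borel_measurable_indicator, auto)
  then show ?thesis using assms(1) by (simp add: locint_def)
qed

lemma mol_bound:
  fixes g :: "'a::euclidean_space \<Rightarrow> real"
  assumes "locint g" "\<epsilon> \<noteq> 0" "\<And>z. \<bar>g z\<bar> \<le> B"
  shows "\<bar>mol \<epsilon> g z\<bar> \<le> B"
proof -
  have "\<bar>mol \<epsilon> g z\<bar> \<le> (LINT h|lborel. bump (h::'a) * B)"
    unfolding mol_def real_norm_def[symmetric]
  proof (rule Bochner_Integration.integral_norm_bound_integral[OF mol_integrable[OF assms(1,2)] bump_const_integrable])
    show "norm (bump h *\<^sub>R g (z + \<epsilon> *\<^sub>R h)) \<le> bump h * B" for h
      using mult_left_mono[OF assms(3) bump_nonneg] by (simp add: abs_mult bump_nonneg abs_of_nonneg)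
  qed
  then show ?thesis by (simp add: integral_bump)
qed

text \<open>Mollifying commutes with the gradient: pass to the limit in the difference quotients.\<close>

lemma mol_gradient:
  fixes g :: "'n::finite spacetime \<Rightarrow> real"
  assumes g: "c1_torus a b g Dg" and \<epsilon>: "0 < \<epsilon>"
  shows "dmol \<epsilon> g = mol \<epsilon> Dg"
proof
  fix z
  note D = c1_torusD[OF g]
  obtain B where B: "0 \<le> B" "\<And>z. \<bar>g z\<bar> \<le> B" "\<And>z. norm (Dg z) \<le> B" using c1_torus_bounds[OF g] by metis
  have lg: "locint g" and lD: "locint Dg"
    using locint_bounded[of g B] locint_bounded[of Dg B] D(6,7) B by auto
  have "dmol \<epsilon> g z \<bullet> v = mol \<epsilon> Dg z \<bullet> v" for v
  proof -
    have 1: "(\<lambda>n. (mol \<epsilon> g (z + step_size n *\<^sub>R v) - mol \<epsilon> g z) / step_size n) \<longlonglongrightarrow> dmol \<epsilon> g z \<bullet> v"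
      by (rule directional_quotient[OF mol_c1[OF lg \<epsilon>]])
    let ?q = "\<lambda>n h. bump h * ((g (z + \<epsilon> *\<^sub>R h + step_size n *\<^sub>R v) - g (z + \<epsilon> *\<^sub>R h)) / step_size n)"
    have 2: "(mol \<epsilon> g (z + step_size n *\<^sub>R v) - mol \<epsilon> g z) / step_size n = (LINT h|lborel. ?q n h)" for n
    proof -
      have "mol \<epsilon> g (z + step_size n *\<^sub>R v) - mol \<epsilon> g z
          = (LINT h|lborel. bump h *\<^sub>R g (z + step_size n *\<^sub>R v + \<epsilon> *\<^sub>R h) - bump h *\<^sub>R g (z + \<epsilon> *\<^sub>R h))"
        unfolding mol_def using mol_integrable[OF lg] \<epsilon> by (intro Bochner_Integration.integral_diff[symmetric]) auto
      also have "\<dots> / step_size n = (LINT h|lborel. ?q n h)"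
        by (subst integral_divide_zero[symmetric])
           (intro Bochner_Integration.integral_cong, auto simp: algebra_simps diff_divide_distrib)
      finally show ?thesis .
    qed
    have "(\<lambda>n. LINT h|lborel. ?q n h) \<longlonglongrightarrow> (LINT h|lborel. bump h * (Dg (z + \<epsilon> *\<^sub>R h) \<bullet> v))"
    proof (rule integral_dominated_convergence[where w = "\<lambda>h. bump h * (B * norm v)"])
      show "AE h in lborel. (\<lambda>n. ?q n h) \<longlonglongrightarrow> bump h * (Dg (z + \<epsilon> *\<^sub>R h) \<bullet> v)"
        by (intro AE_I2 tendsto_intros directional_quotient[OF D(1)])
      have [measurable]: "g \<in> borel_measurable borel" "Dg \<in> borel_measurable borel" by (rule D)+
      show "(\<lambda>h. bump h * (Dg (z + \<epsilon> *\<^sub>R h) \<bullet> v)) \<in> borel_measurable lborel"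
        "\<And>n. (\<lambda>h. ?q n h) \<in> borel_measurable lborel" by measurable
      show "AE h in lborel. norm (?q n h) \<le> bump h * (B * norm v)" for n
        unfolding real_norm_def abs_mult abs_of_nonneg[OF bump_nonneg]
        by (intro AE_I2 mult_left_mono bump_nonneg quotient_bound[OF D(1) B(3) step_size_pos(1)])
    qed (rule bump_const_integrable)
    moreover have "(LINT h|lborel. bump h * (Dg (z + \<epsilon> *\<^sub>R h) \<bullet> v)) = mol \<epsilon> Dg z \<bullet> v"
    proof -
      have "(LINT h|lborel. (bump h *\<^sub>R Dg (z + \<epsilon> *\<^sub>R h)) \<bullet> v) = mol \<epsilon> Dg z \<bullet> v"
        unfolding mol_def by (rule integral_inner_left, rule mol_integrable[OF lD]) (use \<epsilon> in simp)
      then show ?thesis by (simp only: inner_scaleR_left)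
    qed
    ultimately have "(\<lambda>n. LINT h|lborel. ?q n h) \<longlonglongrightarrow> mol \<epsilon> Dg z \<bullet> v" by simp
    from LIMSEQ_unique[OF 1[unfolded 2] this] show ?thesis .
  qed
  then show "dmol \<epsilon> g z = mol \<epsilon> Dg z" by (metis inner_commute vector_eq_rdot)
qed

text \<open>For \<open>\<Lambda> = 0\<close> this is the conservation law with density and flux the components of \<open>V\<close>; for
  \<open>V = (0, u)\<close> it says that the divergence of \<open>u\<close> is a measure of total variation at most \<open>\<Lambda>\<close>. Both
  are mollified by the same argument.\<close>

definition weak_bound ::
  "real \<Rightarrow> real \<Rightarrow> ('n::finite spacetime \<Rightarrow> 'n spacetime) \<Rightarrow> bool" where
  "weak_bound T \<Lambda> V \<longleftrightarrow> (\<forall>\<phi>\<in>test_functions T. \<forall>B. (\<forall>z. \<bar>\<phi> z\<bar> \<le> B) \<longrightarrow>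
     \<bar>LINT z:slab|lborel. V z \<bullet> nabla \<phi> z\<bar> \<le> \<Lambda> * B)"

text \<open>By Fubini's theorem and the translation invariance of the torus, mollifying the field amounts
  to mollifying the test function, which makes a continuously differentiable one smooth.\<close>

lemma weak_bound_mol:
  fixes V :: "'n::finite spacetime \<Rightarrow> 'n spacetime"
  assumes w: "weak_bound T \<Lambda> V"
    and V[measurable]: "V \<in> borel_measurable borel" and Vp: "space_periodic V"
    and Vi: "set_integrable lborel slab V"
    and g: "c1_torus a b g Dg" and \<epsilon>: "0 < \<epsilon>" "\<epsilon> < a" "b + \<epsilon> < T"
    and gB: "\<And>z. \<bar>g z\<bar> \<le> B"
  shows "\<bar>LINT z:slab|lborel. mol \<epsilon> V z \<bullet> Dg z\<bar> \<le> \<Lambda> * B"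
proof -
  note D = c1_torusD[OF g]
  have [measurable]: "g \<in> borel_measurable borel" "Dg \<in> borel_measurable borel" by (rule D)+
  obtain C where C: "0 \<le> C" "\<And>z. \<bar>g z\<bar> \<le> C" "\<And>z. norm (Dg z) \<le> C" using c1_torus_bounds[OF g] by metis
  have lg: "locint g" and lD: "locint Dg" and lV: "locint V"
    using locint_bounded[of g C] locint_bounded[of Dg C] D(6,7) C locint_periodic[OF V Vp Vi] by auto
  define F where "F h z = indicator slab z * (bump h * (V (z + \<epsilon> *\<^sub>R h) \<bullet> Dg z))" for h z :: "'n spacetime"
  define G where "G h z = indicator slab z * (bump h * (V z \<bullet> Dg (z - \<epsilon> *\<^sub>R h)))" for h z :: "'n spacetime"
  have [measurable]: "(\<lambda>(h, z). F h z) \<in> borel_measurable (lborel \<Otimes>\<^sub>M lborel)"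
    "(\<lambda>(h, z). G h z) \<in> borel_measurable (lborel \<Otimes>\<^sub>M lborel)"
    unfolding F_def G_def by measurable
  have shift: "(LINT z|lborel. F h z) = (LINT z|lborel. G h z)" for h
  proof -
    have "space_periodic (\<lambda>z. V z \<bullet> Dg (z - \<epsilon> *\<^sub>R h))"
      unfolding space_periodic_def
    proof (intro allI impI)
      fix t x and k :: "real ^ 'n" assume k: "\<forall>i. k $ i \<in> \<int>"
      have "(t, x + k) - \<epsilon> *\<^sub>R h = (t - \<epsilon> * fst h, (x - \<epsilon> *\<^sub>R snd h) + k)"
        "(t, x) - \<epsilon> *\<^sub>R h = (t - \<epsilon> * fst h, x - \<epsilon> *\<^sub>R snd h)"
        by (simp_all add: minus_prod_def algebra_simps)
      then show "V (t, x + k) \<bullet> Dg ((t, x + k) - \<epsilon> *\<^sub>R h) = V (t, x) \<bullet> Dg ((t, x) - \<epsilon> *\<^sub>R h)"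
        using Vp D(3) k unfolding space_periodic_def by simp
    qed
    from slab_shift(2)[OF _ this, of "\<epsilon> *\<^sub>R h"]
    have "(LINT z:slab|lborel. V (z + \<epsilon> *\<^sub>R h) \<bullet> Dg z) = (LINT z:slab|lborel. V z \<bullet> Dg (z - \<epsilon> *\<^sub>R h))"
      by simp
    then have "bump h * (LINT z:slab|lborel. V (z + \<epsilon> *\<^sub>R h) \<bullet> Dg z) = bump h * (LINT z:slab|lborel. V z \<bullet> Dg (z - \<epsilon> *\<^sub>R h))"
      by simp
    then show ?thesis
      unfolding F_def G_def set_lebesgue_integral_def
      by (simp only: integral_mult_right_zero[symmetric] real_scaleR_def mult.left_commute[of "indicator slab _"])
  qed
  have Vni: "integrable lborel (\<lambda>z. indicator slab z * norm (V z))"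
    using integrable_norm[OF Vi[unfolded set_integrable_def]] by (simp add: abs_mult)
  define I where "I = (LINT z|lborel. indicator slab z * norm (V z))"
  have Vnh: "integrable lborel (\<lambda>z. indicator slab z * norm (V (z + h)))"
    "(LINT z|lborel. indicator slab z * norm (V (z + h))) = I" for h
  proof -
    have p: "space_periodic (\<lambda>z. norm (V z))" using Vp by (simp add: space_periodic_def)
    show "integrable lborel (\<lambda>z. indicator slab z * norm (V (z + h)))"
      "(LINT z|lborel. indicator slab z * norm (V (z + h))) = I"
      using slab_shift[OF _ p, of h] Vni by (simp_all add: set_integrable_def set_lebesgue_integral_def I_def)
  qed
  have Fb: "norm (F h z) \<le> (bump h * C) * (indicator slab z * norm (V (z + \<epsilon> *\<^sub>R h)))" for h z
  proof -
    have "\<bar>V (z + \<epsilon> *\<^sub>R h) \<bullet> Dg z\<bar> \<le> norm (V (z + \<epsilon> *\<^sub>R h)) * norm (Dg z)" by (rule Cauchy_Schwarz_ineq2)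
    also have "\<dots> \<le> norm (V (z + \<epsilon> *\<^sub>R h)) * C" using C by (intro mult_left_mono) auto
    finally have "(indicator slab z * bump h) * \<bar>V (z + \<epsilon> *\<^sub>R h) \<bullet> Dg z\<bar> \<le> (indicator slab z * bump h) * (norm (V (z + \<epsilon> *\<^sub>R h)) * C)"
      by (rule mult_left_mono) (simp add: bump_nonneg)
    then show ?thesis by (simp add: F_def abs_mult bump_nonneg mult_ac)
  qed
  have Gb: "norm (G h z) \<le> (bump h * C) * (indicator slab z * norm (V z))" for h z
  proof -
    have "\<bar>V z \<bullet> Dg (z - \<epsilon> *\<^sub>R h)\<bar> \<le> norm (V z) * norm (Dg (z - \<epsilon> *\<^sub>R h))" by (rule Cauchy_Schwarz_ineq2)
    also have "\<dots> \<le> norm (V z) * C" using C by (intro mult_left_mono) auto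
    finally have "(indicator slab z * bump h) * \<bar>V z \<bullet> Dg (z - \<epsilon> *\<^sub>R h)\<bar> \<le> (indicator slab z * bump h) * (norm (V z) * C)"
      by (rule mult_left_mono) (simp add: bump_nonneg)
    then show ?thesis by (simp add: G_def abs_mult bump_nonneg mult_ac)
  qed
  have inner_int: "integrable lborel (H h)" "(LINT z|lborel. norm (H h z)) \<le> bump h * (C * I)"
    if [measurable]: "(\<lambda>(h, z). H h z) \<in> borel_measurable (lborel \<Otimes>\<^sub>M lborel)"
      and b: "\<And>h z. norm (H h z) \<le> (bump h * C) * (indicator slab z * norm (V (z + k h)))"
    for H :: "'n spacetime \<Rightarrow> 'n spacetime \<Rightarrow> real" and h k
  proof -
    have i: "integrable lborel (\<lambda>z. (bump h * C) * (indicator slab z * norm (V (z + k h))))"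
      using Vnh(1) by (rule integrable_mult_right)
    show ih: "integrable lborel (H h)"
      by (rule Bochner_Integration.integrable_bound[OF i])
         (measurable, rule AE_I2, rule order_trans[OF b], simp)
    have "(LINT z|lborel. norm (H h z)) \<le> (LINT z|lborel. (bump h * C) * (indicator slab z * norm (V (z + k h))))"
      by (rule integral_mono[OF integrable_norm[OF ih] i b])
    then show "(LINT z|lborel. norm (H h z)) \<le> bump h * (C * I)" by (simp add: Vnh(2) mult.assoc)
  qed
  have pair_int: "integrable (lborel \<Otimes>\<^sub>M lborel) (\<lambda>(h, z). H h z)"
    if [measurable]: "(\<lambda>(h, z). H h z) \<in> borel_measurable (lborel \<Otimes>\<^sub>M lborel)"
      and b: "\<And>h z. norm (H h z) \<le> (bump h * C) * (indicator slab z * norm (V (z + k h)))"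
    for H :: "'n spacetime \<Rightarrow> 'n spacetime \<Rightarrow> real" and k
  proof (rule lborel_pair.Fubini_integrable)
    show "(\<lambda>(h, z). H h z) \<in> borel_measurable (lborel \<Otimes>\<^sub>M lborel)" by fact
    show "integrable lborel (\<lambda>h. LINT z|lborel. norm (case (h, z) of (h, z) \<Rightarrow> H h z))"
    proof (rule Bochner_Integration.integrable_bound)
      show "integrable lborel (\<lambda>h::'n spacetime. bump h * (C * I))" by (rule bump_const_integrable)
      show "AE h in lborel. norm (LINT z|lborel. norm (case (h, z) of (h, z) \<Rightarrow> H h z)) \<le> norm (bump h * (C * I))"
      proof (rule AE_I2)
        fix h :: "'n spacetime"
        have "0 \<le> (LINT z|lborel. norm (H h z))" by simp
        then show "norm (LINT z|lborel. norm (case (h, z) of (h, z) \<Rightarrow> H h z)) \<le> norm (bump h * (C * I))"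
          using inner_int(2)[of H k h, OF that] by simp
      qed
    qed measurable
    show "AE h in lborel. integrable lborel (\<lambda>z. case (h, z) of (h, z) \<Rightarrow> H h z)"
      using inner_int(1)[of H k, OF that] by simp
  qed
  have Fi: "integrable (lborel \<Otimes>\<^sub>M lborel) (\<lambda>(h, z). F h z)"
    by (rule pair_int[of F "\<lambda>h. \<epsilon> *\<^sub>R h"], measurable, rule Fb)
  have Gi: "integrable (lborel \<Otimes>\<^sub>M lborel) (\<lambda>(h, z). G h z)"
    by (rule pair_int[of G "\<lambda>h. 0"], measurable, unfold add_0_right, rule Gb)
  have "(LINT z:slab|lborel. mol \<epsilon> V z \<bullet> Dg z) = (LINT z|lborel. LINT h|lborel. F h z)"
  proof -
    have "indicator slab z * (mol \<epsilon> V z \<bullet> Dg z) = (LINT h|lborel. F h z)" for z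
      unfolding F_def mol_def
      using integral_inner_left[of "Dg z" lborel "\<lambda>h. bump h *\<^sub>R V (z + \<epsilon> *\<^sub>R h)"] mol_integrable[OF lV, of \<epsilon> z] \<epsilon>
      by simp
    then show ?thesis by (simp add: set_lebesgue_integral_def)
  qed
  also have "\<dots> = (LINT h|lborel. LINT z|lborel. F h z)"
    by (rule lborel_pair.Fubini_integral[OF Fi])
  also have "\<dots> = (LINT h|lborel. LINT z|lborel. G h z)" by (simp add: shift)
  also have "\<dots> = (LINT z|lborel. LINT h|lborel. G h z)"
    by (rule lborel_pair.Fubini_integral[OF Gi, symmetric])
  also have "\<dots> = (LINT z:slab|lborel. V z \<bullet> mol \<epsilon> Dg z)"
  proof -
    have "indicator slab z * (V z \<bullet> mol \<epsilon> Dg z) = (LINT h|lborel. G h z)" for z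
    proof -
      have "(LINT h|lborel. bump h * (V z \<bullet> Dg (z - \<epsilon> *\<^sub>R h))) = (LINT h|lborel. bump h * (V z \<bullet> Dg (z + \<epsilon> *\<^sub>R h)))"
        by (subst integral_affine(1)[where c = "-1" and t = 0]) (auto simp: bump_even)
      moreover have "V z \<bullet> mol \<epsilon> Dg z = (LINT h|lborel. bump h * (V z \<bullet> Dg (z + \<epsilon> *\<^sub>R h)))"
        unfolding mol_def
        using integral_inner_right[of "V z" lborel "\<lambda>h. bump h *\<^sub>R Dg (z + \<epsilon> *\<^sub>R h)"] mol_integrable[OF lD, of \<epsilon> z] \<epsilon>
        by simp
      ultimately show ?thesis by (simp add: G_def)
    qed
    then show ?thesis by (simp add: set_lebesgue_integral_def)
  qed
  also have "mol \<epsilon> Dg = nabla (mol \<epsilon> g)"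
    using mol_gradient[OF g \<epsilon>(1)] c1_nabla[OF mol_c1[OF lg \<epsilon>(1)]] by simp
  finally have e: "(LINT z:slab|lborel. mol \<epsilon> V z \<bullet> Dg z) = (LINT z:slab|lborel. V z \<bullet> nabla (mol \<epsilon> g) z)" .
  have "mol \<epsilon> g \<in> test_functions T"
  proof -
    have "mol \<epsilon> g (t, x) = 0" if "t \<notin> {a - \<epsilon> .. b + \<epsilon>}" for t x
      using mol_time_support[where f = g and a = a and b = b and z = "(t, x)", OF D(4) \<epsilon>(1)] that by simp
    moreover have "0 < a - \<epsilon>" "b + \<epsilon> < T" using \<epsilon> by simp_all
    ultimately show ?thesis
      unfolding test_functions_def using smooth_mol[OF lg \<epsilon>(1)] periodic_mol[OF D(2)] by blast
  qed
  moreover have "\<bar>mol \<epsilon> g z\<bar> \<le> B" for z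
    using mol_bound[OF lg _ gB] \<epsilon> by auto
  ultimately show ?thesis using w unfolding e weak_bound_def by blast
qed

section \<open>The pointwise energy balance and its remainder\<close>

text \<open>The letters stand for values at one point: \<open>U\<close>, \<open>m\<close>, \<open>q\<close>, \<open>r\<close> for the mollifications of \<open>u\<close>, \<open>\<rho> u\<close>,
  \<open>\<rho> u \<otimes> u\<close>, \<open>\<rho>\<close>, and \<open>a + b\<close> for that of the pressure, where \<open>b\<close> belongs to the pressure \<open>Q = r P' - P\<close>
  with a smooth potential. On the left, the momentum equation is tested with \<open>U \<phi>\<close>, the mass equation
  with \<open>- |U|\<^sup>2 \<phi> / 2\<close> and with \<open>P'(r) \<phi>\<close>; the divergence of \<open>Q(r) \<phi> (1, U)\<close> and the term \<open>a \<phi> div U\<close> are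
  subtracted. On the right stand the energy balance of the original fields and a remainder.\<close>

lemma energy_identity:
  fixes m U u Ut \<phi>x rx :: "'n::finite \<Rightarrow> real" and q Ux :: "'n \<Rightarrow> 'n \<Rightarrow> real"
    and \<phi> \<phi>t \<rho> r rt a b P P\<rho> P1 P2 Q Q\<rho> :: real
  defines "S \<equiv> \<Sum>i\<in>UNIV. U i * U i" and "s \<equiv> \<Sum>i\<in>UNIV. u i * u i"
  assumes Q: "Q = r * P1 - P"
  shows "(\<Sum>i\<in>UNIV. m i * (U i * \<phi>t + \<phi> * Ut i) + (\<Sum>j\<in>UNIV. q i j * (U i * \<phi>x j + \<phi> * Ux i j))
            + (a + b) * (U i * \<phi>x i + \<phi> * Ux i i))
      - (r * (1 / 2 * S * \<phi>t + \<phi> * (\<Sum>i\<in>UNIV. U i * Ut i))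
            + (\<Sum>j\<in>UNIV. m j * (1 / 2 * S * \<phi>x j + \<phi> * (\<Sum>i\<in>UNIV. U i * Ux i j))))
      + (r * (P1 * \<phi>t + \<phi> * (P2 * rt)) + (\<Sum>j\<in>UNIV. m j * (P1 * \<phi>x j + \<phi> * (P2 * rx j))))
      - ((Q * \<phi>t + \<phi> * (r * P2 * rt))
            + (\<Sum>i\<in>UNIV. Q * U i * \<phi>x i + \<phi> * (Q * Ux i i + U i * (r * P2 * rx i))))
      - a * \<phi> * (\<Sum>i\<in>UNIV. Ux i i)
    = \<phi>t * (1 / 2 * \<rho> * s + P\<rho>) + (1 / 2 * \<rho> * s + Q\<rho> + P\<rho>) * (\<Sum>j\<in>UNIV. u j * \<phi>x j)
      + ((\<Sum>i\<in>UNIV. \<phi> * ((m i - r * U i) * Ut i))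
       + (\<Sum>i\<in>UNIV. \<Sum>j\<in>UNIV. \<phi> * ((q i j - m j * U i) * Ux i j))
       + (\<Sum>j\<in>UNIV. \<phi> * P2 * ((m j - r * U j) * rx j))
       + (\<Sum>i\<in>UNIV. \<phi> * ((b - Q) * Ux i i))
       + (\<Sum>i\<in>UNIV. \<phi>t * (m i * U i - 1 / 2 * (r * U i * U i) - 1 / 2 * (\<rho> * u i * u i)))
       + (\<Sum>j\<in>UNIV. \<Sum>i\<in>UNIV. \<phi>x j * (q i j * U i - 1 / 2 * (m j * U i * U i) - 1 / 2 * (\<rho> * u j * u i * u i)))
       + (\<Sum>j\<in>UNIV. a * U j * \<phi>x j)
       + (\<Sum>j\<in>UNIV. (b * U j - Q\<rho> * u j) * \<phi>x j)
       + (\<Sum>j\<in>UNIV. P1 * (m j - r * U j) * \<phi>x j)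
       + ((P - P\<rho>) * \<phi>t + (\<Sum>j\<in>UNIV. (P * U j - P\<rho> * u j) * \<phi>x j)))"
proof -
  define mU where "mU = (\<Sum>i\<in>UNIV. m i * U i)"
  define mUt where "mUt = (\<Sum>i\<in>UNIV. m i * Ut i)"
  define UUt where "UUt = (\<Sum>i\<in>UNIV. U i * Ut i)"
  define qUx where "qUx = (\<Sum>i\<in>UNIV. \<Sum>j\<in>UNIV. q i j * Ux i j)"
  define mUUx where "mUUx = (\<Sum>i\<in>UNIV. \<Sum>j\<in>UNIV. m j * U i * Ux i j)"
  define qU where "qU = (\<Sum>j\<in>UNIV. \<Sum>i\<in>UNIV. \<phi>x j * (q i j * U i))"
  define m\<phi> where "m\<phi> = (\<Sum>j\<in>UNIV. m j * \<phi>x j)"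
  define U\<phi> where "U\<phi> = (\<Sum>j\<in>UNIV. U j * \<phi>x j)"
  define u\<phi> where "u\<phi> = (\<Sum>j\<in>UNIV. u j * \<phi>x j)"
  define dU where "dU = (\<Sum>i\<in>UNIV. Ux i i)"
  define mrx where "mrx = (\<Sum>j\<in>UNIV. m j * rx j)"
  define Urx where "Urx = (\<Sum>j\<in>UNIV. U j * rx j)"
  note defs = mU_def mUt_def UUt_def qUx_def mUUx_def qU_def m\<phi>_def U\<phi>_def u\<phi>_def dU_def mrx_def Urx_def S_def s_def
  have l1: "(\<Sum>i\<in>UNIV. m i * (U i * \<phi>t + \<phi> * Ut i) + (\<Sum>j\<in>UNIV. q i j * (U i * \<phi>x j + \<phi> * Ux i j))
            + (a + b) * (U i * \<phi>x i + \<phi> * Ux i i)) = \<phi>t * mU + \<phi> * mUt + qU + \<phi> * qUx + (a + b) * (U\<phi> + \<phi> * dU)"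
  proof -
    have qU': "qU = (\<Sum>i\<in>UNIV. \<Sum>j\<in>UNIV. \<phi>x j * (q i j * U i))"
      unfolding qU_def by (rule sum.swap)
    show ?thesis
      unfolding qU' mU_def mUt_def qUx_def U\<phi>_def dU_def sum_distrib_left sum.distrib[symmetric]
      by (intro sum.cong refl) (simp add: sum_distrib_left sum.distrib[symmetric] algebra_simps)
  qed
  have l2: "(\<Sum>j\<in>UNIV. m j * (1 / 2 * S * \<phi>x j + \<phi> * (\<Sum>i\<in>UNIV. U i * Ux i j))) = 1 / 2 * S * m\<phi> + \<phi> * mUUx"
  proof -
    have mUUx': "mUUx = (\<Sum>j\<in>UNIV. \<Sum>i\<in>UNIV. m j * U i * Ux i j)"
      unfolding mUUx_def by (rule sum.swap)
    show ?thesis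
      unfolding mUUx' m\<phi>_def sum_distrib_left sum.distrib[symmetric]
      by (intro sum.cong refl) (simp add: sum_distrib_left sum.distrib[symmetric] algebra_simps)
  qed
  have l3: "(\<Sum>j\<in>UNIV. m j * (P1 * \<phi>x j + \<phi> * (P2 * rx j))) = P1 * m\<phi> + \<phi> * P2 * mrx"
    unfolding defs sum_distrib_left sum.distrib[symmetric] by (intro sum.cong refl) (simp add: algebra_simps)
  have l4: "(\<Sum>i\<in>UNIV. Q * U i * \<phi>x i + \<phi> * (Q * Ux i i + U i * (r * P2 * rx i))) = Q * U\<phi> + \<phi> * Q * dU + \<phi> * r * P2 * Urx"
    unfolding defs sum_distrib_left sum.distrib[symmetric] by (intro sum.cong refl) (simp add: algebra_simps)
  have e1: "(\<Sum>i\<in>UNIV. \<phi> * ((m i - r * U i) * Ut i)) = \<phi> * (mUt - r * UUt)"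
    unfolding defs sum_distrib_left sum_subtractf[symmetric] by (intro sum.cong refl) (simp add: algebra_simps)
  have e2: "(\<Sum>i\<in>UNIV. \<Sum>j\<in>UNIV. \<phi> * ((q i j - m j * U i) * Ux i j)) = \<phi> * (qUx - mUUx)"
    unfolding defs sum_distrib_left sum_subtractf[symmetric] by (intro sum.cong refl) (simp add: algebra_simps)
  have e3: "(\<Sum>j\<in>UNIV. \<phi> * P2 * ((m j - r * U j) * rx j)) = \<phi> * P2 * (mrx - r * Urx)"
    unfolding defs sum_distrib_left sum_subtractf[symmetric] by (intro sum.cong refl) (simp add: algebra_simps)
  have e4: "(\<Sum>i\<in>UNIV. \<phi> * ((b - Q) * Ux i i)) = \<phi> * (b - Q) * dU"
    unfolding defs sum_distrib_left by (intro sum.cong refl) (simp add: algebra_simps)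
  have e5: "(\<Sum>i\<in>UNIV. \<phi>t * (m i * U i - 1 / 2 * (r * U i * U i) - 1 / 2 * (\<rho> * u i * u i)))
      = \<phi>t * (mU - 1 / 2 * r * S - 1 / 2 * \<rho> * s)"
    unfolding defs sum_distrib_left sum_subtractf[symmetric] by (intro sum.cong refl) (simp add: algebra_simps)
  have e6: "(\<Sum>j\<in>UNIV. \<Sum>i\<in>UNIV. \<phi>x j * (q i j * U i - 1 / 2 * (m j * U i * U i) - 1 / 2 * (\<rho> * u j * u i * u i)))
      = qU - 1 / 2 * S * m\<phi> - 1 / 2 * \<rho> * s * u\<phi>"
  proof -
    have 1: "S * m\<phi> = (\<Sum>j\<in>UNIV. \<Sum>i\<in>UNIV. (m j * \<phi>x j) * (U i * U i))"
      unfolding S_def m\<phi>_def by (subst mult.commute) (rule sum_product)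
    have 2: "s * u\<phi> = (\<Sum>j\<in>UNIV. \<Sum>i\<in>UNIV. (u j * \<phi>x j) * (u i * u i))"
      unfolding s_def u\<phi>_def by (subst mult.commute) (rule sum_product)
    have "qU - 1 / 2 * (S * m\<phi>) - 1 / 2 * \<rho> * (s * u\<phi>)
      = (\<Sum>j\<in>UNIV. \<Sum>i\<in>UNIV. \<phi>x j * (q i j * U i) - 1 / 2 * ((m j * \<phi>x j) * (U i * U i)) - 1 / 2 * \<rho> * ((u j * \<phi>x j) * (u i * u i)))"
      unfolding 1 2 qU_def sum_distrib_left sum_subtractf ..
    also have "\<dots> = (\<Sum>j\<in>UNIV. \<Sum>i\<in>UNIV. \<phi>x j * (q i j * U i - 1 / 2 * (m j * U i * U i) - 1 / 2 * (\<rho> * u j * u i * u i)))"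
      by (intro sum.cong refl) (simp add: algebra_simps)
    finally show ?thesis by (simp only: mult.assoc)
  qed
  have e7: "(\<Sum>j\<in>UNIV. a * U j * \<phi>x j) = a * U\<phi>"
    unfolding defs sum_distrib_left by (intro sum.cong refl) (simp add: algebra_simps)
  have e8: "(\<Sum>j\<in>UNIV. (b * U j - Q\<rho> * u j) * \<phi>x j) = b * U\<phi> - Q\<rho> * u\<phi>"
    unfolding defs sum_distrib_left sum_subtractf[symmetric] by (intro sum.cong refl) (simp add: algebra_simps)
  have e9: "(\<Sum>j\<in>UNIV. P1 * (m j - r * U j) * \<phi>x j) = P1 * (m\<phi> - r * U\<phi>)"
    unfolding defs sum_distrib_left sum_subtractf[symmetric] by (intro sum.cong refl) (simp add: algebra_simps)
  have e10: "(\<Sum>j\<in>UNIV. (P * U j - P\<rho> * u j) * \<phi>x j) = P * U\<phi> - P\<rho> * u\<phi>"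
    unfolding defs sum_distrib_left sum_subtractf[symmetric] by (intro sum.cong refl) (simp add: algebra_simps)
  show ?thesis
    unfolding l1 l2 l3 l4 e1 e2 e3 e4 e5 e6 e7 e8 e9 e10 UUt_def[symmetric] u\<phi>_def[symmetric] dU_def[symmetric]
    unfolding Q by (simp add: algebra_simps)
qed

lemma abs_mult_le: "\<bar>x\<bar> \<le> A \<Longrightarrow> \<bar>y\<bar> \<le> B \<Longrightarrow> \<bar>x * y\<bar> \<le> A * (B::real)"
  unfolding abs_mult by (intro mult_mono) auto

lemma abs_add_le: "\<bar>x\<bar> \<le> A \<Longrightarrow> \<bar>y\<bar> \<le> B \<Longrightarrow> \<bar>x + y\<bar> \<le> A + (B::real)"
  by linarith

lemma abs_sum_le_card:
  fixes f :: "'n::finite \<Rightarrow> real"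
  assumes "\<And>i. \<bar>f i\<bar> \<le> B"
  shows "\<bar>\<Sum>i\<in>UNIV. f i\<bar> \<le> real CARD('n) * B"
  using order_trans[OF sum_abs[of f UNIV] sum_bounded_above[of UNIV "\<lambda>i. \<bar>f i\<bar>" B]] assms by simp

text \<open>In the critical terms the derivative of a mollified function, which costs \<open>\<epsilon>\<^sup>-\<^sup>1\<close>, multiplies a
  commutator; the sizes \<open>eu = \<epsilon> powr \<alpha>\<close> and \<open>er = \<epsilon> powr \<beta>\<close> of the increments compensate it because
  \<open>2 \<alpha> + \<beta> > 1\<close> and \<open>\<alpha> + 2 \<beta> > 1\<close>. The other terms contain increments or commutators and no derivative
  of a mollified function, except for the one with \<open>a\<close>. That one is only as small as the error \<open>\<delta>\<close> of
  the approximate pressure, so its constant \<open>Y\<close> must be kept apart from \<open>X\<close>, which depends on the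
  approximation.\<close>

lemma energy_remainder_bound:
  fixes m U u Ut \<phi>x rx :: "'n::finite \<Rightarrow> real" and q Ux :: "'n \<Rightarrow> 'n \<Rightarrow> real"
    and \<phi> \<phi>t \<rho> r rt a b P P\<rho> P1 P2 Q Q\<rho> :: real
  assumes X: "1 \<le> X" and w: "1 \<le> w" and th: "0 \<le> \<theta>" "\<theta> \<le> 1" and e: "0 < e"
    and eu: "0 \<le> eu" "eu \<le> \<theta>" and er: "0 \<le> er" "er \<le> \<theta>"
    and t1: "er * eu * (eu / e) \<le> \<theta>" and t2: "er * er * (eu / e) \<le> \<theta>"
    and \<phi>: "\<bar>\<phi>\<bar> \<le> X" "\<bar>\<phi>t\<bar> \<le> X" "\<And>j. \<bar>\<phi>x j\<bar> \<le> X"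
    and u: "\<And>i. \<bar>u i\<bar> \<le> w" "\<And>i. \<bar>\<rho> * u i\<bar> \<le> w"
    and d: "\<And>i. \<bar>U i - u i\<bar> \<le> X * (eu * w)" "\<And>i. \<bar>m i - \<rho> * u i\<bar> \<le> X * (er * w)" "\<bar>r - \<rho>\<bar> \<le> X * (er * w)"
    and D: "\<And>i. \<bar>Ut i\<bar> \<le> X * (eu * w / e)" "\<And>i j. \<bar>Ux i j\<bar> \<le> X * (eu * w / e)" "\<And>j. \<bar>rx j\<bar> \<le> X * (er * w / e)"
    and c: "\<And>i. \<bar>m i - r * U i\<bar> \<le> X * ((er * w) * (eu * w))" "\<And>i j. \<bar>q i j - m j * U i\<bar> \<le> X * ((er * w) * (eu * w))"
    and b: "\<bar>b - Q\<bar> \<le> X * ((er * w) * (er * w))" "\<bar>b - Q\<rho>\<bar> \<le> X * (er * w)"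
    and a: "\<bar>a\<bar> \<le> \<delta>" and Y: "\<And>i. \<bar>U i\<bar> \<le> Y * w" "\<And>j. \<bar>\<phi>x j\<bar> \<le> Y"
    and P: "\<bar>P - P\<rho>\<bar> \<le> X * \<bar>r - \<rho>\<bar>" "\<bar>P1\<bar> \<le> X" "\<bar>P2\<bar> \<le> X" "\<bar>P\<rho>\<bar> \<le> X" "\<bar>Q\<rho>\<bar> \<le> X"
  shows "\<bar>(\<Sum>i\<in>UNIV. \<phi> * ((m i - r * U i) * Ut i))
       + (\<Sum>i\<in>UNIV. \<Sum>j\<in>UNIV. \<phi> * ((q i j - m j * U i) * Ux i j))
       + (\<Sum>j\<in>UNIV. \<phi> * P2 * ((m j - r * U j) * rx j))
       + (\<Sum>i\<in>UNIV. \<phi> * ((b - Q) * Ux i i))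
       + (\<Sum>i\<in>UNIV. \<phi>t * (m i * U i - 1 / 2 * (r * U i * U i) - 1 / 2 * (\<rho> * u i * u i)))
       + (\<Sum>j\<in>UNIV. \<Sum>i\<in>UNIV. \<phi>x j * (q i j * U i - 1 / 2 * (m j * U i * U i) - 1 / 2 * (\<rho> * u j * u i * u i)))
       + (\<Sum>j\<in>UNIV. a * U j * \<phi>x j)
       + (\<Sum>j\<in>UNIV. (b * U j - Q\<rho> * u j) * \<phi>x j)
       + (\<Sum>j\<in>UNIV. P1 * (m j - r * U j) * \<phi>x j)
       + ((P - P\<rho>) * \<phi>t + (\<Sum>j\<in>UNIV. (P * U j - P\<rho> * u j) * \<phi>x j))\<bar>
     \<le> (100 * (real CARD('n))\<^sup>2 * X ^ 4) * \<theta> * w ^ 3 + \<delta> * (real CARD('n) * Y ^ 2) * w ^ 3"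
proof -
  define n where "n = real CARD('n)"
  have n: "1 \<le> n" by (simp add: n_def)
  have w0: "0 \<le> w" and X0: "0 \<le> X" using w X by auto
  have d0: "0 \<le> \<delta>" using a by linarith
  define M where "M = X ^ 4 * \<theta> * w ^ 3"
  have M0: "0 \<le> M" using X0 th w0 by (simp add: M_def)
  have wk: "w ^ k \<le> w ^ 3" if "k \<le> 3" for k using that w by (rule power_increasing)
  have Xk: "X ^ k \<le> X ^ 4" if "k \<le> 4" for k using that X by (rule power_increasing)
  have le_M: "X ^ k * s \<le> M" if "k \<le> 4" "j \<le> 3" "0 \<le> s" "s \<le> \<theta> * w ^ j" for k j s
  proof -
    have "X ^ k * s \<le> X ^ 4 * (\<theta> * w ^ 3)"
      using that Xk wk X0 th w0 by (intro mult_mono order_trans[OF that(4)] mult_left_mono) auto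
    then show ?thesis by (simp add: M_def mult.assoc)
  qed
  have s1: "eu * w \<le> \<theta> * w" "er * w \<le> \<theta> * w"
    using eu er w0 by (auto intro: mult_right_mono)
  have eu1: "eu \<le> 1" "er \<le> 1" using eu er th by linarith+
  have s2: "(er * w) * (eu * w) \<le> \<theta> * w ^ 2"
  proof -
    have "er * eu \<le> \<theta> * 1" using er eu eu1 th by (intro mult_mono) auto
    then have "(er * eu) * (w * w) \<le> \<theta> * (w * w)" using w0 by (intro mult_right_mono) auto
    then show ?thesis by (simp add: power2_eq_square mult_ac)
  qed
  have s3: "((er * w) * (eu * w)) * (eu * w / e) \<le> \<theta> * w ^ 3" "((er * w) * (er * w)) * (eu * w / e) \<le> \<theta> * w ^ 3"
    "((er * w) * (eu * w)) * (er * w / e) \<le> \<theta> * w ^ 3"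
    using mult_right_mono[OF t1, of "w ^ 3"] mult_right_mono[OF t2, of "w ^ 3"] w0
    by (simp_all add: power3_eq_cube mult_ac)
  have nn: "0 \<le> ((er * w) * (eu * w)) * (eu * w / e)" "0 \<le> ((er * w) * (er * w)) * (eu * w / e)"
    "0 \<le> ((er * w) * (eu * w)) * (er * w / e)" "0 \<le> (er * w) * (eu * w)" "0 \<le> er * w" "0 \<le> eu * w"
    using er eu w0 e by simp_all
  have Ub: "\<bar>U i\<bar> \<le> 2 * X * w" for i
  proof -
    have "X * (eu * w) \<le> X * (1 * w)" using eu1 w0 X0 by (intro mult_left_mono mult_right_mono) auto
    moreover have "1 * w \<le> X * w" using X w0 by (intro mult_right_mono) auto
    ultimately show ?thesis using d(1)[of i] u(1)[of i] by linarith
  qed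
  have mb: "\<bar>m i\<bar> \<le> 2 * X * w" for i
  proof -
    have "X * (er * w) \<le> X * (1 * w)" using eu1 w0 X0 by (intro mult_left_mono mult_right_mono) auto
    moreover have "1 * w \<le> X * w" using X w0 by (intro mult_right_mono) auto
    ultimately show ?thesis using d(2)[of i] u(2)[of i] by linarith
  qed
  have E1: "\<bar>\<phi> * ((m i - r * U i) * Ut i)\<bar> \<le> M" for i
  proof -
    have "\<bar>\<phi> * ((m i - r * U i) * Ut i)\<bar> \<le> X * ((X * ((er * w) * (eu * w))) * (X * (eu * w / e)))"
      by (intro abs_mult_le \<phi> c D)
    also have "\<dots> = X ^ 3 * (((er * w) * (eu * w)) * (eu * w / e))" by (simp add: power3_eq_cube mult_ac)
    also have "\<dots> \<le> M" by (rule le_M[OF _ _ nn(1) s3(1)]) auto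
    finally show ?thesis .
  qed
  have E2: "\<bar>\<phi> * ((q i j - m j * U i) * Ux i j)\<bar> \<le> M" for i j
  proof -
    have "\<bar>\<phi> * ((q i j - m j * U i) * Ux i j)\<bar> \<le> X * ((X * ((er * w) * (eu * w))) * (X * (eu * w / e)))"
      by (intro abs_mult_le \<phi> c D)
    also have "\<dots> = X ^ 3 * (((er * w) * (eu * w)) * (eu * w / e))" by (simp add: power3_eq_cube mult_ac)
    also have "\<dots> \<le> M" by (rule le_M[OF _ _ nn(1) s3(1)]) auto
    finally show ?thesis .
  qed
  have E3: "\<bar>\<phi> * P2 * ((m j - r * U j) * rx j)\<bar> \<le> M" for j
  proof -
    have "\<bar>\<phi> * P2 * ((m j - r * U j) * rx j)\<bar> \<le> X * X * ((X * ((er * w) * (eu * w))) * (X * (er * w / e)))"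
      by (intro abs_mult_le \<phi> c D P)
    also have "\<dots> = X ^ 4 * (((er * w) * (eu * w)) * (er * w / e))" by (simp add: power4_eq_xxxx mult_ac)
    also have "\<dots> \<le> M" by (rule le_M[OF _ _ nn(3) s3(3)]) auto
    finally show ?thesis .
  qed
  have E4: "\<bar>\<phi> * ((b - Q) * Ux i i)\<bar> \<le> M" for i
  proof -
    have "\<bar>\<phi> * ((b - Q) * Ux i i)\<bar> \<le> X * ((X * ((er * w) * (er * w))) * (X * (eu * w / e)))"
      by (intro abs_mult_le \<phi> b D)
    also have "\<dots> = X ^ 3 * (((er * w) * (er * w)) * (eu * w / e))" by (simp add: power3_eq_cube mult_ac)
    also have "\<dots> \<le> M" by (rule le_M[OF _ _ nn(2) s3(2)]) auto
    finally show ?thesis .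
  qed
  have f1: "\<bar>\<rho> * u i * (U k - u k)\<bar> \<le> X * (\<theta> * w ^ 2)" for i k
  proof -
    have "\<bar>\<rho> * u i * (U k - u k)\<bar> \<le> w * (X * (eu * w))" by (intro abs_mult_le u d)
    also have "\<dots> \<le> w * (X * (\<theta> * w))" using s1 er eu w0 X0 by (intro mult_left_mono) auto
    finally show ?thesis by (simp add: power2_eq_square mult_ac)
  qed
  have f2: "\<bar>(m i - \<rho> * u i) * U k\<bar> \<le> 2 * X ^ 2 * (\<theta> * w ^ 2)" for i k
  proof -
    have "\<bar>(m i - \<rho> * u i) * U k\<bar> \<le> (X * (er * w)) * (2 * X * w)" by (intro abs_mult_le d Ub)
    also have "\<dots> \<le> (X * (\<theta> * w)) * (2 * X * w)" using s1 er eu w0 X0 by (intro mult_right_mono mult_left_mono) auto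
    finally show ?thesis by (simp add: power2_eq_square mult_ac)
  qed
  have f3: "\<bar>(m i - r * U i) * U k\<bar> \<le> 2 * X ^ 2 * (\<theta> * w ^ 3)" for i k
  proof -
    have "\<bar>(m i - r * U i) * U k\<bar> \<le> (X * ((er * w) * (eu * w))) * (2 * X * w)" by (intro abs_mult_le c Ub)
    also have "\<dots> \<le> (X * (\<theta> * w ^ 2)) * (2 * X * w)" using s2 w0 X0 by (intro mult_right_mono mult_left_mono) auto
    finally show ?thesis by (simp add: power2_eq_square power3_eq_cube mult_ac)
  qed
  have th0: "0 \<le> \<theta> * w ^ j" for j using th w0 by simp
  have E5: "\<bar>\<phi>t * (m i * U i - 1 / 2 * (r * U i * U i) - 1 / 2 * (\<rho> * u i * u i))\<bar> \<le> 5 * M" for i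
  proof -
    have "m i * U i - 1 / 2 * (r * U i * U i) - 1 / 2 * (\<rho> * u i * u i)
       = 1 / 2 * ((m i - \<rho> * u i) * U i) + 1 / 2 * (\<rho> * u i * (U i - u i)) + 1 / 2 * ((m i - r * U i) * U i)"
      by (simp add: field_simps)
    also have "\<bar>\<dots>\<bar> \<le> X ^ 2 * (\<theta> * w ^ 2) + X * (\<theta> * w ^ 2) + X ^ 2 * (\<theta> * w ^ 3)"
      using f1[of i i] f2[of i i] f3[of i i] th0[of 2] X0 mult_nonneg_nonneg[OF X0 th0[of 2]] by linarith
    finally have "\<bar>\<phi>t * (m i * U i - 1 / 2 * (r * U i * U i) - 1 / 2 * (\<rho> * u i * u i))\<bar>
      \<le> X * (X ^ 2 * (\<theta> * w ^ 2) + X * (\<theta> * w ^ 2) + X ^ 2 * (\<theta> * w ^ 3))"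
      by (intro abs_mult_le \<phi>)
    also have "\<dots> = X ^ 3 * (\<theta> * w ^ 2) + X ^ 2 * (\<theta> * w ^ 2) + X ^ 3 * (\<theta> * w ^ 3)"
      by (simp add: power2_eq_square power3_eq_cube algebra_simps)
    also have "\<dots> \<le> 5 * M"
      using le_M[of 3 2 "\<theta> * w ^ 2"] le_M[of 2 2 "\<theta> * w ^ 2"] le_M[of 3 3 "\<theta> * w ^ 3"] th0 M0 by simp
    finally show ?thesis .
  qed
  have E6: "\<bar>\<phi>x j * (q i j * U i - 1 / 2 * (m j * U i * U i) - 1 / 2 * (\<rho> * u j * u i * u i))\<bar> \<le> 10 * M" for i j
  proof -
    have g1: "\<bar>(q i j - m j * U i) * U i\<bar> \<le> 2 * X ^ 2 * (\<theta> * w ^ 3)"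
    proof -
      have "\<bar>(q i j - m j * U i) * U i\<bar> \<le> (X * ((er * w) * (eu * w))) * (2 * X * w)" by (intro abs_mult_le c Ub)
      also have "\<dots> \<le> (X * (\<theta> * w ^ 2)) * (2 * X * w)" using s2 w0 X0 by (intro mult_right_mono mult_left_mono) auto
      finally show ?thesis by (simp add: power2_eq_square power3_eq_cube mult_ac)
    qed
    have g2: "\<bar>(m j - \<rho> * u j) * U i * U i\<bar> \<le> 4 * X ^ 3 * (\<theta> * w ^ 3)"
      using abs_mult_le[OF f2[of j i] Ub[of i]] by (simp add: power2_eq_square power3_eq_cube mult_ac)
    have g3: "\<bar>\<rho> * u j * (U i - u i) * U i\<bar> \<le> 2 * X ^ 2 * (\<theta> * w ^ 3)"
      using abs_mult_le[OF f1[of j i] Ub[of i]] by (simp add: power2_eq_square power3_eq_cube mult_ac)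
    have g4: "\<bar>\<rho> * u j * (U i - u i) * u i\<bar> \<le> X * (\<theta> * w ^ 3)"
      using abs_mult_le[OF f1[of j i] u(1)[of i]] by (simp add: power2_eq_square power3_eq_cube mult_ac)
    have "q i j * U i - 1 / 2 * (m j * U i * U i) - 1 / 2 * (\<rho> * u j * u i * u i)
       = (q i j - m j * U i) * U i + 1 / 2 * ((m j - \<rho> * u j) * U i * U i) + 1 / 2 * (\<rho> * u j * (U i - u i) * U i)
         + 1 / 2 * (\<rho> * u j * (U i - u i) * u i)"
      by (simp add: field_simps)
    also have "\<bar>\<dots>\<bar> \<le> 2 * X ^ 2 * (\<theta> * w ^ 3) + 2 * X ^ 3 * (\<theta> * w ^ 3) + X ^ 2 * (\<theta> * w ^ 3) + X * (\<theta> * w ^ 3)"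
      using g1 g2 g3 g4 mult_nonneg_nonneg[OF X0 th0[of 3]] by linarith
    finally have "\<bar>\<phi>x j * (q i j * U i - 1 / 2 * (m j * U i * U i) - 1 / 2 * (\<rho> * u j * u i * u i))\<bar>
      \<le> X * (2 * X ^ 2 * (\<theta> * w ^ 3) + 2 * X ^ 3 * (\<theta> * w ^ 3) + X ^ 2 * (\<theta> * w ^ 3) + X * (\<theta> * w ^ 3))"
      by (intro abs_mult_le \<phi>)
    also have "\<dots> = 3 * (X ^ 3 * (\<theta> * w ^ 3)) + 2 * (X ^ 4 * (\<theta> * w ^ 3)) + X ^ 2 * (\<theta> * w ^ 3)"
      by (simp add: power2_eq_square power3_eq_cube power4_eq_xxxx algebra_simps)
    also have "\<dots> \<le> 10 * M"
      using le_M[of 3 3 "\<theta> * w ^ 3"] le_M[of 4 3 "\<theta> * w ^ 3"] le_M[of 2 3 "\<theta> * w ^ 3"] th0 M0 by simp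
    finally show ?thesis .
  qed
  have E7: "\<bar>a * U j * \<phi>x j\<bar> \<le> \<delta> * Y ^ 2 * w ^ 3" for j
  proof -
    have "\<bar>a * U j * \<phi>x j\<bar> \<le> \<delta> * (Y * w) * Y" by (intro abs_mult_le a Y)
    also have "\<dots> = \<delta> * Y ^ 2 * w ^ 1" by (simp add: power2_eq_square mult_ac)
    also have "\<dots> \<le> \<delta> * Y ^ 2 * w ^ 3" using wk[of 1] d0 by (intro mult_left_mono) auto
    finally show ?thesis .
  qed
  have lin: "\<bar>x * U j - y * u j\<bar> \<le> 3 * X ^ 3 * (\<theta> * w ^ 3)"
    if "\<bar>x - y\<bar> \<le> X\<^sup>2 * (er * w)" "\<bar>y\<bar> \<le> X" for x y j
  proof -
    have "\<bar>(x - y) * U j\<bar> \<le> (X\<^sup>2 * (er * w)) * (2 * X * w)" by (intro abs_mult_le that Ub)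
    also have "\<dots> \<le> (X\<^sup>2 * (\<theta> * w)) * (2 * X * w)" using s1 er eu w0 X0 by (intro mult_right_mono mult_left_mono) auto
    also have "\<dots> = 2 * X ^ 3 * (\<theta> * w ^ 2)" by (simp add: power2_eq_square power3_eq_cube mult_ac)
    also have "\<dots> \<le> 2 * X ^ 3 * (\<theta> * w ^ 3)" using wk[of 2] X0 th by (intro mult_left_mono) auto
    finally have 1: "\<bar>(x - y) * U j\<bar> \<le> 2 * X ^ 3 * (\<theta> * w ^ 3)" .
    have "\<bar>y * (U j - u j)\<bar> \<le> X * (X * (eu * w))" by (intro abs_mult_le that d)
    also have "\<dots> \<le> X * (X * (\<theta> * w))" using s1 er eu w0 X0 by (intro mult_left_mono) auto
    also have "\<dots> = X ^ 2 * (\<theta> * w ^ 1)" by (simp add: power2_eq_square)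
    also have "\<dots> \<le> X ^ 3 * (\<theta> * w ^ 3)"
      using wk[of 1] X0 X th w0 w by (intro mult_mono mult_left_mono power_increasing) auto
    finally have 2: "\<bar>y * (U j - u j)\<bar> \<le> X ^ 3 * (\<theta> * w ^ 3)" .
    have "x * U j - y * u j = (x - y) * U j + y * (U j - u j)" by (simp add: algebra_simps)
    then show ?thesis using 1 2 by linarith
  qed
  have linM: "\<bar>(x * U j - y * u j) * \<phi>x j\<bar> \<le> 3 * M" if "\<bar>x - y\<bar> \<le> X\<^sup>2 * (er * w)" "\<bar>y\<bar> \<le> X" for x y j
    using abs_mult_le[OF lin[OF that] \<phi>(3)[of j], of j] by (simp add: M_def power3_eq_cube power4_eq_xxxx mult_ac)
  have E8: "\<bar>(b * U j - Q\<rho> * u j) * \<phi>x j\<bar> \<le> 3 * M" for j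
  proof (rule linM)
    have "X * (er * w) \<le> X\<^sup>2 * (er * w)"
      using power_increasing[of 1 2 X] X er w0 by (intro mult_right_mono) auto
    then show "\<bar>b - Q\<rho>\<bar> \<le> X\<^sup>2 * (er * w)" using b(2) by linarith
  qed (rule P)
  have E9: "\<bar>P1 * (m j - r * U j) * \<phi>x j\<bar> \<le> M" for j
  proof -
    have "\<bar>P1 * (m j - r * U j) * \<phi>x j\<bar> \<le> X * (X * ((er * w) * (eu * w))) * X" by (intro abs_mult_le P c \<phi>)
    also have "\<dots> = X ^ 3 * ((er * w) * (eu * w))" by (simp add: power3_eq_cube mult_ac)
    also have "\<dots> \<le> M" by (rule le_M[OF _ _ nn(4) s2]) auto
    finally show ?thesis .
  qed
  have PP: "\<bar>P - P\<rho>\<bar> \<le> X\<^sup>2 * (er * w)"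
    using order_trans[OF P(1) mult_left_mono[OF d(3) X0]] by (simp add: power2_eq_square mult_ac)
  have E10a: "\<bar>(P - P\<rho>) * \<phi>t\<bar> \<le> M"
  proof -
    have "\<bar>(P - P\<rho>) * \<phi>t\<bar> \<le> (X\<^sup>2 * (er * w)) * X" by (intro abs_mult_le PP \<phi>)
    also have "\<dots> = X ^ 3 * (er * w)" by (simp add: power3_eq_cube power2_eq_square mult_ac)
    also have "\<dots> \<le> M" using s1 by (intro le_M[of _ 1, OF _ _ nn(5)]) auto
    finally show ?thesis .
  qed
  have E10b: "\<bar>(P * U j - P\<rho> * u j) * \<phi>x j\<bar> \<le> 3 * M" for j
    by (rule linM[OF PP P(4)])
  have nM: "n * x \<le> n\<^sup>2 * x" if "0 \<le> x" for x
    using mult_right_mono[of n "n\<^sup>2" x] power_increasing[of 1 2 n] n that by simp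
  have M1: "M \<le> n\<^sup>2 * M" "n * M \<le> n\<^sup>2 * M"
    using mult_right_mono[of 1 "n\<^sup>2" M] nM[OF M0] n M0 by (simp_all add: one_le_power)
  have dbl: "\<bar>\<Sum>i\<in>UNIV. \<Sum>j\<in>UNIV. f i j\<bar> \<le> n\<^sup>2 * B" if "\<And>i j. \<bar>f i j\<bar> \<le> B" for f :: "'n \<Rightarrow> 'n \<Rightarrow> real" and B
    using abs_sum_le_card[OF abs_sum_le_card[OF that]] by (simp add: n_def power2_eq_square mult.assoc)
  have S0: "\<bar>(\<Sum>i\<in>UNIV. \<phi> * ((m i - r * U i) * Ut i))\<bar> \<le> n * M"
    unfolding n_def by (rule abs_sum_le_card) (rule E1)
  have S1: "\<bar>(\<Sum>i\<in>UNIV. \<Sum>j\<in>UNIV. \<phi> * ((q i j - m j * U i) * Ux i j))\<bar> \<le> n\<^sup>2 * M"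
    by (rule dbl) (rule E2)
  have S2: "\<bar>(\<Sum>j\<in>UNIV. \<phi> * P2 * ((m j - r * U j) * rx j))\<bar> \<le> n * M"
    unfolding n_def by (rule abs_sum_le_card) (rule E3)
  have S3: "\<bar>(\<Sum>i\<in>UNIV. \<phi> * ((b - Q) * Ux i i))\<bar> \<le> n * M"
    unfolding n_def by (rule abs_sum_le_card) (rule E4)
  have S4: "\<bar>(\<Sum>i\<in>UNIV. \<phi>t * (m i * U i - 1 / 2 * (r * U i * U i) - 1 / 2 * (\<rho> * u i * u i)))\<bar> \<le> n * (5 * M)"
    unfolding n_def by (rule abs_sum_le_card) (rule E5)
  have S5: "\<bar>(\<Sum>j\<in>UNIV. \<Sum>i\<in>UNIV. \<phi>x j * (q i j * U i - 1 / 2 * (m j * U i * U i) - 1 / 2 * (\<rho> * u j * u i * u i)))\<bar> \<le> n\<^sup>2 * (10 * M)"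
    by (rule dbl) (rule E6)
  have S6: "\<bar>(\<Sum>j\<in>UNIV. a * U j * \<phi>x j)\<bar> \<le> n * (\<delta> * Y ^ 2 * w ^ 3)"
    unfolding n_def by (rule abs_sum_le_card) (rule E7)
  have S7: "\<bar>(\<Sum>j\<in>UNIV. (b * U j - Q\<rho> * u j) * \<phi>x j)\<bar> \<le> n * (3 * M)"
    unfolding n_def by (rule abs_sum_le_card) (rule E8)
  have S8: "\<bar>(\<Sum>j\<in>UNIV. P1 * (m j - r * U j) * \<phi>x j)\<bar> \<le> n * M"
    unfolding n_def by (rule abs_sum_le_card) (rule E9)
  have S9: "\<bar>(\<Sum>j\<in>UNIV. (P * U j - P\<rho> * u j) * \<phi>x j)\<bar> \<le> n * (3 * M)"
    unfolding n_def by (rule abs_sum_le_card) (rule E10b)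
  have "n * (\<delta> * Y ^ 2 * w ^ 3) = \<delta> * (n * Y ^ 2) * w ^ 3" by simp
  moreover have "(100 * n\<^sup>2 * X ^ 4) * \<theta> * w ^ 3 = 100 * (n\<^sup>2 * M)" by (simp add: M_def)
  ultimately have total: "n * M + n\<^sup>2 * M + n * M + n * M + n * (5 * M) + n\<^sup>2 * (10 * M)
      + n * (\<delta> * Y ^ 2 * w ^ 3) + n * (3 * M) + n * M + (M + n * (3 * M))
      \<le> (100 * n\<^sup>2 * X ^ 4) * \<theta> * w ^ 3 + \<delta> * (n * Y ^ 2) * w ^ 3"
    using M1 M0 by linarith
  show ?thesis
    unfolding n_def[symmetric]
    by (rule order_trans[OF _ total]) (intro abs_add_le S0 S1 S2 S3 S4 S5 S6 S7 S8 S9 E10a)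
qed

section \<open>Smooth pressure potentials and mollified fluxes\<close>

lemma lipschitz_of_derivative_bound:
  fixes f :: "real \<Rightarrow> real"
  assumes "\<And>x. (f has_real_derivative f' x) (at x)" "\<And>x. x \<in> {-R..R} \<Longrightarrow> \<bar>f' x\<bar> \<le> L"
    and "x \<in> {-R..R}" "y \<in> {-R..R}"
  shows "\<bar>f x - f y\<bar> \<le> L * \<bar>x - y\<bar>"
proof -
  have "norm (f x - f y) \<le> L * norm (x - y)"
    by (rule field_differentiable_bound[where S = "{-R..R}" and f' = f'])
       (use assms in \<open>auto intro: has_field_derivative_at_within\<close>)
  then show ?thesis by simp
qed

lemma taylor_quadratic_bound:
  fixes f :: "real \<Rightarrow> real"
  assumes "\<And>x. (f has_real_derivative f1 x) (at x)" "\<And>x. (f1 has_real_derivative f2 x) (at x)"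
    and "\<And>x. x \<in> {-R..R} \<Longrightarrow> \<bar>f2 x\<bar> \<le> L" and x: "x \<in> {-R..R}" and y: "y \<in> {-R..R}"
  shows "\<bar>f x - f y - f1 y * (x - y)\<bar> \<le> L * (x - y)\<^sup>2"
proof -
  let ?g = "\<lambda>t. f t - f1 y * t"
  have 1: "norm (?g x - ?g y) \<le> L * \<bar>x - y\<bar> * norm (x - y)"
  proof (rule field_differentiable_bound[where S = "closed_segment x y" and f' = "\<lambda>t. f1 t - f1 y"])
    fix t assume t: "t \<in> closed_segment x y"
    show "(?g has_field_derivative f1 t - f1 y) (at t within closed_segment x y)"
      by (rule has_field_derivative_at_within) (auto intro!: derivative_eq_intros assms)
    have tR: "t \<in> {-R..R}" "\<bar>t - y\<bar> \<le> \<bar>x - y\<bar>"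
      using t x y by (auto simp: closed_segment_eq_real_ivl split: if_splits)
    then have "\<bar>f1 t - f1 y\<bar> \<le> L * \<bar>t - y\<bar>"
      using assms by (intro lipschitz_of_derivative_bound[where f' = f2 and R = R]) auto
    also have "\<dots> \<le> L * \<bar>x - y\<bar>"
      using tR(2) assms(3)[OF tR(1)] by (intro mult_left_mono) auto
    finally show "norm (f1 t - f1 y) \<le> L * \<bar>x - y\<bar>" by simp
  qed auto
  have 2: "?g x - ?g y = f x - f y - f1 y * (x - y)" by (simp add: algebra_simps)
  have 3: "L * \<bar>x - y\<bar> * norm (x - y) = L * (x - y)\<^sup>2" by (simp add: power2_eq_square)
  show ?thesis using 1 unfolding 2 3 by simp
qed

lemma continuous_bound:
  fixes f :: "real \<Rightarrow> real"
  assumes "continuous_on UNIV f"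
  shows "\<exists>L. \<forall>x\<in>{-R..R}. \<bar>f x\<bar> \<le> L"
proof -
  have "compact (f ` {-R..R})"
    using assms by (intro compact_continuous_image) (auto intro: continuous_on_subset)
  then show ?thesis using compact_imp_bounded by (fastforce simp: bounded_iff)
qed

text \<open>The relation \<open>Q = r P' - P\<close> makes the mass equation, multiplied by \<open>P'\<close>, the balance law for \<open>P\<close>. The
  derivatives are named up to the third, which controls the Taylor remainder of \<open>Q\<close>.\<close>

definition potential_pair ::
  "(real \<Rightarrow> real) \<Rightarrow> (real \<Rightarrow> real) \<Rightarrow> (real \<Rightarrow> real) \<Rightarrow> (real \<Rightarrow> real) \<Rightarrow> (real \<Rightarrow> real) \<Rightarrow> bool" where
  "potential_pair P P1 P2 P3 Q \<longleftrightarrow>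
     (\<forall>x. (P has_real_derivative P1 x) (at x)) \<and> (\<forall>x. (P1 has_real_derivative P2 x) (at x)) \<and>
     (\<forall>x. (P2 has_real_derivative P3 x) (at x)) \<and> continuous_on UNIV P3 \<and> (\<forall>x. Q x = x * P1 x - P x)"

lemma potential_pairD:
  assumes "potential_pair P P1 P2 P3 Q"
  shows "(P has_real_derivative P1 x) (at x)" "(P1 has_real_derivative P2 x) (at x)"
    "(P2 has_real_derivative P3 x) (at x)" "continuous_on UNIV P3"
    "continuous_on UNIV P" "continuous_on UNIV P1" "continuous_on UNIV P2" "continuous_on UNIV Q"
    "(Q has_real_derivative x * P2 x) (at x)" "((\<lambda>x. x * P2 x) has_real_derivative P2 x + x * P3 x) (at x)"
    "Q x = x * P1 x - P x"
proof -
  show d: "(P has_real_derivative P1 x) (at x)" "(P1 has_real_derivative P2 x) (at x)"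
    "(P2 has_real_derivative P3 x) (at x)" and c3: "continuous_on UNIV P3" and q: "Q x = x * P1 x - P x" for x
    using assms by (auto simp: potential_pair_def)
  show c: "continuous_on UNIV P" "continuous_on UNIV P1" "continuous_on UNIV P2"
    using d by (meson DERIV_isCont continuous_at_imp_continuous_on)+
  have Q: "Q = (\<lambda>x. x * P1 x - P x)" using q by blast
  show "continuous_on UNIV Q" unfolding Q using c by (intro continuous_intros)
  show "(Q has_real_derivative x * P2 x) (at x)"
    unfolding Q by (auto intro!: derivative_eq_intros d)
  show "((\<lambda>x. x * P2 x) has_real_derivative P2 x + x * P3 x) (at x)"
    by (auto intro!: derivative_eq_intros d)
qed

lemma potential_pair_constants:
  assumes pp: "potential_pair P P1 P2 P3 Q"
  obtains L where "1 \<le> L"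
    "\<And>x. x \<in> {-R..R} \<Longrightarrow> \<bar>P x\<bar> \<le> L" "\<And>x. x \<in> {-R..R} \<Longrightarrow> \<bar>P1 x\<bar> \<le> L"
    "\<And>x. x \<in> {-R..R} \<Longrightarrow> \<bar>P2 x\<bar> \<le> L" "\<And>x. x \<in> {-R..R} \<Longrightarrow> \<bar>Q x\<bar> \<le> L"
    "\<And>x y. x \<in> {-R..R} \<Longrightarrow> y \<in> {-R..R} \<Longrightarrow> \<bar>P x - P y\<bar> \<le> L * \<bar>x - y\<bar>"
    "\<And>x y. x \<in> {-R..R} \<Longrightarrow> y \<in> {-R..R} \<Longrightarrow> \<bar>Q x - Q y\<bar> \<le> L * \<bar>x - y\<bar>"
    "\<And>x y. x \<in> {-R..R} \<Longrightarrow> y \<in> {-R..R} \<Longrightarrow> \<bar>Q x - Q y - (y * P2 y) * (x - y)\<bar> \<le> L * (x - y)\<^sup>2"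
proof -
  note d = potential_pairD[OF pp]
  have cont: "continuous_on UNIV (\<lambda>x. x * P2 x)" "continuous_on UNIV (\<lambda>x. P2 x + x * P3 x)"
    using d(4,7) by (auto intro!: continuous_intros)
  obtain L1 where L1: "\<And>x. x \<in> {-R..R} \<Longrightarrow> \<bar>P x\<bar> \<le> L1"
    using continuous_bound[OF d(5), of R] by blast
  obtain L2 where L2: "\<And>x. x \<in> {-R..R} \<Longrightarrow> \<bar>P1 x\<bar> \<le> L2"
    using continuous_bound[OF d(6), of R] by blast
  obtain L3 where L3: "\<And>x. x \<in> {-R..R} \<Longrightarrow> \<bar>P2 x\<bar> \<le> L3"
    using continuous_bound[OF d(7), of R] by blast
  obtain L4 where L4: "\<And>x. x \<in> {-R..R} \<Longrightarrow> \<bar>Q x\<bar> \<le> L4"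
    using continuous_bound[OF d(8), of R] by blast
  obtain L5 where L5: "\<And>x. x \<in> {-R..R} \<Longrightarrow> \<bar>x * P2 x\<bar> \<le> L5"
    using continuous_bound[OF cont(1), of R] by blast
  obtain L6 where L6: "\<And>x. x \<in> {-R..R} \<Longrightarrow> \<bar>P2 x + x * P3 x\<bar> \<le> L6"
    using continuous_bound[OF cont(2), of R] by blast
  note L = L1 L2 L3 L4 L5 L6
  define L where "L = 1 + \<bar>L1\<bar> + \<bar>L2\<bar> + \<bar>L3\<bar> + \<bar>L4\<bar> + \<bar>L5\<bar> + \<bar>L6\<bar>"
  have le: "L1 \<le> L" "L2 \<le> L" "L3 \<le> L" "L4 \<le> L" "L5 \<le> L" "L6 \<le> L" "1 \<le> L" by (auto simp: L_def)
  note LL = order_trans[OF L(1) le(1)] order_trans[OF L(2) le(2)] order_trans[OF L(3) le(3)]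
    order_trans[OF L(4) le(4)] order_trans[OF L(5) le(5)] order_trans[OF L(6) le(6)]
  show ?thesis
  proof (rule that[OF le(7) LL(1-4)])
    show "\<bar>P x - P y\<bar> \<le> L * \<bar>x - y\<bar>" if "x \<in> {-R..R}" "y \<in> {-R..R}" for x y
      by (rule lipschitz_of_derivative_bound[OF d(1) LL(2) that])
    show "\<bar>Q x - Q y\<bar> \<le> L * \<bar>x - y\<bar>" if "x \<in> {-R..R}" "y \<in> {-R..R}" for x y
      by (rule lipschitz_of_derivative_bound[OF d(9) LL(5) that])
    show "\<bar>Q x - Q y - (y * P2 y) * (x - y)\<bar> \<le> L * (x - y)\<^sup>2" if "x \<in> {-R..R}" "y \<in> {-R..R}" for x y
      by (rule taylor_quadratic_bound[OF d(9,10) LL(6) that])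
  qed
qed

lemma mol_linear:
  assumes "bounded_linear L" "locint f" "\<epsilon> \<noteq> 0"
  shows "mol \<epsilon> (\<lambda>z. L (f z)) z = L (mol \<epsilon> f z)"
proof -
  interpret L: bounded_linear L by fact
  show ?thesis
    unfolding mol_def using integral_bounded_linear[OF assms(1) mol_integrable[OF assms(2,3)]]
    by (simp add: L.scaleR)
qed

lemma locint_linear:
  fixes L :: "'b::euclidean_space \<Rightarrow> 'c::euclidean_space"
  assumes "bounded_linear L" "locint f"
  shows "locint (\<lambda>z. L (f z))"
  unfolding locint_def
proof (intro conjI allI)
  interpret L: bounded_linear L by fact
  have [measurable]: "f \<in> borel_measurable borel" using assms by (simp add: locint_def)
  have [measurable]: "L \<in> borel_measurable borel"
    using linear_continuous_on[OF assms(1)] by (rule borel_measurable_continuous_onI)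
  show "(\<lambda>z. L (f z)) \<in> borel_measurable borel" by measurable
  show "set_integrable lborel (cball 0 R) (\<lambda>z. L (f z))" for R
  proof -
    have "set_integrable lborel (cball 0 R) f" using assms by (simp add: locint_def)
    from integrable_bounded_linear[OF assms(1) this[unfolded set_integrable_def]]
    show ?thesis unfolding set_integrable_def by (simp add: L.scaleR)
  qed
qed

lemma bounded_linear_snd_nth: "bounded_linear (\<lambda>x :: 'n::finite spacetime. snd x $ j)"
  using bounded_linear_compose[OF bounded_linear_vec_nth bounded_linear_snd] .

lemma spacetime_inner:
  fixes x y :: "'n::finite spacetime"
  shows "x \<bullet> y = fst x * fst y + (\<Sum>j\<in>UNIV. snd x $ j * snd y $ j)"
  by (simp add: inner_prod_def inner_vec_def)

lemma mol_flux:
  fixes V :: "'n::finite spacetime \<Rightarrow> 'n spacetime"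
  assumes "locint V" "\<epsilon> \<noteq> 0"
  shows "mol \<epsilon> V z \<bullet> D = mol \<epsilon> (\<lambda>z. fst (V z)) z * fst D + (\<Sum>j\<in>UNIV. mol \<epsilon> (\<lambda>z. snd (V z) $ j) z * snd D $ j)"
  unfolding spacetime_inner
  using mol_linear[OF bounded_linear_fst assms] mol_linear[OF bounded_linear_snd_nth assms] by simp

lemma integrable_c1_torus:
  fixes F :: "'n::finite spacetime \<Rightarrow> real"
  assumes "continuous_on UNIV F" "space_periodic F" "\<And>z. fst z \<notin> {a..b} \<Longrightarrow> F z = 0"
  shows "set_integrable lborel slab F"
proof -
  obtain B where B: "\<And>z. norm (F z) \<le> B" using periodic_bounded[OF assms] by metis
  show ?thesis
    using borel_measurable_continuous_onI[OF assms(1)] assms(3) B by (rule slab_integrable_bounded)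
qed

lemma mol_flux_integrable:
  fixes V :: "'n::finite spacetime \<Rightarrow> 'n spacetime"
  assumes V: "locint V" "space_periodic V" and e: "0 < \<epsilon>" and g: "c1_torus a b g Dg"
  shows "set_integrable lborel slab (\<lambda>z. mol \<epsilon> V z \<bullet> Dg z)"
proof (rule integrable_c1_torus)
  note D = c1_torusD[OF g]
  have "continuous_on UNIV (mol \<epsilon> (\<lambda>z. fst (V z)))" "continuous_on UNIV (mol \<epsilon> (\<lambda>z. snd (V z) $ j))" for j
    using smooth_continuous[OF smooth_mol[OF locint_linear[OF bounded_linear_fst V(1)] e]]
      smooth_continuous[OF smooth_mol[OF locint_linear[OF bounded_linear_snd_nth V(1)] e]] by auto
  then show "continuous_on UNIV (\<lambda>z. mol \<epsilon> V z \<bullet> Dg z)"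
    unfolding mol_flux[OF V(1) less_imp_neq[OF e, symmetric]]
    using c1_cont[OF D(1)] by (intro continuous_intros)
  show "space_periodic (\<lambda>z. mol \<epsilon> V z \<bullet> Dg z)"
    using periodic_mol[OF V(2), of \<epsilon>] D(3) by (simp add: space_periodic_def)
  show "mol \<epsilon> V z \<bullet> Dg z = 0" if "fst z \<notin> {a..b}" for z using D(5)[OF that] by simp
qed

lemma gradient_integrable:
  assumes g: "c1_torus a b g Dg"
  shows "set_integrable lborel slab (\<lambda>z. Dg z \<bullet> v)"
proof (rule integrable_c1_torus)
  note D = c1_torusD[OF g]
  show "continuous_on UNIV (\<lambda>z. Dg z \<bullet> v)" using c1_cont[OF D(1)] by (intro continuous_intros)
  show "space_periodic (\<lambda>z. Dg z \<bullet> v)" using D(3) by (simp add: space_periodic_def)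
  show "Dg z \<bullet> v = 0" if "fst z \<notin> {a..b}" for z using D(5)[OF that] by simp
qed

lemma c1_torus_mult:
  assumes "c1 f Df" "space_periodic f" "c1_torus a b g Dg"
  shows "c1_torus a b (\<lambda>z. f z * g z) (\<lambda>z. f z *\<^sub>R Dg z + g z *\<^sub>R Df z)"
  using c1_mult[OF assms(1) c1_torusD(1)[OF assms(3)]] assms c1_torusD[OF assms(3)]
  by (auto simp: c1_torus_def space_periodic_def)

lemma c1_eq: "c1 g Dg \<Longrightarrow> (\<And>z. Dg z = Dg' z) \<Longrightarrow> c1 g Dg'"
  using ext[of Dg Dg'] by simp

section \<open>Besov regularity and integrated oscillations\<close>

text \<open>The third power of the Besov condition, for the exponent \<open>3\<close>.\<close>

definition besov_bound :: "real \<Rightarrow> real \<Rightarrow> real \<Rightarrow> ('n::finite spacetime \<Rightarrow> 'b::euclidean_space) \<Rightarrow> bool" where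
  "besov_bound T M \<gamma> f \<longleftrightarrow> (\<forall>\<xi>. (\<integral>\<^sup>+z. ennreal (norm (f (z + \<xi>) - f z) ^ 3) *
      indicator {z \<in> slab. fst z \<in> {0<..<T} \<and> fst (z + \<xi>) \<in> {0<..<T}} z \<partial>lborel)
      \<le> ennreal (M * norm \<xi> powr (3 * \<gamma>)))"

definition cubic_osc :: "real \<Rightarrow> ('n::finite spacetime \<Rightarrow> 'b::euclidean_space) \<Rightarrow> 'n spacetime \<Rightarrow> real" where
  "cubic_osc \<epsilon> f z = (LINT h|ball_measure. norm (f (z + \<epsilon> *\<^sub>R h) - f z) ^ 3)"

lemma cubic_osc_nonneg: "0 \<le> cubic_osc \<epsilon> f z"
  by (simp add: cubic_osc_def)

lemma cube_diff_le:
  fixes x y :: "'b::real_normed_vector"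
  shows "norm (x - y) ^ 3 \<le> 8 * norm x ^ 3 + 8 * norm y ^ 3"
proof -
  define m where "m = max (norm x) (norm y)"
  have "norm (x - y) \<le> 2 * m" using norm_triangle_ineq4[of x y] by (simp add: m_def)
  then have "norm (x - y) ^ 3 \<le> (2 * m) ^ 3" by (intro power_mono) auto
  also have "\<dots> = 8 * m ^ 3" by (simp add: power_mult_distrib)
  also have "m ^ 3 \<le> norm x ^ 3 + norm y ^ 3" by (simp add: m_def max_def)
  finally show ?thesis by simp
qed

lemma cubic_osc_integrable:
  fixes f :: "'n::finite spacetime \<Rightarrow> 'b::euclidean_space"
  assumes [measurable]: "f \<in> borel_measurable borel" and l: "locint (\<lambda>z. norm (f z) ^ 3)" and e: "\<epsilon> \<noteq> 0"
  shows "integrable ball_measure (\<lambda>h. norm (f (z + \<epsilon> *\<^sub>R h) - f z) ^ 3)"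
proof -
  interpret finite_measure "ball_measure::'n spacetime measure" by (rule finite_measure_ball_measure)
  have "set_integrable lborel (cball 0 1) (\<lambda>h. norm (f (z + \<epsilon> *\<^sub>R h)) ^ 3)"
    using locint_shift[OF l e, of z] by (simp add: locint_def)
  then have "integrable ball_measure (\<lambda>h. norm (f (z + \<epsilon> *\<^sub>R h)) ^ 3)"
    by (simp add: ball_measure_def integrable_restrict_space set_integrable_def)
  then have i: "integrable ball_measure (\<lambda>h. 8 * norm (f (z + \<epsilon> *\<^sub>R h)) ^ 3 + 8 * norm (f z) ^ 3)"
    by (intro Bochner_Integration.integrable_add integrable_mult_right) auto
  show ?thesis
  proof (rule Bochner_Integration.integrable_bound[OF i])
    have "norm (norm (f (z + \<epsilon> *\<^sub>R h) - f z) ^ 3) \<le> norm (8 * norm (f (z + \<epsilon> *\<^sub>R h)) ^ 3 + 8 * norm (f z) ^ 3)" for h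
      using cube_diff_le[of "f (z + \<epsilon> *\<^sub>R h)" "f z"] by simp
    then show "AE h in ball_measure. norm (norm (f (z + \<epsilon> *\<^sub>R h) - f z) ^ 3) \<le> norm (8 * norm (f (z + \<epsilon> *\<^sub>R h)) ^ 3 + 8 * norm (f z) ^ 3)"
      by simp
  qed measurable
qed

lemma cubic_osc_nn:
  fixes f :: "'n::finite spacetime \<Rightarrow> 'b::euclidean_space"
  assumes "f \<in> borel_measurable borel" "locint (\<lambda>z. norm (f z) ^ 3)" "\<epsilon> \<noteq> 0"
  shows "ennreal (cubic_osc \<epsilon> f z) = (\<integral>\<^sup>+h. ennreal (norm (f (z + \<epsilon> *\<^sub>R h) - f z) ^ 3) * indicator (cball 0 1) h \<partial>lborel)"
proof -
  have "ennreal (cubic_osc \<epsilon> f z) = (\<integral>\<^sup>+h. ennreal (norm (f (z + \<epsilon> *\<^sub>R h) - f z) ^ 3) \<partial>ball_measure)"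
    unfolding cubic_osc_def by (rule nn_integral_eq_integral[symmetric, OF cubic_osc_integrable[OF assms]]) simp
  then show ?thesis by (simp add: ball_measure_def nn_integral_restrict_space)
qed

lemma cubic_osc_measurable:
  fixes f :: "'n::finite spacetime \<Rightarrow> 'b::euclidean_space"
  assumes [measurable]: "f \<in> borel_measurable borel" and "locint (\<lambda>z. norm (f z) ^ 3)" "\<epsilon> \<noteq> 0"
  shows "cubic_osc \<epsilon> f \<in> borel_measurable borel"
proof -
  have [measurable]: "cball 0 1 \<in> sets (borel :: 'n spacetime measure)" by simp
  have "(\<lambda>z. enn2real (\<integral>\<^sup>+h. ennreal (norm (f (z + \<epsilon> *\<^sub>R h) - f z) ^ 3) * indicator (cball 0 1) h \<partial>lborel)) \<in> borel_measurable borel"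
    by measurable
  moreover have "cubic_osc \<epsilon> f z = enn2real (\<integral>\<^sup>+h. ennreal (norm (f (z + \<epsilon> *\<^sub>R h) - f z) ^ 3) * indicator (cball 0 1) h \<partial>lborel)" for z
    using cubic_osc_nn[OF assms, of z] by (metis enn2real_ennreal cubic_osc_nonneg)
  ultimately show ?thesis by (metis (no_types, lifting) ext)
qed

text \<open>By Tonelli's theorem the increments can be integrated over space-time first, for each shift
  separately, where the Besov condition applies.\<close>

lemma cubic_osc_strip_integral:
  fixes f :: "'n::finite spacetime \<Rightarrow> 'b::euclidean_space"
  assumes m[measurable]: "f \<in> borel_measurable borel" and l: "locint (\<lambda>z. norm (f z) ^ 3)"
    and b: "besov_bound T M \<gamma> f" and \<gamma>: "0 \<le> \<gamma>" and M: "0 \<le> M"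
    and \<epsilon>: "0 < \<epsilon>" "\<epsilon> < a" "b + \<epsilon> < T"
  defines "S \<equiv> {a..b} \<times> (unit_cell :: (real^'n) set)"
    and "C \<equiv> measure lborel (cball (0::'n spacetime) 1)"
  shows "integrable lborel (\<lambda>z. indicator S z * cubic_osc \<epsilon> f z)"
    and "(LINT z|lborel. indicator S z * cubic_osc \<epsilon> f z) \<le> M * C * \<epsilon> powr (3 * \<gamma>)"
proof -
  have [measurable]: "S \<in> sets borel" "cball 0 1 \<in> sets (borel :: 'n spacetime measure)" by (simp_all add: S_def)
  have e0: "\<epsilon> \<noteq> 0" using \<epsilon> by simp
  have [measurable]: "cubic_osc \<epsilon> f \<in> borel_measurable borel" by (rule cubic_osc_measurable[OF m l e0])
  let ?I = "\<lambda>h z. ennreal (norm (f (z + \<epsilon> *\<^sub>R h) - f z) ^ 3) * indicator (cball 0 1) h * indicator S z"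
  have nn: "(\<integral>\<^sup>+z. ennreal (indicator S z * cubic_osc \<epsilon> f z) \<partial>lborel) \<le> ennreal (M * C * \<epsilon> powr (3 * \<gamma>))"
  proof -
    have "(\<integral>\<^sup>+z. ennreal (indicator S z * cubic_osc \<epsilon> f z) \<partial>lborel) = (\<integral>\<^sup>+z. \<integral>\<^sup>+h. ?I h z \<partial>lborel \<partial>lborel)"
    proof (rule nn_integral_cong)
      fix z :: "'n spacetime"
      have "(\<integral>\<^sup>+h. ?I h z \<partial>lborel) = ennreal (cubic_osc \<epsilon> f z) * indicator S z"
        unfolding cubic_osc_nn[OF m l e0] by (rule nn_integral_multc) measurable
      then show "ennreal (indicator S z * cubic_osc \<epsilon> f z) = (\<integral>\<^sup>+h. ?I h z \<partial>lborel)"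
        by (simp add: indicator_def)
    qed
    also have "\<dots> = (\<integral>\<^sup>+h. \<integral>\<^sup>+z. ?I h z \<partial>lborel \<partial>lborel)"
      by (rule lborel_pair.Fubini'[symmetric]) measurable
    also have "\<dots> \<le> (\<integral>\<^sup>+h. ennreal (M * \<epsilon> powr (3 * \<gamma>)) * indicator (cball (0::'n spacetime) 1) h \<partial>lborel)"
    proof (rule nn_integral_mono)
      fix h :: "'n spacetime"
      show "(\<integral>\<^sup>+z. ?I h z \<partial>lborel) \<le> ennreal (M * \<epsilon> powr (3 * \<gamma>)) * indicator (cball 0 1) h"
      proof (cases "h \<in> cball 0 1")
        case True
        have "\<bar>\<epsilon> * fst h\<bar> \<le> \<epsilon> * 1"
          unfolding abs_mult using \<epsilon> True norm_fst_le[of "fst h" "snd h"] by (intro mult_mono) auto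
        then have sub: "S \<subseteq> {z \<in> slab. fst z \<in> {0<..<T} \<and> fst (z + \<epsilon> *\<^sub>R h) \<in> {0<..<T}}"
          using \<epsilon> by (auto simp: S_def slab_def)
        have "(\<integral>\<^sup>+z. ?I h z \<partial>lborel) \<le> (\<integral>\<^sup>+z. ennreal (norm (f (z + \<epsilon> *\<^sub>R h) - f z) ^ 3) *
            indicator {z \<in> slab. fst z \<in> {0<..<T} \<and> fst (z + \<epsilon> *\<^sub>R h) \<in> {0<..<T}} z \<partial>lborel)"
          by (rule nn_integral_mono) (use sub in \<open>auto simp: indicator_def\<close>)
        also have "\<dots> \<le> ennreal (M * norm (\<epsilon> *\<^sub>R h) powr (3 * \<gamma>))"
          using b unfolding besov_bound_def by blast
        also have "\<dots> \<le> ennreal (M * \<epsilon> powr (3 * \<gamma>))"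
        proof -
          have "norm (\<epsilon> *\<^sub>R h) \<le> \<epsilon>" using True \<epsilon> by (simp add: mult_left_le)
          then show ?thesis using \<gamma> M by (intro ennreal_leI mult_left_mono powr_mono2) auto
        qed
        finally show ?thesis using True by simp
      qed simp
    qed
    also have "\<dots> = ennreal (M * \<epsilon> powr (3 * \<gamma>)) * emeasure lborel (cball (0::'n spacetime) 1)"
      by (rule nn_integral_cmult_indicator) simp
    also have "emeasure lborel (cball (0::'n spacetime) 1) = ennreal C"
      unfolding C_def by (rule emeasure_eq_ennreal_measure) (use emeasure_lborel_cball_finite[of "0::'n spacetime" 1] in simp)
    finally show ?thesis using M by (simp add: ennreal_mult'[symmetric] C_def mult_ac)
  qed
  show i: "integrable lborel (\<lambda>z. indicator S z * cubic_osc \<epsilon> f z)"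
    by (rule integrableI_nn_integral_finite[where x = "enn2real (\<integral>\<^sup>+z. ennreal (indicator S z * cubic_osc \<epsilon> f z) \<partial>lborel)"])
       (use nn in \<open>auto simp: cubic_osc_nonneg less_top[symmetric] intro!: ennreal_enn2real[symmetric] le_less_trans[OF nn]\<close>)
  have "ennreal (LINT z|lborel. indicator S z * cubic_osc \<epsilon> f z) \<le> ennreal (M * C * \<epsilon> powr (3 * \<gamma>))"
    using nn by (subst (asm) nn_integral_eq_integral[OF i]) (auto simp: cubic_osc_nonneg)
  then show "(LINT z|lborel. indicator S z * cubic_osc \<epsilon> f z) \<le> M * C * \<epsilon> powr (3 * \<gamma>)"
    using M by (subst (asm) ennreal_le_iff) (auto simp: C_def)
qed

lemma osc_bound_of_cubic_osc:
  fixes f :: "'n::finite spacetime \<Rightarrow> 'b::euclidean_space" and g :: "'n spacetime \<Rightarrow> real"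
  assumes m: "f \<in> borel_measurable borel" "locint (\<lambda>z. norm (f z) ^ 3)" "\<epsilon> \<noteq> 0"
    and [measurable]: "g \<in> borel_measurable borel" and le: "\<And>z y. \<bar>g z - g y\<bar> \<le> norm (f z - f y)"
    and s: "0 < \<sigma>" "cubic_osc \<epsilon> f z \<le> \<sigma> ^ 3"
  shows "osc_bound \<epsilon> g z \<sigma>"
proof -
  note i = cubic_osc_integrable[OF m, of z]
  have b: "\<bar>g (z + \<epsilon> *\<^sub>R h) - g z\<bar> ^ 3 \<le> norm (f (z + \<epsilon> *\<^sub>R h) - f z) ^ 3" for h
    by (intro power_mono le) auto
  have j: "integrable ball_measure (\<lambda>h. \<bar>g (z + \<epsilon> *\<^sub>R h) - g z\<bar> ^ 3)"
    by (rule Bochner_Integration.integrable_bound[OF i]) (measurable, use b in \<open>auto intro!: AE_I2 simp: power_abs[symmetric]\<close>)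
  moreover have "(LINT h|ball_measure. \<bar>g (z + \<epsilon> *\<^sub>R h) - g z\<bar> ^ 3) \<le> cubic_osc \<epsilon> f z"
    unfolding cubic_osc_def by (rule integral_mono[OF j i b])
  ultimately show ?thesis using s by (simp add: osc_bound_def)
qed

section \<open>The energy defect at a fixed scale\<close>

definition has_slab_integral :: "('n::finite spacetime \<Rightarrow> real) \<Rightarrow> real \<Rightarrow> bool" where
  "has_slab_integral F x \<longleftrightarrow> set_integrable lborel slab F \<and> (LINT z:slab|lborel. F z) = x"

lemma has_slab_integral_add: "has_slab_integral F x \<Longrightarrow> has_slab_integral G y \<Longrightarrow> has_slab_integral (\<lambda>z. F z + G z) (x + y)"
  by (simp add: has_slab_integral_def set_integral_add)

lemma has_slab_integral_diff: "has_slab_integral F x \<Longrightarrow> has_slab_integral G y \<Longrightarrow> has_slab_integral (\<lambda>z. F z - G z) (x - y)"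
  by (simp add: has_slab_integral_def set_integral_diff)

lemma has_slab_integral_sum: "finite I \<Longrightarrow> (\<And>i. i \<in> I \<Longrightarrow> has_slab_integral (F i) (x i)) \<Longrightarrow> has_slab_integral (\<lambda>z. \<Sum>i\<in>I. F i z) (\<Sum>i\<in>I. x i)"
proof (induction I rule: finite_induct)
  case empty
  then show ?case by (simp add: has_slab_integral_def set_integrable_def set_lebesgue_integral_def)
next
  case (insert i I)
  then show ?case by (simp add: has_slab_integral_add)
qed

lemma measurable_vec_nth:
  fixes f :: "'a \<Rightarrow> real ^ 'b::finite"
  assumes [measurable]: "f \<in> borel_measurable M"
  shows "(\<lambda>z. f z $ i) \<in> borel_measurable M"
proof -
  have [measurable]: "(\<lambda>x::real^'b. x $ i) \<in> borel_measurable borel"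
    using linear_continuous_on[OF bounded_linear_vec_nth] by (rule borel_measurable_continuous_onI)
  show ?thesis by measurable
qed

lemma mol_add:
  assumes "locint f" "locint g" "\<epsilon> \<noteq> 0"
  shows "mol \<epsilon> (\<lambda>z. f z + g z) z = mol \<epsilon> f z + mol \<epsilon> g z"
  unfolding mol_def scaleR_add_right
  using mol_integrable[OF assms(1,3)] mol_integrable[OF assms(2,3)] by (rule Bochner_Integration.integral_add)

lemma mol_cong_ball:
  assumes "\<And>h. norm h < 1 \<Longrightarrow> f (z + \<epsilon> *\<^sub>R h) = g (z + \<epsilon> *\<^sub>R h)"
  shows "mol \<epsilon> f z = mol \<epsilon> g z"
proof -
  have "bump h *\<^sub>R f (z + \<epsilon> *\<^sub>R h) = bump h *\<^sub>R g (z + \<epsilon> *\<^sub>R h)" for h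
    using assms[of h] bump_outside[of h] by (cases "norm h < 1") auto
  then show ?thesis by (simp only: mol_def)
qed

text \<open>What the argument uses of a solution, for fields that are Borel, exactly periodic, and defined
  everywhere. The pressure field \<open>pr\<close> is \<open>p(\<rho>)\<close> inside \<open>(0,T)\<close> only: outside it vanishes like the other
  fields, even if \<open>p(0)\<close> does not.\<close>

locale torus_flow =
  fixes T \<alpha> \<beta> R \<Lambda> M :: real
    and \<rho> pr :: "'n::finite spacetime \<Rightarrow> real" and u :: "'n spacetime \<Rightarrow> real ^ 'n"
  assumes T: "0 < T" and M: "0 \<le> M" and \<Lambda>: "0 \<le> \<Lambda>"
    and exps: "0 < \<alpha>" "0 < \<beta>" "1 < 2 * \<alpha> + \<beta>" "1 < \<alpha> + 2 * \<beta>"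
    and meas[measurable]: "\<rho> \<in> borel_measurable borel" "pr \<in> borel_measurable borel" "u \<in> borel_measurable borel"
    and per: "space_periodic \<rho>" "space_periodic pr" "space_periodic u"
    and rho: "\<And>z. 0 \<le> \<rho> z" "\<And>z. \<rho> z \<le> R"
    and prb: "\<exists>B. \<forall>z. \<bar>pr z\<bar> \<le> B"
    and off: "\<And>z. fst z \<notin> {0<..<T} \<Longrightarrow> \<rho> z = 0 \<and> pr z = 0 \<and> u z = 0"
    and u3: "set_integrable lborel slab (\<lambda>z. norm (u z) ^ 3)"
    and bu: "besov_bound T M \<alpha> u" and brho: "besov_bound T M \<beta> \<rho>" and bm: "besov_bound T M \<beta> (\<lambda>z. \<rho> z *\<^sub>R u z)"
    and mass: "weak_bound T 0 (\<lambda>z. (\<rho> z, \<rho> z *\<^sub>R u z))"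
    and mom: "\<And>i. weak_bound T 0 (\<lambda>z. (\<rho> z * u z $ i, (\<rho> z * u z $ i) *\<^sub>R u z + pr z *\<^sub>R axis i 1))"
    and dvu: "weak_bound T \<Lambda> (\<lambda>z. (0, u z))"
begin

definition momentum :: "'n spacetime \<Rightarrow> real ^ 'n" where "momentum z = \<rho> z *\<^sub>R u z"

lemma momentum_meas[measurable]: "momentum \<in> borel_measurable borel"
  unfolding momentum_def[abs_def] by measurable

lemma u_nth[measurable]: "(\<lambda>z. u z $ i) \<in> borel_measurable borel"
  and momentum_nth[measurable]: "(\<lambda>z. momentum z $ i) \<in> borel_measurable borel"
  by (rule measurable_vec_nth, measurable)+

lemma R0: "0 \<le> R"
  using rho order_trans by blast

lemma slab_integrable:
  fixes F :: "'n spacetime \<Rightarrow> 'b::euclidean_space"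
  assumes [measurable]: "F \<in> borel_measurable borel" and z0: "\<And>z. fst z \<notin> {0<..<T} \<Longrightarrow> F z = 0"
    and b: "\<And>z. norm (F z) \<le> c * (1 + norm (u z) ^ 3)"
  shows "set_integrable lborel slab F"
proof -
  let ?S = "{0..T} \<times> (unit_cell :: (real^'n) set)"
  have i: "integrable lborel (\<lambda>z. c * (indicator ?S z + indicator slab z * norm (u z) ^ 3))"
    using u3 strip_finite[of 0 T] unfolding set_integrable_def
    by (intro integrable_mult_right Bochner_Integration.integrable_add integrable_real_indicator) auto
  have "0 \<le> c"
    using order_trans[OF norm_ge_zero b[of undefined]]
    by (metis add_pos_nonneg not_le zero_less_one norm_ge_zero zero_le_power mult_neg_pos)
  show ?thesis
    unfolding set_integrable_def
  proof (rule Bochner_Integration.integrable_bound[OF i])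
    have "norm (indicator slab z *\<^sub>R F z) \<le> norm (c * (indicator ?S z + indicator slab z * norm (u z) ^ 3))" for z
      using b[of z] z0[of z] \<open>0 \<le> c\<close>
      by (cases "z \<in> slab"; cases "fst z \<in> {0<..<T}") (auto simp: slab_def indicator_def abs_mult)
    then show "AE z in lborel. norm (indicator slab z *\<^sub>R F z) \<le> norm (c * (indicator ?S z + indicator slab z * norm (u z) ^ 3))"
      by simp
  qed measurable
qed

lemma locint_field:
  fixes F :: "'n spacetime \<Rightarrow> 'b::euclidean_space"
  assumes "F \<in> borel_measurable borel" "space_periodic F" "\<And>z. fst z \<notin> {0<..<T} \<Longrightarrow> F z = 0"
    and "\<And>z. norm (F z) \<le> c * (1 + norm (u z) ^ 3)"
  shows "locint F"
  by (rule locint_periodic[OF assms(1,2) slab_integrable[OF assms(1,3,4)]])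

lemma velocity_le_cube: "norm (u z) \<le> 1 + norm (u z) ^ 3" "norm (u z) * norm (u z) \<le> 2 * (1 + norm (u z) ^ 3)"
  using cube_ge_linear[of "norm (u z)"] cube_ge_product[of "norm (u z)" "norm (u z)"] by auto

lemma const_le_cube: "x \<le> 1 \<Longrightarrow> 0 \<le> c \<Longrightarrow> c * x \<le> c * (1 + norm (u z) ^ 3)"
  using mult_left_mono[of x "1 + norm (u z) ^ 3" c] zero_le_power[OF norm_ge_zero[of "u z"], of 3] by linarith

lemma momentum_norm: "norm (momentum z) \<le> R * norm (u z)"
  using rho by (simp add: momentum_def mult_right_mono abs_of_nonneg)

lemma locint_u: "locint u"
  by (rule locint_field[where c = 1]) (use per off velocity_le_cube in auto)

lemma locint_momentum: "locint momentum"
proof (rule locint_field[where c = R])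
  show "space_periodic momentum" using per by (simp add: momentum_def space_periodic_def)
  show "norm (momentum z) \<le> R * (1 + norm (u z) ^ 3)" for z
    using order_trans[OF momentum_norm mult_left_mono[OF velocity_le_cube(1) R0]] .
qed (use off in \<open>auto simp: momentum_def\<close>)

lemma locint_bounded_field:
  assumes "F \<in> borel_measurable borel" "\<And>z. \<bar>F z\<bar> \<le> B"
  shows "locint (F :: 'n spacetime \<Rightarrow> real)"
  using assms by (intro locint_bounded[where B = B]) auto

lemma locint_rho: "locint \<rho>"
  by (rule locint_bounded_field[where B = R]) (use rho in \<open>auto simp: abs_of_nonneg\<close>)

lemma locint_pr: "locint pr"
  using prb locint_bounded_field meas by blast

lemma locint_u_nth: "locint (\<lambda>z. u z $ i)" and locint_momentum_nth: "locint (\<lambda>z. momentum z $ i)"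
  using locint_linear[OF bounded_linear_vec_nth locint_u] locint_linear[OF bounded_linear_vec_nth locint_momentum] by auto

lemma momentum_u_bound: "norm (momentum z) * norm (u z) \<le> (2 * R) * (1 + norm (u z) ^ 3)"
proof -
  have "norm (momentum z) * norm (u z) \<le> R * norm (u z) * norm (u z)" by (intro mult_right_mono momentum_norm) auto
  also have "\<dots> \<le> R * (2 * (1 + norm (u z) ^ 3))"
    using mult_left_mono[OF velocity_le_cube(2) R0] by (simp add: mult.assoc)
  also have "\<dots> = (2 * R) * (1 + norm (u z) ^ 3)" by simp
  finally show ?thesis .
qed

lemma locint_momentum_u: "locint (\<lambda>z. momentum z $ j * u z $ i)"
proof (rule locint_field[where c = "2 * R"])
  show "space_periodic (\<lambda>z. momentum z $ j * u z $ i)" using per by (simp add: momentum_def space_periodic_def)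
  show "norm (momentum z $ j * u z $ i) \<le> 2 * R * (1 + norm (u z) ^ 3)" for z
  proof -
    have "norm (momentum z $ j * u z $ i) \<le> norm (momentum z) * norm (u z)"
      unfolding real_norm_def abs_mult by (intro mult_mono component_le_norm_cart) auto
    then show ?thesis using momentum_u_bound[of z] by linarith
  qed
qed (use off in \<open>auto simp: momentum_def\<close>)

lemma cubes_locint:
  "locint (\<lambda>z. norm (u z) ^ 3)" "locint (\<lambda>z. norm (\<rho> z) ^ 3)" "locint (\<lambda>z. norm (momentum z) ^ 3)"
proof -
  show "locint (\<lambda>z. norm (u z) ^ 3)"
    by (rule locint_field[where c = 1]) (use per off in \<open>auto simp: space_periodic_def\<close>)
  show "locint (\<lambda>z. norm (\<rho> z) ^ 3)"
    by (rule locint_bounded_field[where B = "R ^ 3"]) (use rho in \<open>auto intro!: power_mono\<close>)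
  show "locint (\<lambda>z. norm (momentum z) ^ 3)"
  proof (rule locint_field[where c = "R ^ 3"])
    show "space_periodic (\<lambda>z. norm (momentum z) ^ 3)" using per by (simp add: momentum_def space_periodic_def)
    show "norm (norm (momentum z) ^ 3) \<le> R ^ 3 * (1 + norm (u z) ^ 3)" for z
    proof -
      have "norm (momentum z) ^ 3 \<le> (R * norm (u z)) ^ 3" by (intro power_mono momentum_norm) auto
      also have "\<dots> \<le> R ^ 3 * (1 + norm (u z) ^ 3)"
        using R0 by (auto simp: power_mult_distrib intro!: mult_left_mono)
      finally show ?thesis by simp
    qed
  qed (use off in \<open>auto simp: momentum_def\<close>)
qed

text \<open>The cube root \<open>w\<close> of this function dominates \<open>1\<close>, \<open>|u|\<close>, \<open>|\<rho> u|\<close> and the increments divided by their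
  expected size, while its integral is bounded uniformly in \<open>\<epsilon>\<close>. Pointwise bounds by multiples of \<open>w\<^sup>3\<close>
  thus take the place of Hoelder's inequality.\<close>

definition weight :: "real \<Rightarrow> 'n spacetime \<Rightarrow> real" where
  "weight \<epsilon> z = 1 + norm (u z) ^ 3 + norm (momentum z) ^ 3 + cubic_osc \<epsilon> u z / \<epsilon> powr (3 * \<alpha>)
     + (cubic_osc \<epsilon> \<rho> z + cubic_osc \<epsilon> momentum z) / \<epsilon> powr (3 * \<beta>)"

lemma weight_ge:
  assumes e: "0 < \<epsilon>"
  shows "1 \<le> weight \<epsilon> z" "norm (u z) ^ 3 \<le> weight \<epsilon> z" "norm (momentum z) ^ 3 \<le> weight \<epsilon> z"
    "cubic_osc \<epsilon> u z \<le> \<epsilon> powr (3 * \<alpha>) * weight \<epsilon> z" "cubic_osc \<epsilon> \<rho> z \<le> \<epsilon> powr (3 * \<beta>) * weight \<epsilon> z" "cubic_osc \<epsilon> momentum z \<le> \<epsilon> powr (3 * \<beta>) * weight \<epsilon> z"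
proof -
  have p: "0 < \<epsilon> powr (3 * \<alpha>)" "0 < \<epsilon> powr (3 * \<beta>)" using e by auto
  have n: "0 \<le> norm (u z) ^ 3" "0 \<le> norm (momentum z) ^ 3" "0 \<le> cubic_osc \<epsilon> u z / \<epsilon> powr (3 * \<alpha>)"
    "0 \<le> cubic_osc \<epsilon> \<rho> z / \<epsilon> powr (3 * \<beta>)" "0 \<le> cubic_osc \<epsilon> momentum z / \<epsilon> powr (3 * \<beta>)"
    by (simp_all add: divide_nonneg_nonneg cubic_osc_nonneg)
  have d: "weight \<epsilon> z = 1 + norm (u z) ^ 3 + norm (momentum z) ^ 3 + cubic_osc \<epsilon> u z / \<epsilon> powr (3 * \<alpha>)
     + (cubic_osc \<epsilon> \<rho> z / \<epsilon> powr (3 * \<beta>) + cubic_osc \<epsilon> momentum z / \<epsilon> powr (3 * \<beta>))"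
    by (simp add: weight_def add_divide_distrib)
  show "1 \<le> weight \<epsilon> z" "norm (u z) ^ 3 \<le> weight \<epsilon> z" "norm (momentum z) ^ 3 \<le> weight \<epsilon> z" using n d by linarith+
  have "cubic_osc \<epsilon> u z / \<epsilon> powr (3 * \<alpha>) \<le> weight \<epsilon> z" "cubic_osc \<epsilon> \<rho> z / \<epsilon> powr (3 * \<beta>) \<le> weight \<epsilon> z" "cubic_osc \<epsilon> momentum z / \<epsilon> powr (3 * \<beta>) \<le> weight \<epsilon> z"
    using n d by linarith+
  then show "cubic_osc \<epsilon> u z \<le> \<epsilon> powr (3 * \<alpha>) * weight \<epsilon> z" "cubic_osc \<epsilon> \<rho> z \<le> \<epsilon> powr (3 * \<beta>) * weight \<epsilon> z" "cubic_osc \<epsilon> momentum z \<le> \<epsilon> powr (3 * \<beta>) * weight \<epsilon> z"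
    using p by (simp_all add: pos_divide_le_eq mult.commute)
qed

lemma weight_integral:
  assumes ab: "0 < a" "b < T"
  defines "S \<equiv> {a..b} \<times> (unit_cell :: (real^'n) set)"
  shows "\<exists>C\<ge>0. \<forall>\<epsilon>. 0 < \<epsilon> \<longrightarrow> \<epsilon> < a \<longrightarrow> b + \<epsilon> < T \<longrightarrow>
     integrable lborel (\<lambda>z. indicator S z * weight \<epsilon> z) \<and> (LINT z|lborel. indicator S z * weight \<epsilon> z) \<le> C"
proof -
  have [measurable]: "S \<in> sets borel" by (simp add: S_def)
  have sub: "S \<subseteq> slab" by (auto simp: S_def slab_def)
  have base: "integrable lborel (\<lambda>z. indicator S z * F z)" if "set_integrable lborel slab F" for F :: "'n spacetime \<Rightarrow> real"
    using set_integrable_subset[OF that _ sub] by (simp add: set_integrable_def)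
  have c3: "set_integrable lborel slab (\<lambda>z. norm (momentum z) ^ 3)"
  proof (rule slab_integrable[where c = "R ^ 3"])
    show "norm (norm (momentum z) ^ 3) \<le> R ^ 3 * (1 + norm (u z) ^ 3)" for z
    proof -
      have "norm (momentum z) ^ 3 \<le> (R * norm (u z)) ^ 3" by (intro power_mono momentum_norm) auto
      also have "\<dots> \<le> R ^ 3 * (1 + norm (u z) ^ 3)"
        using R0 by (auto simp: power_mult_distrib intro!: mult_left_mono)
      finally show ?thesis by simp
    qed
  qed (use off in \<open>auto simp: momentum_def\<close>)
  have i1: "integrable lborel (\<lambda>z. indicator S z :: real)"
    using strip_finite[of a b] by (intro integrable_real_indicator) (auto simp: S_def)
  note i2 = base[OF u3] and i3 = base[OF c3]
  define k where "k = measure lborel (cball (0::'n spacetime) 1)"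
  define C where "C = (LINT z|lborel. indicator S z) + (LINT z|lborel. indicator S z * norm (u z) ^ 3)
     + (LINT z|lborel. indicator S z * norm (momentum z) ^ 3) + 3 * (M * k)"
  have bm': "besov_bound T M \<beta> momentum" using bm by (simp add: momentum_def[abs_def])
  have main: "integrable lborel (\<lambda>z. indicator S z * weight \<epsilon> z) \<and> (LINT z|lborel. indicator S z * weight \<epsilon> z) \<le> C"
    if e: "0 < \<epsilon>" "\<epsilon> < a" "b + \<epsilon> < T" for \<epsilon>
  proof -
    note su = cubic_osc_strip_integral[OF meas(3) cubes_locint(1) bu less_imp_le[OF exps(1)] M e, folded S_def k_def]
    note sr = cubic_osc_strip_integral[OF meas(1) cubes_locint(2) brho less_imp_le[OF exps(2)] M e, folded S_def k_def]
    note sm = cubic_osc_strip_integral[OF momentum_meas cubes_locint(3) bm' less_imp_le[OF exps(2)] M e, folded S_def k_def]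
    have weight: "(\<lambda>z. indicator S z * weight \<epsilon> z) = (\<lambda>z. (((indicator S z + indicator S z * norm (u z) ^ 3)
       + indicator S z * norm (momentum z) ^ 3) + indicator S z * cubic_osc \<epsilon> u z / \<epsilon> powr (3 * \<alpha>))
       + (indicator S z * cubic_osc \<epsilon> \<rho> z / \<epsilon> powr (3 * \<beta>) + indicator S z * cubic_osc \<epsilon> momentum z / \<epsilon> powr (3 * \<beta>)))"
      by (rule ext) (simp add: weight_def algebra_simps add_divide_distrib)
    note j1 = Bochner_Integration.integrable_add[OF i1 i2]
    note j2 = Bochner_Integration.integrable_add[OF j1 i3]
    note j3 = Bochner_Integration.integrable_add[OF j2 integrable_divide_zero[OF su(1)], of "\<epsilon> powr (3 * \<alpha>)"]
    note j4 = Bochner_Integration.integrable_add[OF integrable_divide_zero[OF sr(1), of "\<epsilon> powr (3 * \<beta>)"] integrable_divide_zero[OF sm(1), of "\<epsilon> powr (3 * \<beta>)"]]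
    note j5 = Bochner_Integration.integrable_add[OF j3 j4]
    have "integrable lborel (\<lambda>z. indicator S z * weight \<epsilon> z)" unfolding weight by (rule j5)
    moreover have "(LINT z|lborel. indicator S z * weight \<epsilon> z) = (LINT z|lborel. indicator S z) + (LINT z|lborel. indicator S z * norm (u z) ^ 3)
       + (LINT z|lborel. indicator S z * norm (momentum z) ^ 3) + (LINT z|lborel. indicator S z * cubic_osc \<epsilon> u z) / \<epsilon> powr (3 * \<alpha>)
       + ((LINT z|lborel. indicator S z * cubic_osc \<epsilon> \<rho> z) / \<epsilon> powr (3 * \<beta>) + (LINT z|lborel. indicator S z * cubic_osc \<epsilon> momentum z) / \<epsilon> powr (3 * \<beta>))"
      unfolding weight Bochner_Integration.integral_add[OF j3 j4] Bochner_Integration.integral_add[OF j2 integrable_divide_zero[OF su(1)], of "\<epsilon> powr (3 * \<alpha>)"]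
        Bochner_Integration.integral_add[OF j1 i3] Bochner_Integration.integral_add[OF i1 i2]
        Bochner_Integration.integral_add[OF integrable_divide_zero[OF sr(1), of "\<epsilon> powr (3 * \<beta>)"] integrable_divide_zero[OF sm(1), of "\<epsilon> powr (3 * \<beta>)"]]
      by simp
    moreover have "(LINT z|lborel. indicator S z * cubic_osc \<epsilon> u z) / \<epsilon> powr (3 * \<alpha>) \<le> M * k"
      "(LINT z|lborel. indicator S z * cubic_osc \<epsilon> \<rho> z) / \<epsilon> powr (3 * \<beta>) \<le> M * k"
      "(LINT z|lborel. indicator S z * cubic_osc \<epsilon> momentum z) / \<epsilon> powr (3 * \<beta>) \<le> M * k"
      using su(2) sr(2) sm(2) e by (simp_all add: pos_divide_le_eq)
    ultimately show ?thesis by (simp add: C_def)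
  qed
  have "0 \<le> C" unfolding C_def using M by (auto intro!: add_nonneg_nonneg simp: k_def)
  with main show ?thesis by blast
qed

definition root_weight :: "real \<Rightarrow> 'n spacetime \<Rightarrow> real" where
  "root_weight \<epsilon> z = root 3 (weight \<epsilon> z)"

lemma root_weight:
  assumes "0 < \<epsilon>"
  shows "root_weight \<epsilon> z ^ 3 = weight \<epsilon> z" "1 \<le> root_weight \<epsilon> z" "norm (u z) \<le> root_weight \<epsilon> z" "norm (momentum z) \<le> root_weight \<epsilon> z"
proof -
  note weight = weight_ge[OF assms, of z]
  show 3: "root_weight \<epsilon> z ^ 3 = weight \<epsilon> z" using weight(1) by (simp add: root_weight_def)
  have "0 \<le> root_weight \<epsilon> z" using weight(1) by (simp add: root_weight_def)
  then show "1 \<le> root_weight \<epsilon> z" "norm (u z) \<le> root_weight \<epsilon> z" "norm (momentum z) \<le> root_weight \<epsilon> z"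
    using weight(1-3) unfolding 3[symmetric] by (auto intro: power_le_imp_le_base[where n = 2] simp: numeral_eq_Suc)
qed

lemma powr_cube: "0 < \<epsilon> \<Longrightarrow> (\<epsilon> powr \<gamma>) ^ 3 = \<epsilon> powr (3 * (\<gamma>::real))"
  by (simp add: powr_power mult.commute)

lemma osc_bound_fields:
  assumes e: "0 < \<epsilon>"
  shows "osc_bound \<epsilon> (\<lambda>z. u z $ i) z (\<epsilon> powr \<alpha> * root_weight \<epsilon> z)" "osc_bound \<epsilon> \<rho> z (\<epsilon> powr \<beta> * root_weight \<epsilon> z)"
    "osc_bound \<epsilon> (\<lambda>z. momentum z $ i) z (\<epsilon> powr \<beta> * root_weight \<epsilon> z)"
proof -
  have e0: "\<epsilon> \<noteq> 0" using e by simp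
  have p: "0 < \<epsilon> powr \<alpha> * root_weight \<epsilon> z" "0 < \<epsilon> powr \<beta> * root_weight \<epsilon> z" using root_weight(2)[OF e, of z] e by auto
  note weight = weight_ge[OF e, of z]
  show "osc_bound \<epsilon> (\<lambda>z. u z $ i) z (\<epsilon> powr \<alpha> * root_weight \<epsilon> z)"
  proof (rule osc_bound_of_cubic_osc[OF meas(3) cubes_locint(1) e0 u_nth _ p(1)])
    show "\<bar>u y $ i - u x $ i\<bar> \<le> norm (u y - u x)" for x y
      by (metis component_le_norm_cart vector_minus_component)
    show "cubic_osc \<epsilon> u z \<le> (\<epsilon> powr \<alpha> * root_weight \<epsilon> z) ^ 3" using weight(4) by (simp add: power_mult_distrib root_weight(1)[OF e] powr_cube[OF e])
  qed
  show "osc_bound \<epsilon> \<rho> z (\<epsilon> powr \<beta> * root_weight \<epsilon> z)"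
  proof (rule osc_bound_of_cubic_osc[OF meas(1) cubes_locint(2) e0 meas(1) _ p(2)])
    show "cubic_osc \<epsilon> \<rho> z \<le> (\<epsilon> powr \<beta> * root_weight \<epsilon> z) ^ 3" using weight(5) by (simp add: power_mult_distrib root_weight(1)[OF e] powr_cube[OF e])
  qed simp
  show "osc_bound \<epsilon> (\<lambda>z. momentum z $ i) z (\<epsilon> powr \<beta> * root_weight \<epsilon> z)"
  proof (rule osc_bound_of_cubic_osc[OF momentum_meas cubes_locint(3) e0 momentum_nth _ p(2)])
    show "\<bar>momentum y $ i - momentum x $ i\<bar> \<le> norm (momentum y - momentum x)" for x y
      by (metis component_le_norm_cart vector_minus_component)
    show "cubic_osc \<epsilon> momentum z \<le> (\<epsilon> powr \<beta> * root_weight \<epsilon> z) ^ 3" using weight(6) by (simp add: power_mult_distrib root_weight(1)[OF e] powr_cube[OF e])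
  qed
qed

definition massflux :: "'n spacetime \<Rightarrow> 'n spacetime" where
  "massflux z = (\<rho> z, momentum z)"

definition momflux :: "'n \<Rightarrow> 'n spacetime \<Rightarrow> 'n spacetime" where
  "momflux i z = (momentum z $ i, momentum z $ i *\<^sub>R u z + pr z *\<^sub>R axis i 1)"

definition velflux :: "'n spacetime \<Rightarrow> 'n spacetime" where
  "velflux z = (0, u z)"

lemma flux_meas: "massflux \<in> borel_measurable borel" "momflux i \<in> borel_measurable borel" "velflux \<in> borel_measurable borel"
  unfolding massflux_def[abs_def] momflux_def[abs_def] velflux_def[abs_def] by measurable

lemma flux_per: "space_periodic massflux" "space_periodic (momflux i)" "space_periodic velflux"
  using per by (simp_all add: space_periodic_def massflux_def momflux_def velflux_def momentum_def)

lemma flux_int: "set_integrable lborel slab massflux" "set_integrable lborel slab (momflux i)" "set_integrable lborel slab velflux"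
proof -
  show "set_integrable lborel slab massflux"
  proof (rule slab_integrable[where c = "R + R", OF flux_meas(1)])
    show "norm (massflux z) \<le> (R + R) * (1 + norm (u z) ^ 3)" for z
    proof -
      have "norm (massflux z) \<le> \<bar>\<rho> z\<bar> + norm (momentum z)" using sqrt_sum_squares_le_sum_abs[of "\<rho> z" "norm (momentum z)"] by (simp add: massflux_def norm_Pair)
      also have "\<dots> \<le> R * 1 + R * norm (u z)" using momentum_norm[of z] rho[of z] by simp
      also have "\<dots> \<le> R * (1 + norm (u z) ^ 3) + R * (1 + norm (u z) ^ 3)"
        using velocity_le_cube(1)[of z] R0 const_le_cube[of 1 R z] by (intro add_mono mult_left_mono) auto
      finally show ?thesis by (simp add: distrib_right)
    qed
  qed (use off in \<open>auto simp: massflux_def momentum_def zero_prod_def\<close>)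
  obtain B where B: "\<And>z. \<bar>pr z\<bar> \<le> B" using prb by auto
  have B0: "0 \<le> B" using order_trans[OF abs_ge_zero B] .
  show "set_integrable lborel slab (momflux i)"
  proof (rule slab_integrable[where c = "R + (2 * R + B)", OF flux_meas(2)])
    show "norm (momflux i z) \<le> (R + (2 * R + B)) * (1 + norm (u z) ^ 3)" for z
    proof -
      have "norm (momflux i z) \<le> \<bar>momentum z $ i\<bar> + norm (momentum z $ i *\<^sub>R u z + pr z *\<^sub>R axis i 1)"
        by (simp add: momflux_def norm_Pair order_trans[OF sqrt_sum_squares_le_sum_abs])
      also have "\<dots> \<le> norm (momentum z) + (norm (momentum z) * norm (u z) + B)"
      proof -
        have "norm (momentum z $ i *\<^sub>R u z + pr z *\<^sub>R axis i 1) \<le> \<bar>momentum z $ i\<bar> * norm (u z) + \<bar>pr z\<bar>"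
          using norm_triangle_ineq[of "momentum z $ i *\<^sub>R u z" "pr z *\<^sub>R axis i 1"] by (simp add: norm_axis_1)
        moreover have "\<bar>momentum z $ i\<bar> * norm (u z) \<le> norm (momentum z) * norm (u z)"
          by (intro mult_right_mono component_le_norm_cart) auto
        ultimately show ?thesis using B[of z] component_le_norm_cart[of "momentum z" i] by linarith
      qed
      also have "\<dots> \<le> R * (1 + norm (u z) ^ 3) + ((2 * R) * (1 + norm (u z) ^ 3) + B * (1 + norm (u z) ^ 3))"
        using order_trans[OF momentum_norm mult_left_mono[OF velocity_le_cube(1) R0], of z] momentum_u_bound[of z] const_le_cube[of 1 B z] B0
        by (intro add_mono) auto
      finally show ?thesis by (simp add: algebra_simps)
    qed
  qed (use off in \<open>auto simp: momflux_def momentum_def zero_prod_def\<close>)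
  show "set_integrable lborel slab velflux"
    by (rule slab_integrable[where c = 1, OF flux_meas(3)]) (use off velocity_le_cube in \<open>auto simp: velflux_def zero_prod_def\<close>)
qed

lemmas flux_locint = locint_periodic[OF flux_meas(1) flux_per(1) flux_int(1)]
  locint_periodic[OF flux_meas(2) flux_per(2) flux_int(2)] locint_periodic[OF flux_meas(3) flux_per(3) flux_int(3)]

lemma flux_weak: "weak_bound T 0 massflux" "weak_bound T 0 (momflux i)" "weak_bound T \<Lambda> velflux"
  using mass mom[of i] dvu by (simp_all add: massflux_def[abs_def] momflux_def[abs_def] velflux_def[abs_def] momentum_def)

lemma weak_zero:
  assumes "weak_bound T 0 V" "V \<in> borel_measurable borel" "space_periodic V" "set_integrable lborel slab V"
    and g: "c1_torus a b g Dg" and e: "0 < \<epsilon>" "\<epsilon> < a" "b + \<epsilon> < T"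
  shows "has_slab_integral (\<lambda>z. mol \<epsilon> V z \<bullet> Dg z) 0"
proof -
  obtain B where B: "\<And>z. \<bar>g z\<bar> \<le> B" using c1_torus_bounds[OF g] by metis
  show ?thesis
    using weak_bound_mol[OF assms(1-4) g e B] mol_flux_integrable[OF locint_periodic[OF assms(2-4)] assms(3) e(1) g]
    by (simp add: has_slab_integral_def)
qed

lemma gradient_zero: "c1_torus a b g Dg \<Longrightarrow> has_slab_integral (\<lambda>z. Dg z \<bullet> v) 0"
  by (simp add: has_slab_integral_def gradient_integrable integral_gradient_zero)

definition energy_integrand ::
  "('n spacetime \<Rightarrow> 'n spacetime) \<Rightarrow> (real \<Rightarrow> real) \<Rightarrow> (real \<Rightarrow> real) \<Rightarrow> 'n spacetime \<Rightarrow> real" where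
  "energy_integrand D\<phi> P Q z =
     fst (D\<phi> z) * (1 / 2 * \<rho> z * (\<Sum>i\<in>UNIV. u z $ i * u z $ i) + P (\<rho> z))
     + (1 / 2 * \<rho> z * (\<Sum>i\<in>UNIV. u z $ i * u z $ i) + Q (\<rho> z) + P (\<rho> z)) * (\<Sum>j\<in>UNIV. u z $ j * snd (D\<phi> z) $ j)"

lemma energy_integrand_integrable:
  assumes \<phi>: "c1_torus a b \<phi> D\<phi>" and ab: "0 < a" "b < T"
    and m[measurable]: "P \<in> borel_measurable borel" "Q \<in> borel_measurable borel"
    and L: "\<And>x. x \<in> {0..R} \<Longrightarrow> \<bar>P x\<bar> \<le> L" "\<And>x. x \<in> {0..R} \<Longrightarrow> \<bar>Q x\<bar> \<le> L"
  shows "set_integrable lborel slab (energy_integrand D\<phi> P Q)"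
proof -
  note D = c1_torusD[OF \<phi>]
  have [measurable]: "D\<phi> \<in> borel_measurable borel" by (rule D)
  obtain B where B: "0 \<le> B" "\<And>z. norm (D\<phi> z) \<le> B" using c1_torus_bounds[OF \<phi>] by metis
  have L0: "0 \<le> L" using L(1)[of 0] R0 by auto
  have sq: "(\<Sum>i\<in>UNIV. u z $ i * u z $ i) = norm (u z) ^ 2" for z
    by (simp add: power2_norm_eq_inner inner_vec_def)
  have ip: "(\<Sum>j\<in>UNIV. u z $ j * snd (D\<phi> z) $ j) = u z \<bullet> snd (D\<phi> z)" for z
    by (simp add: inner_vec_def)
  show ?thesis
  proof (rule slab_integrable[where c = "B * (R + L) + B * (R + 2 * L)"])
    show "energy_integrand D\<phi> P Q \<in> borel_measurable borel"
    proof -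
      have [measurable]: "(\<lambda>z. fst (D\<phi> z)) \<in> borel_measurable borel" "(\<lambda>z. snd (D\<phi> z)) \<in> borel_measurable borel"
        using c1_cont[OF D(1)] by (auto intro!: borel_measurable_continuous_onI continuous_intros)
      show ?thesis unfolding energy_integrand_def[abs_def] sq ip by measurable
    qed
    show "energy_integrand D\<phi> P Q z = 0" if "fst z \<notin> {0<..<T}" for z
      using that D(5)[of z] ab by (auto simp: energy_integrand_def)
    show "norm (energy_integrand D\<phi> P Q z) \<le> (B * (R + L) + B * (R + 2 * L)) * (1 + norm (u z) ^ 3)" for z
    proof -
      let ?n = "norm (u z)"
      have PQ: "\<bar>P (\<rho> z)\<bar> \<le> L" "\<bar>Q (\<rho> z)\<bar> \<le> L" using L rho by auto
      have ft: "\<bar>fst (D\<phi> z)\<bar> \<le> B" "norm (snd (D\<phi> z)) \<le> B"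
        using B(2)[of z] norm_fst_le[of "fst (D\<phi> z)" "snd (D\<phi> z)"] norm_snd_le[of "snd (D\<phi> z)" "fst (D\<phi> z)"] by auto
      have k: "\<bar>1 / 2 * \<rho> z * ?n ^ 2\<bar> \<le> R / 2 * ?n ^ 2"
        using rho[of z] by (simp add: abs_mult abs_of_nonneg mult_right_mono)
      have s: "\<bar>u z \<bullet> snd (D\<phi> z)\<bar> \<le> ?n * B"
        using order_trans[OF Cauchy_Schwarz_ineq2 mult_left_mono[OF ft(2)]] by simp
      have n2: "?n ^ 2 \<le> 2 * (1 + ?n ^ 3)" using velocity_le_cube(2)[of z] by (simp add: power2_eq_square)
      have "\<bar>energy_integrand D\<phi> P Q z\<bar> \<le> B * (R / 2 * ?n ^ 2 + L) + (R / 2 * ?n ^ 2 + L + L) * (?n * B)"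
        unfolding energy_integrand_def sq ip
        by (intro order_trans[OF abs_triangle_ineq] add_mono abs_mult_le ft s)
           (use PQ rho[of z] in \<open>auto simp: abs_mult\<close>)
      also have "\<dots> = B * (R / 2 * ?n ^ 2 + L) + B * (R / 2 * ?n ^ 3 + 2 * L * ?n)"
        by (simp add: power2_eq_square power3_eq_cube algebra_simps)
      also have "\<dots> \<le> B * ((R + L) * (1 + ?n ^ 3)) + B * ((R + 2 * L) * (1 + ?n ^ 3))"
      proof (intro add_mono mult_left_mono B(1))
        have "R / 2 * ?n ^ 2 \<le> R / 2 * (2 * (1 + ?n ^ 3))" using n2 R0 by (intro mult_left_mono) auto
        then show "R / 2 * ?n ^ 2 + L \<le> (R + L) * (1 + ?n ^ 3)"
          using mult_nonneg_nonneg[OF L0 zero_le_power[OF norm_ge_zero[of "u z"], of 3]] by (simp add: algebra_simps)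
        have "R / 2 * ?n ^ 3 \<le> R * (1 + ?n ^ 3)" using R0 by (simp add: algebra_simps)
        moreover have "2 * L * ?n \<le> 2 * L * (1 + ?n ^ 3)" using velocity_le_cube(1)[of z] L0 by (intro mult_left_mono) auto
        ultimately show "R / 2 * ?n ^ 3 + 2 * L * ?n \<le> (R + 2 * L) * (1 + ?n ^ 3)" by (simp add: algebra_simps)
      qed
      finally show ?thesis by (simp add: algebra_simps)
    qed
  qed
qed

text \<open>The pressure is split into \<open>Q(\<rho>)\<close>, whose commutators are controlled by the regularity of \<open>\<rho>\<close>, and
  an error of size \<open>\<delta>\<close>. Against the error, the large function \<open>div U\<close> is not estimated by its size but
  as a measure, which costs at most \<open>\<Lambda> \<delta> B\<close> at every scale.\<close>

lemma energy_defect_at_scale: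
  assumes \<phi>: "c1_torus a b \<phi> D\<phi>" and ab: "0 < a" "b < T"
    and pp: "potential_pair P P1 P2 P3 Q"
    and \<delta>: "0 \<le> \<delta>" and close: "\<And>z. fst z \<in> {0<..<T} \<Longrightarrow> \<bar>pr z - Q (\<rho> z)\<bar> \<le> \<delta>"
    and A: "kernel_bound TYPE('n spacetime) A"
    and L1: "1 \<le> L" and LP: "\<And>x. x \<in> {-R..R} \<Longrightarrow> \<bar>P x\<bar> \<le> L"
      "\<And>x. x \<in> {-R..R} \<Longrightarrow> \<bar>P1 x\<bar> \<le> L" "\<And>x. x \<in> {-R..R} \<Longrightarrow> \<bar>P2 x\<bar> \<le> L" "\<And>x. x \<in> {-R..R} \<Longrightarrow> \<bar>Q x\<bar> \<le> L"
      "\<And>x y. x \<in> {-R..R} \<Longrightarrow> y \<in> {-R..R} \<Longrightarrow> \<bar>P x - P y\<bar> \<le> L * \<bar>x - y\<bar>"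
      "\<And>x y. x \<in> {-R..R} \<Longrightarrow> y \<in> {-R..R} \<Longrightarrow> \<bar>Q x - Q y\<bar> \<le> L * \<bar>x - y\<bar>"
      "\<And>x y. x \<in> {-R..R} \<Longrightarrow> y \<in> {-R..R} \<Longrightarrow> \<bar>Q x - Q y - (y * P2 y) * (x - y)\<bar> \<le> L * (x - y)\<^sup>2"
    and B: "0 \<le> B" "\<And>z. \<bar>\<phi> z\<bar> \<le> B" "\<And>z. norm (D\<phi> z) \<le> B"
    and e: "0 < \<epsilon>" "\<epsilon> < a" "b + \<epsilon> < T"
    and th: "0 \<le> \<theta>" "\<theta> \<le> 1" "\<epsilon> powr \<alpha> \<le> \<theta>" "\<epsilon> powr \<beta> \<le> \<theta>"
      "\<epsilon> powr \<beta> * \<epsilon> powr \<alpha> * (\<epsilon> powr \<alpha> / \<epsilon>) \<le> \<theta>" "\<epsilon> powr \<beta> * \<epsilon> powr \<beta> * (\<epsilon> powr \<alpha> / \<epsilon>) \<le> \<theta>"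
  shows "\<bar>LINT z:slab|lborel. energy_integrand D\<phi> P Q z\<bar> \<le> \<Lambda> * (\<delta> * B)
    + ((100 * (real CARD('n))\<^sup>2 * ((1 + 14 * A ^ 6 + B) * (1 + L)) ^ 4) * \<theta> + \<delta> * (real CARD('n) * (1 + 14 * A ^ 6 + B) ^ 2))
      * (LINT z|lborel. indicator ({a..b} \<times> unit_cell) z * weight \<epsilon> z)"
proof -
  define K where "K = 14 * A ^ 6"
  define Y where "Y = 1 + K + B"
  define X where "X = Y * (1 + L)"
  have e0: "\<epsilon> \<noteq> 0" using e by simp
  have A1: "1 \<le> A" by (rule kernel_boundD(1)[OF A])
  have "A ^ 2 \<le> A ^ 6" "A ^ 4 \<le> A ^ 6" "1 \<le> A ^ 6" using A1 by (auto intro: power_increasing)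
  then have K: "2 * A\<^sup>2 \<le> K" "7 * A ^ 4 \<le> K" "1 \<le> K" unfolding K_def by linarith+
  have YX: "1 \<le> Y" "K \<le> Y" "B \<le> Y" using K B by (auto simp: Y_def)
  have "X = Y + L * Y" "1 * L \<le> Y * L" "L * Y = Y * L"
    unfolding X_def using YX L1 by (auto simp: algebra_simps intro!: mult_right_mono)
  then have X: "Y \<le> X" "L \<le> X" "L * Y \<le> X" using YX L1 by linarith+
  have LK: "L * K \<le> X" using X(3) mult_left_mono[OF YX(2), of L] L1 by linarith
  note pd = potential_pairD[OF pp]
  note D = c1_torusD[OF \<phi>]
  define S where "S = {a..b} \<times> (unit_cell :: (real^'n) set)"
  \<comment> \<open>The pressure error and the approximate pressure, cut off in time because
    \<open>Q\<close> need not vanish at \<open>0\<close>.\<close>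
  define av where "av z = (if fst z \<in> {0<..<T} then pr z - Q (\<rho> z) else 0)" for z
  define bv where "bv z = (if fst z \<in> {0<..<T} then Q (\<rho> z) else 0)" for z
  have pr_split: "pr = (\<lambda>z. av z + bv z)" by (rule ext) (use off in \<open>auto simp: av_def bv_def\<close>)
  have [measurable]: "Q \<in> borel_measurable borel" "P \<in> borel_measurable borel"
    using pd(5,8) by (auto intro: borel_measurable_continuous_onI)
  have time[measurable]: "{z::'n spacetime. fst z \<in> {0<..<T}} \<in> sets borel"
    using open_vimage_fst[of "{0<..<T}"] by (intro borel_open) (simp add: vimage_def)
  have avm: "av \<in> borel_measurable borel" and bvm: "bv \<in> borel_measurable borel"
  proof -
    have 1: "av = (\<lambda>z. indicator {z. fst z \<in> {0<..<T}} z * (pr z - Q (\<rho> z)))"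
      "bv = (\<lambda>z. indicator {z. fst z \<in> {0<..<T}} z * Q (\<rho> z))"
      by (auto simp: av_def bv_def indicator_def)
    show "av \<in> borel_measurable borel" "bv \<in> borel_measurable borel"
      unfolding 1 by (intro borel_measurable_times borel_measurable_indicator time; measurable)+
  qed
  have avb: "\<bar>av z\<bar> \<le> \<delta>" for z using close \<delta> by (simp add: av_def)
  have rR: "\<rho> z \<in> {-R..R}" for z using rho[of z] by simp
  have bvb: "\<bar>bv z\<bar> \<le> L" for z using LP(4)[OF rR[of z]] L1 by (simp add: bv_def)
  have lav: "locint av" and lbv: "locint bv" using locint_bounded_field avm bvm avb bvb by blast+
  have pav: "space_periodic av" using per(1,2) unfolding av_def space_periodic_def by (intro allI impI) simp
  define U where "U i = mol \<epsilon> (\<lambda>z. u z $ i)" for i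
  define DU where "DU i = dmol \<epsilon> (\<lambda>z. u z $ i)" for i
  define mm where "mm i = mol \<epsilon> (\<lambda>z. momentum z $ i)" for i
  define q where "q i j = mol \<epsilon> (\<lambda>z. momentum z $ j * u z $ i)" for i j
  define r where "r = mol \<epsilon> \<rho>"
  define Dr where "Dr = dmol \<epsilon> \<rho>"
  define aa where "aa = mol \<epsilon> av"
  define Da where "Da = dmol \<epsilon> av"
  define bb where "bb = mol \<epsilon> bv"
  have cU: "c1 (U i) (DU i)" for i unfolding U_def DU_def by (rule mol_c1[OF locint_u_nth e(1)])
  have cr: "c1 r Dr" unfolding r_def Dr_def by (rule mol_c1[OF locint_rho e(1)])
  have ca: "c1 aa Da" unfolding aa_def Da_def by (rule mol_c1[OF lav e(1)])
  have pU: "space_periodic (U i)" for i unfolding U_def using per by (intro periodic_mol) (simp add: space_periodic_def)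
  have p_r: "space_periodic r" unfolding r_def using per by (intro periodic_mol)
  have pa: "space_periodic aa" unfolding aa_def using pav by (rule periodic_mol)
  define Sq where "Sq z = (\<Sum>i\<in>UNIV. U i z * U i z)" for z
  have cS: "c1 (\<lambda>z. 1 / 2 * Sq z) (\<lambda>z. \<Sum>i\<in>UNIV. U i z *\<^sub>R DU i z)"
  proof (rule c1_eq)
    show "c1 (\<lambda>z. 1 / 2 * Sq z) (\<lambda>z. (1 / 2) *\<^sub>R (\<Sum>i\<in>UNIV. U i z *\<^sub>R DU i z + U i z *\<^sub>R DU i z) + Sq z *\<^sub>R 0)"
      unfolding Sq_def by (intro c1_mult c1_const c1_sum cU) simp
  qed (simp add: sum.distrib)
  have pS: "space_periodic (\<lambda>z. 1 / 2 * Sq z)" using pU unfolding Sq_def space_periodic_def by simp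
  have cP1: "c1 (\<lambda>z. P1 (r z)) (\<lambda>z. P2 (r z) *\<^sub>R Dr z)" by (rule c1_compose[OF cr pd(2,7)])
  have cQ: "c1 (\<lambda>z. Q (r z)) (\<lambda>z. (r z * P2 (r z)) *\<^sub>R Dr z)"
    by (rule c1_compose[OF cr pd(9)]) (use pd(7) in \<open>auto intro!: continuous_intros\<close>)
  have pPQ: "space_periodic (\<lambda>z. P1 (r z))" "space_periodic (\<lambda>z. Q (r z))" using p_r by (simp_all add: space_periodic_def)
  \<comment> \<open>The test functions: \<open>g1\<close> for the momentum equation,
    \<open>g2\<close> and \<open>g3\<close> for the mass equation, \<open>g6\<close> for the
    divergence of \<open>u\<close>; \<open>g4\<close>, \<open>g5\<close> and \<open>g7\<close> are
    differentiated and integrated to zero.\<close>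
  note g1 = c1_torus_mult[OF cU pU \<phi>]
  note g2 = c1_torus_mult[OF cS pS \<phi>]
  note g3 = c1_torus_mult[OF cP1 pPQ(1) \<phi>]
  note g4 = c1_torus_mult[OF cQ pPQ(2) \<phi>]
  note g5 = c1_torus_mult[OF cU pU g4]
  note g6 = c1_torus_mult[OF ca pa \<phi>]
  note g7 = c1_torus_mult[OF cU pU g6]
  note h1 = weak_zero[OF flux_weak(2) flux_meas(2) flux_per(2) flux_int(2) g1 e]
  note h2 = weak_zero[OF flux_weak(1) flux_meas(1) flux_per(1) flux_int(1) g2 e]
  note h3 = weak_zero[OF flux_weak(1) flux_meas(1) flux_per(1) flux_int(1) g3 e]
  note h4 = gradient_zero[OF g4, of "(1, 0)"]
  note h5 = gradient_zero[OF g5]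
  note h7 = gradient_zero[OF g7]
  define G8 where "G8 z = mol \<epsilon> velflux z \<bullet> (aa z *\<^sub>R D\<phi> z + \<phi> z *\<^sub>R Da z)" for z
  define y where "y = (LINT z:slab|lborel. G8 z)"
  have aab: "\<bar>aa z\<bar> \<le> \<delta>" for z unfolding aa_def by (rule mol_bound[OF lav e0 avb])
  have h8: "has_slab_integral G8 y"
    unfolding has_slab_integral_def y_def G8_def using mol_flux_integrable[OF flux_locint(3) flux_per(3) e(1) g6] by simp
  have y: "\<bar>y\<bar> \<le> \<Lambda> * (\<delta> * B)"
    unfolding y_def G8_def
    by (rule weak_bound_mol[OF flux_weak(3) flux_meas(3) flux_per(3) flux_int(3) g6 e]) (intro abs_mult_le aab B)
  define G1 where "G1 i z = mol \<epsilon> (momflux i) z \<bullet> (U i z *\<^sub>R D\<phi> z + \<phi> z *\<^sub>R DU i z)" for i z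
  define G2 where "G2 z = mol \<epsilon> massflux z \<bullet> ((1 / 2 * Sq z) *\<^sub>R D\<phi> z + \<phi> z *\<^sub>R (\<Sum>i\<in>UNIV. U i z *\<^sub>R DU i z))" for z
  define G3 where "G3 z = mol \<epsilon> massflux z \<bullet> (P1 (r z) *\<^sub>R D\<phi> z + \<phi> z *\<^sub>R (P2 (r z) *\<^sub>R Dr z))" for z
  define D4 where "D4 z = Q (r z) *\<^sub>R D\<phi> z + \<phi> z *\<^sub>R ((r z * P2 (r z)) *\<^sub>R Dr z)" for z
  define D6 where "D6 z = aa z *\<^sub>R D\<phi> z + \<phi> z *\<^sub>R Da z" for z
  define G4 where "G4 z = D4 z \<bullet> (1, 0)" for z
  define G5 where "G5 i z = (U i z *\<^sub>R D4 z + (Q (r z) * \<phi> z) *\<^sub>R DU i z) \<bullet> (0, axis i 1)" for i z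
  define G7 where "G7 i z = (U i z *\<^sub>R D6 z + (aa z * \<phi> z) *\<^sub>R DU i z) \<bullet> (0, axis i 1)" for i z
  define G where "G z = (\<Sum>i\<in>UNIV. G1 i z) - G2 z + G3 z - (G4 z + (\<Sum>i\<in>UNIV. G5 i z)) - ((\<Sum>i\<in>UNIV. G7 i z) - G8 z)" for z
  have H: "has_slab_integral (\<lambda>z. G1 i z) 0" "has_slab_integral (\<lambda>z. G2 z) 0" "has_slab_integral (\<lambda>z. G3 z) 0" "has_slab_integral (\<lambda>z. G4 z) 0"
    "has_slab_integral (\<lambda>z. G5 i z) 0" "has_slab_integral (\<lambda>z. G7 i z) 0" for i
    unfolding G1_def G2_def G3_def G4_def G5_def G7_def D4_def D6_def
    by (rule h1, rule h2, rule h3, rule h4, rule h5, rule h7)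
  have "has_slab_integral G ((\<Sum>i\<in>(UNIV::'n set). 0) - 0 + 0 - (0 + (\<Sum>i\<in>(UNIV::'n set). 0)) - ((\<Sum>i\<in>(UNIV::'n set). 0) - y))"
    unfolding G_def[abs_def]
    by (intro has_slab_integral_add has_slab_integral_diff has_slab_integral_sum h8 H finite_class.finite_UNIV)
  then have hG: "has_slab_integral G y" by simp
  have flux1: "mol \<epsilon> (momflux i) z \<bullet> E = mm i z * fst E + (\<Sum>j\<in>UNIV. q i j z * snd E $ j) + (aa z + bb z) * snd E $ i" for i z E
  proof -
    have 1: "snd (momflux i z) $ j = momentum z $ j * u z $ i + (if j = i then pr z else 0)" for z j
      by (simp add: momflux_def axis_def momentum_def)
    have 2: "mol \<epsilon> (\<lambda>z. momentum z $ j * u z $ i + (if j = i then pr z else 0)) z = q i j z + (if j = i then aa z + bb z else 0)" for j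
      using mol_add[OF locint_momentum_u locint_pr e0] mol_add[OF lav lbv e0]
      by (auto simp: q_def aa_def bb_def pr_split[symmetric])
    have 3: "fst (momflux i z) = momentum z $ i" for z by (simp add: momflux_def)
    show ?thesis
      unfolding mol_flux[OF flux_locint(2) e0] 1 2 3
      by (simp add: mm_def distrib_right sum.distrib if_distrib[of "\<lambda>x. x * _"] sum.delta cong: if_cong)
  qed
  have flux2: "mol \<epsilon> massflux z \<bullet> E = r z * fst E + (\<Sum>j\<in>UNIV. mm j z * snd E $ j)" for z E
    unfolding mol_flux[OF flux_locint(1) e0] by (simp add: massflux_def r_def mm_def)
  have flux3: "mol \<epsilon> velflux z \<bullet> E = (\<Sum>j\<in>UNIV. U j z * snd E $ j)" for z E
    unfolding mol_flux[OF flux_locint(3) e0] by (simp add: velflux_def U_def mol_def)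
  have Gid: "G z = (\<Sum>i\<in>UNIV. mm i z * (U i z * fst (D\<phi> z) + \<phi> z * fst (DU i z))
            + (\<Sum>j\<in>UNIV. q i j z * (U i z * snd (D\<phi> z) $ j + \<phi> z * snd (DU i z) $ j))
            + (aa z + bb z) * (U i z * snd (D\<phi> z) $ i + \<phi> z * snd (DU i z) $ i))
      - (r z * (1 / 2 * (\<Sum>i\<in>UNIV. U i z * U i z) * fst (D\<phi> z) + \<phi> z * (\<Sum>i\<in>UNIV. U i z * fst (DU i z)))
            + (\<Sum>j\<in>UNIV. mm j z * (1 / 2 * (\<Sum>i\<in>UNIV. U i z * U i z) * snd (D\<phi> z) $ j + \<phi> z * (\<Sum>i\<in>UNIV. U i z * snd (DU i z) $ j))))
      + (r z * (P1 (r z) * fst (D\<phi> z) + \<phi> z * (P2 (r z) * fst (Dr z)))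
            + (\<Sum>j\<in>UNIV. mm j z * (P1 (r z) * snd (D\<phi> z) $ j + \<phi> z * (P2 (r z) * snd (Dr z) $ j))))
      - ((Q (r z) * fst (D\<phi> z) + \<phi> z * (r z * P2 (r z) * fst (Dr z)))
            + (\<Sum>i\<in>UNIV. Q (r z) * U i z * snd (D\<phi> z) $ i + \<phi> z * (Q (r z) * snd (DU i z) $ i + U i z * (r z * P2 (r z) * snd (Dr z) $ i))))
      - aa z * \<phi> z * (\<Sum>i\<in>UNIV. snd (DU i z) $ i)" for z
  proof -
    have k1: "G1 i z = mm i z * (U i z * fst (D\<phi> z) + \<phi> z * fst (DU i z))
            + (\<Sum>j\<in>UNIV. q i j z * (U i z * snd (D\<phi> z) $ j + \<phi> z * snd (DU i z) $ j))
            + (aa z + bb z) * (U i z * snd (D\<phi> z) $ i + \<phi> z * snd (DU i z) $ i)" for i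
      unfolding G1_def flux1 by simp
    have k2: "G2 z = r z * (1 / 2 * (\<Sum>i\<in>UNIV. U i z * U i z) * fst (D\<phi> z) + \<phi> z * (\<Sum>i\<in>UNIV. U i z * fst (DU i z)))
            + (\<Sum>j\<in>UNIV. mm j z * (1 / 2 * (\<Sum>i\<in>UNIV. U i z * U i z) * snd (D\<phi> z) $ j + \<phi> z * (\<Sum>i\<in>UNIV. U i z * snd (DU i z) $ j)))"
      unfolding G2_def flux2 Sq_def by (simp add: fst_sum snd_sum)
    have k3: "G3 z = r z * (P1 (r z) * fst (D\<phi> z) + \<phi> z * (P2 (r z) * fst (Dr z)))
            + (\<Sum>j\<in>UNIV. mm j z * (P1 (r z) * snd (D\<phi> z) $ j + \<phi> z * (P2 (r z) * snd (Dr z) $ j)))"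
      unfolding G3_def flux2 by (simp add: mult.assoc)
    have k4: "G4 z = Q (r z) * fst (D\<phi> z) + \<phi> z * (r z * P2 (r z) * fst (Dr z))"
      unfolding G4_def D4_def by (simp add: inner_prod_def mult.assoc)
    have k5: "G5 i z = Q (r z) * U i z * snd (D\<phi> z) $ i + \<phi> z * (Q (r z) * snd (DU i z) $ i + U i z * (r z * P2 (r z) * snd (Dr z) $ i))" for i
      unfolding G5_def D4_def by (simp add: inner_prod_def inner_axis algebra_simps)
    have k7: "(\<Sum>i\<in>UNIV. G7 i z) - G8 z = aa z * \<phi> z * (\<Sum>i\<in>UNIV. snd (DU i z) $ i)"
      unfolding G7_def G8_def flux3 D6_def sum_distrib_left sum_subtractf[symmetric]
      by (intro sum.cong refl) (simp add: inner_prod_def inner_axis algebra_simps)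
    show ?thesis unfolding G_def k1 k2 k3 k4 k5 k7 ..
  qed
  have Q_eq: "Q (r z) = r z * P1 (r z) - P (r z)" for z by (rule pd(11))
  define c where "c = (100 * (real CARD('n))\<^sup>2 * X ^ 4) * \<theta> + \<delta> * (real CARD('n) * Y ^ 2)"
  have rem: "\<bar>G z - energy_integrand D\<phi> P Q z\<bar> \<le> c * weight \<epsilon> z" if z: "fst z \<in> {a..b}" for z
  proof -
    define w where "w = root_weight \<epsilon> z"
    have w: "1 \<le> w" "w ^ 3 = weight \<epsilon> z" "norm (u z) \<le> w" "norm (momentum z) \<le> w" using root_weight[OF e(1)] by (auto simp: w_def)
    define su where "su = \<epsilon> powr \<alpha> * w"
    define sr where "sr = \<epsilon> powr \<beta> * w"
    note os = osc_bound_fields[OF e(1), where z = z, folded w_def, folded su_def sr_def]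
    have s0: "0 \<le> su" "0 \<le> sr" using w by (auto simp: su_def sr_def)
    have up: "2 * A\<^sup>2 * s \<le> X * s" "7 * A ^ 4 * s \<le> X * s" if "0 \<le> s" for s
      using K X YX that by (auto intro!: mult_right_mono)
    have absc: "\<bar>fst E\<bar> \<le> norm E" "\<bar>snd E $ j\<bar> \<le> norm E" for E :: "'n spacetime" and j
      using norm_fst_le[of "fst E" "snd E"] norm_snd_le[of "snd E" "fst E"] component_le_norm_cart[of "snd E" j] by auto
    have dU: "norm (DU i z) \<le> X * (su / \<epsilon>)" for i
      using order_trans[OF dmol_bound[OF os(1)[of i] A e(1)] up(1)] s0 e unfolding DU_def by simp
    have dr: "norm (Dr z) \<le> X * (sr / \<epsilon>)"
      using order_trans[OF dmol_bound[OF os(2) A e(1)] up(1)] s0 e unfolding Dr_def by simp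
    have Uu: "\<bar>U i z - u z $ i\<bar> \<le> K * su" for i
      using mol_minus(2)[OF os(1)[of i] A] mult_right_mono[OF K(1) s0(1)] unfolding U_def by linarith
    have rz: "r y \<in> {-R..R}" for y
      using mol_bound[OF locint_rho e0, of R y] rho unfolding r_def by (auto simp: abs_of_nonneg abs_le_iff)
    \<comment> \<open>Averages around points with time in \<open>{a..b}\<close> only see times
      inside \<open>(0,T)\<close>, where \<open>bv\<close> is \<open>Q(\<rho>)\<close>.\<close>
    have bbz: "bb z = mol \<epsilon> (\<lambda>z. Q (\<rho> z)) z"
      unfolding bb_def
    proof (rule mol_cong_ball)
      fix h :: "'n spacetime" assume h: "norm h < 1"
      have "\<bar>\<epsilon> * fst h\<bar> \<le> \<epsilon> * 1"
        unfolding abs_mult using e h norm_fst_le[of "fst h" "snd h"] by (intro mult_mono) auto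
      then have "fst (z + \<epsilon> *\<^sub>R h) \<in> {0<..<T}" using e z by auto
      then show "bv (z + \<epsilon> *\<^sub>R h) = Q (\<rho> (z + \<epsilon> *\<^sub>R h))" by (simp add: bv_def)
    qed
    have "\<bar>G z - energy_integrand D\<phi> P Q z\<bar>
      \<le> (100 * (real CARD('n))\<^sup>2 * X ^ 4) * \<theta> * w ^ 3 + \<delta> * (real CARD('n) * Y ^ 2) * w ^ 3"
      unfolding Gid energy_identity[where m = "\<lambda>i. mm i z" and U = "\<lambda>i. U i z" and u = "\<lambda>i. u z $ i" and Ut = "\<lambda>i. fst (DU i z)"
        and \<phi>x = "\<lambda>j. snd (D\<phi> z) $ j" and rx = "\<lambda>j. snd (Dr z) $ j" and q = "\<lambda>i j. q i j z" and Ux = "\<lambda>i j. snd (DU i z) $ j"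
        and \<phi> = "\<phi> z" and \<phi>t = "fst (D\<phi> z)" and \<rho> = "\<rho> z" and r = "r z" and a = "aa z" and b = "bb z"
        and P = "P (r z)" and P\<rho> = "P (\<rho> z)" and ?P1.0 = "P1 (r z)" and ?P2.0 = "P2 (r z)" and Q = "Q (r z)" and Q\<rho> = "Q (\<rho> z)" and rt = "fst (Dr z)", OF Q_eq]
        energy_integrand_def add_diff_cancel_left'
    proof (rule energy_remainder_bound[where m = "\<lambda>i. mm i z" and U = "\<lambda>i. U i z" and u = "\<lambda>i. u z $ i" and Ut = "\<lambda>i. fst (DU i z)"
        and \<phi>x = "\<lambda>j. snd (D\<phi> z) $ j" and rx = "\<lambda>j. snd (Dr z) $ j" and q = "\<lambda>i j. q i j z" and Ux = "\<lambda>i j. snd (DU i z) $ j"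
        and \<phi> = "\<phi> z" and \<phi>t = "fst (D\<phi> z)" and \<rho> = "\<rho> z" and r = "r z" and a = "aa z" and b = "bb z"
        and P = "P (r z)" and P\<rho> = "P (\<rho> z)" and ?P1.0 = "P1 (r z)" and ?P2.0 = "P2 (r z)" and Q = "Q (r z)" and Q\<rho> = "Q (\<rho> z)"
        and w = w and eu = "\<epsilon> powr \<alpha>" and er = "\<epsilon> powr \<beta>" and e = \<epsilon>, folded su_def sr_def])
      show "1 \<le> X" using X YX by linarith
      show "\<bar>\<phi> z\<bar> \<le> X" using B(2)[of z] X YX by linarith
      show "\<bar>fst (D\<phi> z)\<bar> \<le> X" "\<bar>snd (D\<phi> z) $ j\<bar> \<le> X" "\<bar>snd (D\<phi> z) $ j\<bar> \<le> Y" for j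
        using absc[of "D\<phi> z"] B(3)[of z] X YX by (meson order_trans)+
      show "\<bar>u z $ i\<bar> \<le> w" for i using component_le_norm_cart[of "u z" i] w by linarith
      show "\<bar>\<rho> z * u z $ i\<bar> \<le> w" for i using component_le_norm_cart[of "momentum z" i] w by (simp add: momentum_def)
      show "\<bar>U i z - u z $ i\<bar> \<le> X * su" for i
        using Uu[of i] mult_right_mono[OF order_trans[OF YX(2) X(1)] s0(1)] by linarith
      show "\<bar>mm i z - \<rho> z * u z $ i\<bar> \<le> X * sr" for i
        using mol_minus(2)[OF os(3)[of i] A] up(1)[OF s0(2)] unfolding mm_def by (simp add: momentum_def)
      show "\<bar>r z - \<rho> z\<bar> \<le> X * sr"
        using mol_minus(2)[OF os(2) A] up(1)[OF s0(2)] unfolding r_def by simp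
      show "\<bar>fst (DU i z)\<bar> \<le> X * (su / \<epsilon>)" "\<bar>snd (DU i z) $ j\<bar> \<le> X * (su / \<epsilon>)" for i j
        using absc[of "DU i z"] dU[of i] by (meson order_trans)+
      show "\<bar>snd (Dr z) $ j\<bar> \<le> X * (sr / \<epsilon>)" for j using absc(2)[of "Dr z" j] dr by linarith
      show "\<bar>mm i z - r z * U i z\<bar> \<le> X * (sr * su)" for i
        using mol_mult_commutator[OF os(2) os(1)[of i] A] up(2)[OF mult_nonneg_nonneg[OF s0(2,1)]]
        unfolding mm_def r_def U_def by (simp add: momentum_def)
      show "\<bar>q i j z - mm j z * U i z\<bar> \<le> X * (sr * su)" for i j
        using mol_mult_commutator[OF os(3)[of j] os(1)[of i] A] up(2)[OF mult_nonneg_nonneg[OF s0(2,1)]]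
        unfolding mm_def q_def U_def by linarith
      have "\<bar>bb z - Q (r z)\<bar> \<le> L * (14 * A ^ 6 * (sr * sr))"
        unfolding bbz r_def
      proof (rule mol_compose_commutator[OF os(2) A, where ?F1.0 = "r z * P2 (r z)"])
        fix h
        show "\<bar>Q (\<rho> (z + \<epsilon> *\<^sub>R h)) - Q (mol \<epsilon> \<rho> z) - r z * P2 (r z) * (\<rho> (z + \<epsilon> *\<^sub>R h) - mol \<epsilon> \<rho> z)\<bar>
            \<le> L * (\<rho> (z + \<epsilon> *\<^sub>R h) - mol \<epsilon> \<rho> z)\<^sup>2"
          using LP(7)[OF rR rz[of z]] unfolding r_def .
      qed (use L1 in auto)
      also have "\<dots> = L * K * (sr * sr)" by (simp add: K_def)
      also have "\<dots> \<le> X * (sr * sr)" using LK s0 by (intro mult_right_mono) auto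
      finally show "\<bar>bb z - Q (r z)\<bar> \<le> X * (sr * sr)" .
      have "\<bar>bb z - Q (\<rho> z)\<bar> \<le> L * (2 * A\<^sup>2 * sr)"
        unfolding bbz by (rule osc_bound_lipschitz_average[OF os(2) A]) (use L1 LP(6) rR in auto)
      also have "\<dots> \<le> L * (K * sr)" using K s0 L1 by (intro mult_left_mono mult_right_mono) auto
      also have "\<dots> \<le> X * sr" using mult_right_mono[OF LK s0(2)] by (simp add: mult.assoc)
      finally show "\<bar>bb z - Q (\<rho> z)\<bar> \<le> X * sr" .
      show "\<bar>aa z\<bar> \<le> \<delta>" by (rule aab)
      show "\<bar>U i z\<bar> \<le> Y * w" for i
      proof -
        have "su \<le> 1 * w" unfolding su_def using th w by (intro mult_right_mono) auto
        then have "K * su \<le> K * w" using K by (intro mult_left_mono) auto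
        moreover have "0 \<le> B * w" using B w by simp
        ultimately show ?thesis using Uu[of i] component_le_norm_cart[of "u z" i] w by (simp add: Y_def distrib_right)
      qed
      show "\<bar>P (r z) - P (\<rho> z)\<bar> \<le> X * \<bar>r z - \<rho> z\<bar>"
        using LP(5)[OF rz[of z] rR[of z]] mult_right_mono[OF X(2) abs_ge_zero[of "r z - \<rho> z"]] by linarith
      show "\<bar>P1 (r z)\<bar> \<le> X" "\<bar>P2 (r z)\<bar> \<le> X" "\<bar>P (\<rho> z)\<bar> \<le> X" "\<bar>Q (\<rho> z)\<bar> \<le> X"
        using LP(1-4) rz[of z] rR[of z] X(2) by (meson order_trans)+
    qed (use w th e in auto)
    then show ?thesis by (simp add: c_def w distrib_right)
  qed
  have P0: "{0..R} \<subseteq> {-R..R}" using R0 by auto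
  have Ti: "set_integrable lborel slab (energy_integrand D\<phi> P Q)"
    by (rule energy_integrand_integrable[OF \<phi> ab, where L = L]) (use LP P0 in auto)
  have Gi: "set_integrable lborel slab G" and Gy: "(LINT z:slab|lborel. G z) = y" using hG by (auto simp: has_slab_integral_def)
  have [measurable]: "S \<in> sets borel" by (simp add: S_def)
  have "(LINT z:slab|lborel. energy_integrand D\<phi> P Q z) = y - (LINT z:slab|lborel. G z - energy_integrand D\<phi> P Q z)"
    using Gi Ti Gy by (simp add: set_integral_diff)
  moreover have "\<bar>LINT z:slab|lborel. G z - energy_integrand D\<phi> P Q z\<bar> \<le> c * (LINT z|lborel. indicator S z * weight \<epsilon> z)"
  proof -
    have iW: "integrable lborel (\<lambda>z. c * (indicator S z * weight \<epsilon> z))"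
      using weight_integral[OF ab] e unfolding S_def by (intro integrable_mult_right) blast
    have iR: "integrable lborel (\<lambda>z. indicator slab z *\<^sub>R (G z - energy_integrand D\<phi> P Q z))"
      using set_integral_diff(1)[OF Gi Ti] by (simp add: set_integrable_def)
    have "norm (indicator slab z *\<^sub>R (G z - energy_integrand D\<phi> P Q z)) \<le> c * (indicator S z * weight \<epsilon> z)" for z
    proof (cases "fst z \<in> {a..b}")
      case True
      then show ?thesis using rem[of z] by (auto simp: S_def slab_def indicator_def)
    next
      case False
      then have "G z = 0" "energy_integrand D\<phi> P Q z = 0"
        using D(4,5)[OF False] by (simp_all add: Gid energy_integrand_def)
      then show ?thesis using False by (auto simp: S_def indicator_def)
    qed
    from Bochner_Integration.integral_norm_bound_integral[OF iR iW this]
    show ?thesis by (simp add: set_lebesgue_integral_def)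
  qed
  ultimately show ?thesis using y unfolding c_def X_def Y_def K_def S_def by linarith
qed

end

section \<open>Approximating the pressure and its potential\<close>

text \<open>\<open>P / y\<close> is a primitive of \<open>Q / y\<^sup>2\<close>.\<close>

lemma potential_pair_integral:
  assumes pp: "potential_pair P P1 P2 P3 Q" and xc: "0 < x" "x \<le> c"
  shows "(LBINT y=ereal x..ereal c. Q y / y\<^sup>2) = P c / c - P x / x"
    and "continuous_on {x..c} (\<lambda>y. Q y / y\<^sup>2)"
proof -
  note d = potential_pairD[OF pp]
  show c: "continuous_on {x..c} (\<lambda>y. Q y / y\<^sup>2)"
    using d(8) xc by (intro continuous_intros) (auto intro: continuous_on_subset)
  show "(LBINT y=ereal x..ereal c. Q y / y\<^sup>2) = P c / c - P x / x"
  proof (rule interval_integral_FTC_finite)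
    show "continuous_on {min x c..max x c} (\<lambda>y. Q y / y\<^sup>2)" using c xc by (simp add: min_absorb1 max_absorb2)
    fix y assume y: "min x c \<le> y" "y \<le> max x c"
    then have y0: "y \<noteq> 0" using xc by auto
    have "((\<lambda>y. P y / y) has_real_derivative Q y / y\<^sup>2) (at y)"
      using d(1)[of y] y0 by (auto intro!: derivative_eq_intros simp: d(11)[of y] power2_eq_square field_simps)
    then show "((\<lambda>y. P y / y) has_vector_derivative Q y / y\<^sup>2) (at y within {min x c..max x c})"
      using has_field_derivative_at_within has_real_derivative_iff_has_vector_derivative by blast
  qed
qed

lemma potential_pair_const: "potential_pair (\<lambda>_. - k) (\<lambda>_. 0) (\<lambda>_. 0) (\<lambda>_. 0) (\<lambda>_. k)"
  by (simp add: potential_pair_def)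

text \<open>After multiplication with \<open>x\<close> the bound is at most \<open>\<delta>\<close>, uniformly down to vacuum.\<close>

lemma potential_integral_bound:
  assumes pp: "potential_pair P P1 P2 P3 Q" and xc: "0 < x" "x \<le> c"
    and i: "interval_lebesgue_integrable lborel (ereal x) (ereal c) (\<lambda>y. p y / y\<^sup>2)"
    and le: "\<And>y. x < y \<Longrightarrow> y < c \<Longrightarrow> \<bar>p y - Q y\<bar> \<le> \<delta>"
  shows "\<bar>(LBINT y=ereal x..ereal c. p y / y\<^sup>2) - (P c / c - P x / x)\<bar> \<le> \<delta> * (1 / x - 1 / c)"
proof -
  have iQ: "interval_lebesgue_integrable lborel (ereal x) (ereal c) (\<lambda>y. Q y / y\<^sup>2)"
    by (rule interval_integrable_continuous_on[OF xc(2) potential_pair_integral(2)[OF pp xc]])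
  note one = potential_pair_integral[OF potential_pair_const[of \<delta>] xc]
  have i1: "interval_lebesgue_integrable lborel (ereal x) (ereal c) (\<lambda>y. \<delta> / y\<^sup>2)"
    by (rule interval_integrable_continuous_on[OF xc(2) one(2)])
  have s: "set_integrable lborel {x<..<c} (\<lambda>y. p y / y\<^sup>2 - Q y / y\<^sup>2)" "set_integrable lborel {x<..<c} (\<lambda>y. \<delta> / y\<^sup>2)"
    using i iQ i1 xc by (auto simp: interval_lebesgue_integrable_def intro: set_integral_diff)
  have "(LBINT y=ereal x..ereal c. p y / y\<^sup>2) - (P c / c - P x / x)
     = (LBINT y=ereal x..ereal c. p y / y\<^sup>2 - Q y / y\<^sup>2)"
    using interval_lebesgue_integral_diff(2)[OF i iQ] potential_pair_integral(1)[OF pp xc] by simp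
  also have "\<dots> = (LINT y:{x<..<c}|lborel. p y / y\<^sup>2 - Q y / y\<^sup>2)"
    using xc by (simp add: interval_lebesgue_integral_def)
  also have "\<bar>\<dots>\<bar> \<le> (LINT y:{x<..<c}|lborel. \<delta> / y\<^sup>2)"
    unfolding set_lebesgue_integral_def real_norm_def[symmetric]
  proof (rule Bochner_Integration.integral_norm_bound_integral)
    show "norm (indicator {x<..<c} y *\<^sub>R (p y / y\<^sup>2 - Q y / y\<^sup>2)) \<le> indicator {x<..<c} y *\<^sub>R (\<delta> / y\<^sup>2)" for y
    proof (cases "y \<in> {x<..<c}")
      case True
      have "\<bar>p y / y\<^sup>2 - Q y / y\<^sup>2\<bar> = \<bar>p y - Q y\<bar> / y\<^sup>2" by (simp add: diff_divide_distrib[symmetric] abs_divide)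
      also have "\<dots> \<le> \<delta> / y\<^sup>2" using le True by (intro divide_right_mono) auto
      finally show ?thesis using True by simp
    qed simp
  qed (use s in \<open>auto simp: set_integrable_def\<close>)
  also have "\<dots> = (LBINT y=ereal x..ereal c. \<delta> / y\<^sup>2)"
    using xc by (simp add: interval_lebesgue_integral_def)
  also have "\<dots> = \<delta> * (1 / x - 1 / c)" unfolding one(1) by (simp add: algebra_simps)
  finally show ?thesis .
qed

text \<open>Near vacuum the pressure is almost the constant \<open>p 0\<close>, whose potential is \<open>- p 0\<close> up to a linear
  function, and linear functions vanish at \<open>0\<close>.\<close>

lemma pressure_potential_zero:
  assumes lim: "(p \<longlongrightarrow> p 0) (at_right 0)"
    and i: "\<And>r. 0 < r \<Longrightarrow> r \<le> 1 \<Longrightarrow> interval_lebesgue_integrable lborel 1 (ereal r) (\<lambda>y. p y / y\<^sup>2)"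
  shows "pressure_potential p 0 = - p 0"
proof -
  let ?J = "\<lambda>s. s * (LBINT y=1..ereal s. p y / y\<^sup>2)"
  have "(?J \<longlongrightarrow> - p 0) (at_right 0)"
  proof (rule tendstoI)
    fix e :: real assume e: "0 < e"
    have "\<forall>\<^sub>F y in at_right 0. dist (p y) (p 0) < e / 4"
      using lim e by (intro tendstoD) auto
    then obtain \<eta> where \<eta>: "0 < \<eta>" "\<And>y. 0 < y \<Longrightarrow> y < \<eta> \<Longrightarrow> dist (p y) (p 0) < e / 4"
      unfolding eventually_at_right_field by auto
    define c where "c = min \<eta> 1"
    have c: "0 < c" "c \<le> 1" "\<And>y. 0 < y \<Longrightarrow> y < c \<Longrightarrow> \<bar>p y - p 0\<bar> \<le> e / 4"
      using \<eta> by (auto simp: c_def dist_real_def less_imp_le)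
    define k where "k = \<bar>LBINT y=1..ereal c. p y / y\<^sup>2\<bar> + \<bar>p 0\<bar> / c"
    have k: "0 \<le> k" using c by (simp add: k_def)
    define d where "d = min c (e / (4 * (k + 1)))"
    have d: "0 < d" using c e k by (simp add: d_def)
    have "dist (?J s) (- p 0) < e" if s: "0 < s" "s < d" for s
    proof -
      have cubic_osc: "s \<le> c" "s \<le> 1" using s c by (auto simp: d_def)
      have i1: "interval_lebesgue_integrable lborel (ereal s) 1 (\<lambda>y. p y / y\<^sup>2)"
        using i[OF s(1) cubic_osc(2)] by (subst interval_integrable_endpoints_reverse)
      then have "set_integrable lborel {s<..<1} (\<lambda>y. p y / y\<^sup>2)"
        using cubic_osc by (simp add: interval_lebesgue_integrable_def one_ereal_def)
      then have "set_integrable lborel {s<..<c} (\<lambda>y. p y / y\<^sup>2)"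
        by (rule set_integrable_subset) (use c in auto)
      then have i2: "interval_lebesgue_integrable lborel (ereal s) (ereal c) (\<lambda>y. p y / y\<^sup>2)"
        using cubic_osc by (simp add: interval_lebesgue_integrable_def)
      have b: "\<bar>(LBINT y=ereal s..ereal c. p y / y\<^sup>2) - (- p 0 / c - - p 0 / s)\<bar> \<le> e / 4 * (1 / s - 1 / c)"
        by (rule potential_integral_bound[OF potential_pair_const s(1) cubic_osc(1) i2]) (use s c in auto)
      have sum: "(LBINT y=1..ereal c. p y / y\<^sup>2) + (LBINT y=ereal c..ereal s. p y / y\<^sup>2) = (LBINT y=1..ereal s. p y / y\<^sup>2)"
      proof (rule interval_integral_sum)
        have "min 1 (min (ereal c) (ereal s)) = ereal s" "max 1 (max (ereal c) (ereal s)) = 1"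
          using cubic_osc c by (auto simp: min_def max_def one_ereal_def)
        then show "interval_lebesgue_integrable lborel (min 1 (min (ereal c) (ereal s))) (max 1 (max (ereal c) (ereal s))) (\<lambda>y. p y / y\<^sup>2)"
          using i1 by simp
      qed
      have J: "?J s + p 0 = s * (LBINT y=1..ereal c. p y / y\<^sup>2) + s * (p 0 / c)
          - s * ((LBINT y=ereal s..ereal c. p y / y\<^sup>2) - (- p 0 / c - - p 0 / s))"
        using s unfolding sum[symmetric] interval_integral_endpoints_reverse[of "ereal c" "ereal s"]
        by (simp add: algebra_simps)
      have a1: "\<bar>s * (LBINT y=1..ereal c. p y / y\<^sup>2) + s * (p 0 / c)\<bar> \<le> s * k"
      proof -
        have "\<bar>(LBINT y=1..ereal c. p y / y\<^sup>2) + p 0 / c\<bar> \<le> k"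
          unfolding k_def using abs_triangle_ineq[of "LBINT y=1..ereal c. p y / y\<^sup>2" "p 0 / c"] c by (simp add: abs_divide)
        then have "s * \<bar>(LBINT y=1..ereal c. p y / y\<^sup>2) + p 0 / c\<bar> \<le> s * k" using s by (intro mult_left_mono) auto
        moreover have "s * (LBINT y=1..ereal c. p y / y\<^sup>2) + s * (p 0 / c) = s * ((LBINT y=1..ereal c. p y / y\<^sup>2) + p 0 / c)"
          by (simp only: distrib_left)
        ultimately show ?thesis using s by (simp only: abs_mult abs_of_pos)
      qed
      have "s * k \<le> e / (4 * (k + 1)) * k"
        using s k by (intro mult_right_mono) (auto simp: d_def)
      also have "\<dots> \<le> e / 4" using e k by (simp add: field_simps)
      finally have a2: "s * k \<le> e / 4" .
      have "\<bar>s * ((LBINT y=ereal s..ereal c. p y / y\<^sup>2) - (- p 0 / c - - p 0 / s))\<bar> \<le> s * (e / 4 * (1 / s - 1 / c))"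
        unfolding abs_mult using s b by (intro mult_mono) auto
      also have "\<dots> \<le> e / 4" using s c e by (simp add: field_simps)
      finally have a3: "\<bar>s * ((LBINT y=ereal s..ereal c. p y / y\<^sup>2) - (- p 0 / c - - p 0 / s))\<bar> \<le> e / 4" .
      have "\<bar>?J s + p 0\<bar> \<le> e / 4 + e / 4"
        unfolding J by (rule order_trans[OF abs_triangle_ineq4 add_mono[OF order_trans[OF a1 a2] a3]])
      then show ?thesis using e by (simp add: dist_real_def)
    qed
    then show "\<forall>\<^sub>F s in at_right 0. dist (?J s) (- p 0) < e"
      unfolding eventually_at_right_field using d by auto
  qed
  then have "Lim (at_right 0) ?J = - p 0" by (intro tendsto_Lim) auto
  then show ?thesis by (simp add: pressure_potential_def)
qed

text \<open>The pairs belonging to the monomials \<open>r\<^sup>2\<^sup>k\<close> are again monomials, whereas \<open>r\<close> itself would need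
  \<open>r ln r\<close>; since polynomials in \<open>r\<^sup>2\<close> are dense on intervals of nonnegative numbers, even pressures
  suffice. A linear term of \<open>P\<close> does not change \<open>Q\<close> and prescribes one value of \<open>P\<close>.\<close>

lemma even_potential_pair:
  fixes a :: "nat \<Rightarrow> real"
  assumes "y \<noteq> 0"
  shows "\<exists>P P1 P2 P3. potential_pair P P1 P2 P3 (\<lambda>x. \<Sum>k\<le>n. a k * (x\<^sup>2) ^ k) \<and> P y = v"
proof -
  define A where "A = (\<Sum>k\<le>n. monom (a k / (2 * real k - 1)) (2 * k))"
  define B where "B = A + monom ((v - poly A y) / y) 1"
  have "x * poly (pderiv (monom (a k / (2 * real k - 1)) (2 * k))) x - poly (monom (a k / (2 * real k - 1)) (2 * k)) x
      = a k * (x\<^sup>2) ^ k" for x k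
  proof -
    define c where "c = a k / (2 * real k - 1)"
    have "2 * real k - 1 \<noteq> 0" by (cases k) auto
    then have c: "a k = (2 * real k - 1) * c" by (simp add: c_def)
    have "x * (real (2 * k) * c * x ^ (2 * k - 1)) = real (2 * k) * c * x ^ (2 * k)"
      by (cases k) auto
    then have "x * (real (2 * k) * c * x ^ (2 * k - 1)) - c * x ^ (2 * k) = a k * x ^ (2 * k)"
      unfolding c by (simp add: algebra_simps)
    then show ?thesis unfolding c_def[symmetric] by (simp add: pderiv_monom poly_monom power_mult mult.assoc)
  qed
  then have "x * poly (pderiv A) x - poly A x = (\<Sum>k\<le>n. a k * (x\<^sup>2) ^ k)" for x
    by (simp add: A_def higher_pderiv_sum[where n = 1, simplified] poly_sum sum_distrib_left sum_subtractf[symmetric])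
  then have "x * poly (pderiv B) x - poly B x = (\<Sum>k\<le>n. a k * (x\<^sup>2) ^ k)" for x
    by (simp add: B_def pderiv_add pderiv_monom poly_monom algebra_simps)
  then have "potential_pair (poly B) (poly (pderiv B)) (poly (pderiv (pderiv B))) (poly (pderiv (pderiv (pderiv B))))
     (\<lambda>x. \<Sum>k\<le>n. a k * (x\<^sup>2) ^ k)"
    by (simp add: potential_pair_def poly_DERIV continuous_on_poly)
  moreover have "poly B y = v" using assms by (simp add: B_def poly_monom)
  ultimately show ?thesis by blast
qed

text \<open>If \<open>P\<close> agrees with the pressure potential at the upper end of the interval, then the difference at
  \<open>x\<close> is \<open>x\<close> times the integral of \<open>(Q - p) / y\<^sup>2\<close> from \<open>x\<close> to that end.\<close>

lemma pressure_approximation: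
  assumes lu: "0 \<le> lo" "lo \<le> up" and cont: "continuous_on {lo..up} p"
    and pd: "pressure_potential_defined p lo up" and \<delta>: "0 < \<delta>"
  shows "\<exists>P P1 P2 P3 Q. potential_pair P P1 P2 P3 Q \<and>
    (\<forall>x\<in>{lo..up}. \<bar>p x - Q x\<bar> \<le> \<delta> \<and> \<bar>pressure_potential p x - P x\<bar> \<le> \<delta>)"
proof -
  have ii: "interval_lebesgue_integrable lborel 1 (ereal r) (\<lambda>y. p y / y\<^sup>2)" if "r \<in> {min lo 1..max up 1}" "0 < r" for r
    using pd that by (auto simp: pressure_potential_defined_def)
  have pot0: "pressure_potential p 0 = - p 0" if "lo = 0"
  proof (rule pressure_potential_zero)
    show "interval_lebesgue_integrable lborel 1 (ereal r) (\<lambda>y. p y / y\<^sup>2)" if "0 < r" "r \<le> 1" for r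
      using ii[of r] that \<open>lo = 0\<close> by auto
    show "(p \<longlongrightarrow> p 0) (at_right 0)"
    proof (cases "up = 0")
      case True
      then show ?thesis using pd by (simp add: pressure_potential_defined_def)
    next
      case False
      then have "(p \<longlongrightarrow> p 0) (at 0 within {0..up})"
        using cont lu that by (simp add: continuous_on_def)
      then show ?thesis using False lu by (simp add: at_within_Icc_at_right)
    qed
  qed
  show ?thesis
  proof (cases "up = 0")
    case True
    then have "lo = 0" using lu by simp
    then show ?thesis using potential_pair_const[of "p 0"] pot0 True \<delta> by fastforce
  next
    case False
    then have up: "0 < up" using lu by simp
    \<comment> \<open>Polynomials in \<open>s = r\<^sup>2\<close> are even polynomials in
      \<open>r\<close>.\<close>
    have "continuous_on {lo\<^sup>2..up\<^sup>2} (\<lambda>s. p (sqrt s))"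
    proof (rule continuous_on_compose2[OF cont])
      show "sqrt ` {lo\<^sup>2..up\<^sup>2} \<subseteq> {lo..up}"
        using lu by (auto intro!: real_le_rsqrt real_le_lsqrt)
    qed (intro continuous_intros)
    then obtain g where g: "real_polynomial_function g" "\<And>s. s \<in> {lo\<^sup>2..up\<^sup>2} \<Longrightarrow> \<bar>p (sqrt s) - g s\<bar> < \<delta>"
      using Stone_Weierstrass_real_polynomial_function[of "{lo\<^sup>2..up\<^sup>2}"] \<delta> by (metis compact_Icc)
    obtain a n where a: "g = (\<lambda>x. \<Sum>i\<le>n. a i * x ^ i)"
      using g(1) unfolding real_polynomial_function_iff_sum by blast
    define Q where "Q x = (\<Sum>k\<le>n. a k * (x\<^sup>2) ^ k)" for x :: real
    have Qp: "\<bar>p x - Q x\<bar> \<le> \<delta>" if "x \<in> {lo..up}" for x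
    proof -
      have "x\<^sup>2 \<in> {lo\<^sup>2..up\<^sup>2}" "sqrt (x\<^sup>2) = x" using that lu by (auto intro: power_mono)
      then show ?thesis using g(2)[of "x\<^sup>2"] by (simp add: a Q_def)
    qed
    obtain P P1 P2 P3 where pp: "potential_pair P P1 P2 P3 Q" and Pup: "P up = pressure_potential p up"
      using even_potential_pair[where n = n and a = a and v = "pressure_potential p up", OF False] unfolding Q_def[abs_def] by blast
    have "\<bar>pressure_potential p x - P x\<bar> \<le> \<delta>" if x: "x \<in> {lo..up}" for x
    proof (cases "x = 0")
      case True
      then have "lo = 0" using x lu by simp
      then show ?thesis using True pot0 Qp[OF x] potential_pairD(11)[OF pp, of 0] by simp
    next
      case False
      then have x0: "0 < x" "x \<le> up" using x lu by auto
      have "continuous_on {x..up} (\<lambda>y. p y / y\<^sup>2)"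
        using cont x x0 by (intro continuous_intros) (auto intro: continuous_on_subset)
      then have i: "interval_lebesgue_integrable lborel (ereal x) (ereal up) (\<lambda>y. p y / y\<^sup>2)"
        by (rule interval_integrable_continuous_on[OF x0(2)])
      have ix: "interval_lebesgue_integrable lborel 1 (ereal x) (\<lambda>y. p y / y\<^sup>2)"
        and iu: "interval_lebesgue_integrable lborel 1 (ereal up) (\<lambda>y. p y / y\<^sup>2)"
        using x x0 up by (auto intro!: ii)
      have ix': "interval_lebesgue_integrable lborel (ereal x) 1 (\<lambda>y. p y / y\<^sup>2)"
        using ix by (subst interval_integrable_endpoints_reverse)
      have "(LBINT y=1..ereal x. p y / y\<^sup>2) + (LBINT y=ereal x..ereal up. p y / y\<^sup>2) = (LBINT y=1..ereal up. p y / y\<^sup>2)"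
      proof (rule interval_integral_sum)
        have "min 1 (min (ereal x) (ereal up)) = min 1 (ereal x)" "max 1 (max (ereal x) (ereal up)) = max 1 (ereal up)"
          using x0 by (auto simp: min_def max_def)
        moreover have "min 1 (ereal x) = 1 \<and> max 1 (ereal up) = ereal up \<or> min 1 (ereal x) = ereal x \<and> max 1 (ereal up) = 1
            \<or> min 1 (ereal x) = ereal x \<and> max 1 (ereal up) = ereal up"
          using x0 by (auto simp: min_def max_def one_ereal_def)
        ultimately show "interval_lebesgue_integrable lborel (min 1 (min (ereal x) (ereal up))) (max 1 (max (ereal x) (ereal up))) (\<lambda>y. p y / y\<^sup>2)"
          using i iu ix' by auto
      qed
      then have e: "(LBINT y=1..ereal x. p y / y\<^sup>2) = (LBINT y=1..ereal up. p y / y\<^sup>2) - (LBINT y=ereal x..ereal up. p y / y\<^sup>2)" by simp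
      have Pu: "P up / up = (LBINT y=1..ereal up. p y / y\<^sup>2)" using Pup up by (simp add: pressure_potential_def)
      have "pressure_potential p x - P x = - x * ((LBINT y=ereal x..ereal up. p y / y\<^sup>2) - (P up / up - P x / x))"
        using False unfolding Pu by (simp add: pressure_potential_def e algebra_simps)
      also have "\<bar>\<dots>\<bar> \<le> x * (\<delta> * (1 / x - 1 / up))"
      proof -
        have "\<bar>(LBINT y=ereal x..ereal up. p y / y\<^sup>2) - (P up / up - P x / x)\<bar> \<le> \<delta> * (1 / x - 1 / up)"
          by (rule potential_integral_bound[OF pp x0 i]) (use Qp x in auto)
        then show ?thesis using x0 by (simp add: abs_mult)
      qed
      also have "\<dots> \<le> \<delta>" using x0 up \<delta> by (simp add: field_simps)
      finally show ?thesis .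
    qed
    then show ?thesis using pp Qp by blast
  qed
qed

lemma pressure_potential_continuous:
  assumes "0 \<le> lo" "lo \<le> up" "continuous_on {lo..up} p" "pressure_potential_defined p lo up"
  shows "continuous_on {lo..up} (pressure_potential p)"
proof -
  have "\<exists>P. continuous_on UNIV P \<and> (\<forall>x\<in>{lo..up}. \<bar>pressure_potential p x - P x\<bar> \<le> step_size n)" for n
    using pressure_approximation[OF assms step_size_pos(1)[of n]] potential_pairD(5) by meson
  then obtain P where P: "\<And>n. continuous_on UNIV (P n)" "\<And>n x. x \<in> {lo..up} \<Longrightarrow> \<bar>pressure_potential p x - P n x\<bar> \<le> step_size n"
    by metis
  have "uniform_limit {lo..up} P (pressure_potential p) sequentially"
  proof (rule uniform_limitI)
    fix e :: real assume "0 < e"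
    have "step_size \<longlonglongrightarrow> 0" using LIMSEQ_inverse_real_of_nat by (simp add: step_size_def[abs_def] inverse_eq_divide)
    then have "\<forall>\<^sub>F n in sequentially. step_size n < e" using \<open>0 < e\<close> by (rule order_tendstoD)
    then show "\<forall>\<^sub>F n in sequentially. \<forall>x\<in>{lo..up}. dist (P n x) (pressure_potential p x) < e"
    proof eventually_elim
      case (elim n)
      then show ?case using P(2)[of _ n] by (force simp: dist_real_def abs_minus_commute)
    qed
  qed
  then show ?thesis
    by (rule uniform_limit_theorem[rotated])
       (auto intro!: always_eventually continuous_on_subset[OF P(1)])
qed

section \<open>Energy balance for the flow\<close>

context torus_flow
begin

text \<open>As \<open>\<epsilon>\<close> tends to \<open>0\<close>, only the contribution of the pressure error survives. It matters that \<open>C\<close> is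
  chosen before the approximation.\<close>

lemma energy_defect:
  assumes \<phi>: "c1_torus a b \<phi> D\<phi>" and ab: "0 < a" "b < T"
  shows "\<exists>C. \<forall>\<delta> P P1 P2 P3 Q. potential_pair P P1 P2 P3 Q \<longrightarrow> 0 \<le> \<delta> \<longrightarrow>
    (\<forall>z. fst z \<in> {0<..<T} \<longrightarrow> \<bar>pr z - Q (\<rho> z)\<bar> \<le> \<delta>) \<longrightarrow>
    \<bar>LINT z:slab|lborel. energy_integrand D\<phi> P Q z\<bar> \<le> C * \<delta>"
proof -
  obtain A where A: "kernel_bound TYPE('n spacetime) A" using kernel_bound_exists by blast
  obtain B where B: "0 \<le> B" "\<And>z. \<bar>\<phi> z\<bar> \<le> B" "\<And>z. norm (D\<phi> z) \<le> B" using c1_torus_bounds[OF \<phi>] by metis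
  obtain C0 where C0: "0 \<le> C0" "\<And>\<epsilon>. 0 < \<epsilon> \<Longrightarrow> \<epsilon> < a \<Longrightarrow> b + \<epsilon> < T \<Longrightarrow>
      (LINT z|lborel. indicator ({a..b} \<times> unit_cell) z * weight \<epsilon> z) \<le> C0"
    using weight_integral[OF ab] by blast
  define n where "n = real CARD('n)"
  define Y where "Y = 1 + 14 * A ^ 6 + B"
  define C where "C = \<Lambda> * B + n * Y ^ 2 * C0"
  \<comment> \<open>The rate at which the worst of the remainder terms decays.\<close>
  define \<gamma> where "\<gamma> = min (min \<alpha> \<beta>) (min (2 * \<alpha> + \<beta> - 1) (\<alpha> + 2 * \<beta> - 1))"
  have \<gamma>: "0 < \<gamma>" "\<gamma> \<le> \<alpha>" "\<gamma> \<le> \<beta>" "\<gamma> \<le> 2 * \<alpha> + \<beta> - 1" "\<gamma> \<le> \<alpha> + 2 * \<beta> - 1"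
    using exps by (auto simp: \<gamma>_def)
  have "\<bar>LINT z:slab|lborel. energy_integrand D\<phi> P Q z\<bar> \<le> C * \<delta>"
    if pp: "potential_pair P P1 P2 P3 Q" and \<delta>: "0 \<le> \<delta>" and close: "\<forall>z. fst z \<in> {0<..<T} \<longrightarrow> \<bar>pr z - Q (\<rho> z)\<bar> \<le> \<delta>"
    for \<delta> P P1 P2 P3 Q
  proof -
    let ?I = "\<bar>LINT z:slab|lborel. energy_integrand D\<phi> P Q z\<bar>"
    obtain L where L1: "1 \<le> L"
      and LP: "\<And>x. x \<in> {-R..R} \<Longrightarrow> \<bar>P x\<bar> \<le> L" "\<And>x. x \<in> {-R..R} \<Longrightarrow> \<bar>P1 x\<bar> \<le> L"
        "\<And>x. x \<in> {-R..R} \<Longrightarrow> \<bar>P2 x\<bar> \<le> L" "\<And>x. x \<in> {-R..R} \<Longrightarrow> \<bar>Q x\<bar> \<le> L"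
        "\<And>x y. x \<in> {-R..R} \<Longrightarrow> y \<in> {-R..R} \<Longrightarrow> \<bar>P x - P y\<bar> \<le> L * \<bar>x - y\<bar>"
        "\<And>x y. x \<in> {-R..R} \<Longrightarrow> y \<in> {-R..R} \<Longrightarrow> \<bar>Q x - Q y\<bar> \<le> L * \<bar>x - y\<bar>"
        "\<And>x y. x \<in> {-R..R} \<Longrightarrow> y \<in> {-R..R} \<Longrightarrow> \<bar>Q x - Q y - (y * P2 y) * (x - y)\<bar> \<le> L * (x - y)\<^sup>2"
      by (rule potential_pair_constants[OF pp, of R]) (rule that; blast)
    define D where "D = 100 * n\<^sup>2 * (Y * (1 + L)) ^ 4 * C0"
    have D0: "0 \<le> 100 * n\<^sup>2 * (Y * (1 + L)) ^ 4" by (simp add: zero_le_even_power)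
    define \<epsilon>0 where "\<epsilon>0 = min 1 (min a (T - b))"
    have \<epsilon>0: "0 < \<epsilon>0" using ab by (simp add: \<epsilon>0_def)
    have bound: "?I \<le> C * \<delta> + D * \<epsilon> powr \<gamma>" if e: "0 < \<epsilon>" "\<epsilon> < \<epsilon>0" for \<epsilon>
    proof -
      have e1: "\<epsilon> < a" "b + \<epsilon> < T" "\<epsilon> \<le> 1" using e by (auto simp: \<epsilon>0_def)
      have pw: "\<epsilon> powr s \<le> \<epsilon> powr \<gamma>" if "\<gamma> \<le> s" for s using that e e1 by (intro powr_mono') auto
      have q1: "\<epsilon> powr \<beta> * \<epsilon> powr \<alpha> * (\<epsilon> powr \<alpha> / \<epsilon>) = \<epsilon> powr (2 * \<alpha> + \<beta> - 1)"
        "\<epsilon> powr \<beta> * \<epsilon> powr \<beta> * (\<epsilon> powr \<alpha> / \<epsilon>) = \<epsilon> powr (\<alpha> + 2 * \<beta> - 1)"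
      proof -
        have d: "\<epsilon> powr s / \<epsilon> = \<epsilon> powr (s - 1)" for s using e by (simp add: powr_diff)
        show "\<epsilon> powr \<beta> * \<epsilon> powr \<alpha> * (\<epsilon> powr \<alpha> / \<epsilon>) = \<epsilon> powr (2 * \<alpha> + \<beta> - 1)"
          "\<epsilon> powr \<beta> * \<epsilon> powr \<beta> * (\<epsilon> powr \<alpha> / \<epsilon>) = \<epsilon> powr (\<alpha> + 2 * \<beta> - 1)"
          unfolding d powr_add[symmetric] by (simp_all add: algebra_simps)
      qed
      have "?I \<le> \<Lambda> * (\<delta> * B)
        + ((100 * (real CARD('n))\<^sup>2 * ((1 + 14 * A ^ 6 + B) * (1 + L)) ^ 4) * \<epsilon> powr \<gamma> + \<delta> * (real CARD('n) * (1 + 14 * A ^ 6 + B) ^ 2))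
          * (LINT z|lborel. indicator ({a..b} \<times> unit_cell) z * weight \<epsilon> z)"
      proof (rule energy_defect_at_scale[OF \<phi> ab pp \<delta> _ A L1 LP B e(1) e1(1,2)])
        show "\<epsilon> powr \<gamma> \<le> 1" using e e1 \<gamma> by (intro powr_le1) auto
      qed (use close pw \<gamma> q1 in auto)
      also have "\<dots> \<le> \<Lambda> * (\<delta> * B) + ((100 * n\<^sup>2 * (Y * (1 + L)) ^ 4) * \<epsilon> powr \<gamma> + \<delta> * (n * Y ^ 2)) * C0"
        unfolding n_def[symmetric] Y_def[symmetric]
        using C0(2)[OF e(1) e1(1,2)] D0 \<delta> by (intro add_left_mono mult_left_mono add_nonneg_nonneg mult_nonneg_nonneg) (auto simp: n_def)
      also have "\<dots> = C * \<delta> + D * \<epsilon> powr \<gamma>" by (simp add: C_def D_def algebra_simps)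
      finally show ?thesis .
    qed
    have "((\<lambda>\<epsilon>. \<epsilon> powr \<gamma>) \<longlongrightarrow> 0) (at_right 0)"
      by (rule tendsto_zero_powrI[OF tendsto_ident_at tendsto_const]) (auto simp: eventually_at_filter \<gamma>)
    then have "((\<lambda>\<epsilon>. C * \<delta> + D * \<epsilon> powr \<gamma>) \<longlongrightarrow> C * \<delta> + D * 0) (at_right 0)"
      by (intro tendsto_intros)
    then have "?I \<le> C * \<delta> + D * 0"
    proof (rule tendsto_lowerbound)
      show "\<forall>\<^sub>F \<epsilon> in at_right 0. ?I \<le> C * \<delta> + D * \<epsilon> powr \<gamma>"
        unfolding eventually_at_right_field using bound \<epsilon>0 by auto
    qed simp
    then show ?thesis by simp
  qed
  then show ?thesis by blast
qed

lemma energy_balance: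
  assumes \<phi>: "c1_torus a b \<phi> D\<phi>" and ab: "0 < a" "b < T"
    and m[measurable]: "Pot \<in> borel_measurable borel" "p \<in> borel_measurable borel"
    and L: "\<And>x. \<bar>Pot x\<bar> \<le> L" "\<And>x. \<bar>p x\<bar> \<le> L"
    and range: "\<And>z. fst z \<in> {0<..<T} \<Longrightarrow> \<rho> z \<in> J \<and> pr z = p (\<rho> z)"
    and approx: "\<And>\<delta>. 0 < \<delta> \<Longrightarrow> \<exists>P P1 P2 P3 Q. potential_pair P P1 P2 P3 Q \<and> (\<forall>x\<in>J. \<bar>p x - Q x\<bar> \<le> \<delta> \<and> \<bar>Pot x - P x\<bar> \<le> \<delta>)"
  shows "(LINT z:slab|lborel. energy_integrand D\<phi> Pot p z) = 0"
proof -
  note D = c1_torusD[OF \<phi>]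
  obtain B where B: "0 \<le> B" "\<And>z. \<bar>\<phi> z\<bar> \<le> B" "\<And>z. norm (D\<phi> z) \<le> B" using c1_torus_bounds[OF \<phi>] by metis
  obtain C where C: "\<And>\<delta> P P1 P2 P3 Q. potential_pair P P1 P2 P3 Q \<Longrightarrow> 0 \<le> \<delta> \<Longrightarrow>
    (\<forall>z. fst z \<in> {0<..<T} \<longrightarrow> \<bar>pr z - Q (\<rho> z)\<bar> \<le> \<delta>) \<Longrightarrow>
    \<bar>LINT z:slab|lborel. energy_integrand D\<phi> P Q z\<bar> \<le> C * \<delta>"
    using energy_defect[OF \<phi> ab] by blast
  define h where "h z = indicator ({0<..<T} \<times> UNIV) z * (3 * B * (1 + norm (u z) ^ 3))" for z :: "'n spacetime"
  have hm: "h \<in> borel_measurable borel"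
  proof -
    have [measurable]: "{0<..<T} \<times> UNIV \<in> sets (borel :: 'n spacetime measure)"
      by (intro borel_open open_Times) auto
    show ?thesis unfolding h_def[abs_def] by measurable
  qed
  have hi: "set_integrable lborel slab h"
    by (rule slab_integrable[where c = "3 * B", OF hm])
       (use B in \<open>auto simp: h_def indicator_def abs_mult zero_le_power\<close>)
  define J' where "J' = (LINT z:slab|lborel. h z)"
  have Ii: "set_integrable lborel slab (energy_integrand D\<phi> Pot p)"
    by (rule energy_integrand_integrable[OF \<phi> ab m]) (use L in auto)
  have main: "\<bar>LINT z:slab|lborel. energy_integrand D\<phi> Pot p z\<bar> \<le> (C + J') * \<delta>" if \<delta>: "0 < \<delta>" for \<delta>
  proof -
    obtain P P1 P2 P3 Q where pp: "potential_pair P P1 P2 P3 Q"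
      and cl: "\<And>x. x \<in> J \<Longrightarrow> \<bar>p x - Q x\<bar> \<le> \<delta>" "\<And>x. x \<in> J \<Longrightarrow> \<bar>Pot x - P x\<bar> \<le> \<delta>"
      using approx[OF \<delta>] by blast
    have 1: "\<bar>LINT z:slab|lborel. energy_integrand D\<phi> P Q z\<bar> \<le> C * \<delta>"
      using \<delta> range cl(1) by (intro C[OF pp]) auto
    obtain L' where L': "\<And>x. x \<in> {-R..R} \<Longrightarrow> \<bar>P x\<bar> \<le> L'" "\<And>x. x \<in> {-R..R} \<Longrightarrow> \<bar>Q x\<bar> \<le> L'"
      using potential_pair_constants[OF pp, of R] by metis
    have Pi: "set_integrable lborel slab (energy_integrand D\<phi> P Q)"
      by (rule energy_integrand_integrable[OF \<phi> ab, where L = L'])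
         (use L' R0 potential_pairD(5,8)[OF pp] in \<open>auto intro: borel_measurable_continuous_onI\<close>)
    have "\<bar>LINT z:slab|lborel. energy_integrand D\<phi> Pot p z - energy_integrand D\<phi> P Q z\<bar> \<le> (LINT z:slab|lborel. \<delta> * h z)"
      unfolding set_lebesgue_integral_def real_norm_def[symmetric]
    proof (rule Bochner_Integration.integral_norm_bound_integral)
      show "integrable lborel (\<lambda>z. indicator slab z *\<^sub>R (energy_integrand D\<phi> Pot p z - energy_integrand D\<phi> P Q z))"
        using set_integral_diff(1)[OF Ii Pi] by (simp add: set_integrable_def)
      show "integrable lborel (\<lambda>z. indicator slab z *\<^sub>R (\<delta> * h z))"
        using set_integrable_mult_right[of \<delta> lborel slab h] hi by (simp add: set_integrable_def)
      fix z :: "'n spacetime"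
      have "\<bar>energy_integrand D\<phi> Pot p z - energy_integrand D\<phi> P Q z\<bar> \<le> \<delta> * h z"
      proof (cases "fst z \<in> {0<..<T}")
        case True
        let ?s = "\<Sum>j\<in>UNIV. u z $ j * snd (D\<phi> z) $ j"
        have J: "\<rho> z \<in> J" using range True by blast
        have ft: "\<bar>fst (D\<phi> z)\<bar> \<le> B" "norm (snd (D\<phi> z)) \<le> B"
          using B(3)[of z] norm_fst_le[of "fst (D\<phi> z)" "snd (D\<phi> z)"] norm_snd_le[of "snd (D\<phi> z)" "fst (D\<phi> z)"] by auto
        have s: "\<bar>?s\<bar> \<le> norm (u z) * B"
        proof -
          have "?s = u z \<bullet> snd (D\<phi> z)" by (simp add: inner_vec_def)
          then show ?thesis using order_trans[OF Cauchy_Schwarz_ineq2 mult_left_mono[OF ft(2)]] by simp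
        qed
        have e: "energy_integrand D\<phi> Pot p z - energy_integrand D\<phi> P Q z
          = fst (D\<phi> z) * (Pot (\<rho> z) - P (\<rho> z)) + ((p (\<rho> z) - Q (\<rho> z)) + (Pot (\<rho> z) - P (\<rho> z))) * ?s"
          by (simp add: energy_integrand_def algebra_simps)
        have "\<bar>\<dots>\<bar> \<le> B * \<delta> + (\<delta> + \<delta>) * (norm (u z) * B)"
          by (intro abs_add_le abs_mult_le ft cl J s)
        also have "\<dots> = (\<delta> * B) * (1 + 2 * norm (u z))" by (simp add: algebra_simps)
        also have "\<dots> \<le> (\<delta> * B) * (3 * (1 + norm (u z) ^ 3))"
        proof (rule mult_left_mono)
          have "0 \<le> norm (u z) ^ 3" by simp
          then show "1 + 2 * norm (u z) \<le> 3 * (1 + norm (u z) ^ 3)" using velocity_le_cube(1)[of z] by argo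
        qed (use B(1) \<delta> in simp)
        also have "\<dots> = \<delta> * h z" using True by (simp add: h_def indicator_def mem_Times_iff)
        finally show ?thesis unfolding e .
      next
        case False
        then have "D\<phi> z = 0" using D(5)[of z] ab by auto
        moreover have "h z = 0" using False by (simp only: h_def indicator_def mem_Times_iff) simp
        ultimately show ?thesis by (simp add: energy_integrand_def)
      qed
      then show "norm (indicator slab z *\<^sub>R (energy_integrand D\<phi> Pot p z - energy_integrand D\<phi> P Q z)) \<le> indicator slab z *\<^sub>R (\<delta> * h z)"
        by (simp add: indicator_def)
    qed
    also have "\<dots> = J' * \<delta>" by (simp add: J'_def)
    finally have "\<bar>LINT z:slab|lborel. energy_integrand D\<phi> Pot p z - energy_integrand D\<phi> P Q z\<bar> \<le> J' * \<delta>" .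
    then show ?thesis using 1 by (simp add: set_integral_diff[OF Ii Pi] distrib_right)
  qed
  have "\<bar>LINT z:slab|lborel. energy_integrand D\<phi> Pot p z\<bar> \<le> 0 + e" if e: "0 < e" for e
  proof -
    have "(C + J') * (e / (\<bar>C + J'\<bar> + 1)) \<le> e"
    proof -
      have "(C + J') / (\<bar>C + J'\<bar> + 1) \<le> 1" by (simp add: pos_divide_le_eq add_nonneg_pos)
      from mult_right_mono[OF this, of e] show ?thesis using e by simp
    qed
    then show ?thesis using main[of "e / (\<bar>C + J'\<bar> + 1)"] e by simp
  qed
  from field_le_epsilon[OF this] show ?thesis by simp
qed

end

section \<open>Borel representatives of periodic fields\<close>

lemma cylinder_iff: "z \<in> cylinder T \<longleftrightarrow> z \<in> slab \<and> fst z \<in> {0<..<T}"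
  by (auto simp: cylinder_def slab_def mem_Times_iff)

lemma AE_lebesgue_shift:
  fixes P :: "'a::euclidean_space \<Rightarrow> bool"
  assumes "AE z in lebesgue. P z"
  shows "AE z in lebesgue. P (z + h)"
proof -
  obtain N where N: "N \<in> null_sets lebesgue" "{z \<in> space lebesgue. \<not> P z} \<subseteq> N"
    using assms by (auto simp: eventually_ae_filter)
  then have "negligible ((+) (- h) ` N)"
    by (intro negligible_translation) (simp add: negligible_iff_null_sets)
  then have "(+) (- h) ` N \<in> null_sets lebesgue" by (simp add: negligible_iff_null_sets)
  moreover have "{z \<in> space lebesgue. \<not> P (z + h)} \<subseteq> (+) (- h) ` N"
  proof
    fix z assume "z \<in> {z \<in> space lebesgue. \<not> P (z + h)}"
    then have "z + h \<in> N" using N(2) by auto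
    then show "z \<in> (+) (- h) ` N" by (intro image_eqI[of _ _ "z + h"]) auto
  qed
  ultimately show ?thesis by (rule AE_I')
qed

text \<open>Countably many lattice translates of the fundamental domain cover everything.\<close>

lemma AE_periodic:
  fixes P :: "'n::finite spacetime \<Rightarrow> bool"
  assumes "AE z in lebesgue. z \<in> cylinder T \<longrightarrow> P z" and per: "\<And>z k. P (z + lattice k) = P z"
  shows "AE z in lebesgue. fst z \<in> {0<..<T} \<longrightarrow> P z"
proof -
  have "AE z in lebesgue. \<forall>k. z + lattice k \<in> cylinder T \<longrightarrow> P (z + lattice k)"
    unfolding AE_all_countable using AE_lebesgue_shift[OF assms(1)] by blast
  then show ?thesis
  proof eventually_elim
    case (elim z)
    have "z + lattice (- floor_vec z) \<in> slab" using slab_lattice_iff[of z "floor_vec z"] by (simp add: lattice_minus)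
    moreover have "fst (z + lattice k) = fst z" for k by (simp add: lattice_def)
    ultimately show ?case using elim[rule_format, of "- floor_vec z"] by (simp only: cylinder_iff per) blast
  qed
qed

definition wrap_cell :: "'n::finite spacetime \<Rightarrow> 'n spacetime" where
  "wrap_cell z = z - lattice (floor_vec z)"

lemma borel_measurable_vec_lambda:
  fixes f :: "'n::finite \<Rightarrow> 'a \<Rightarrow> real"
  assumes "\<And>i. f i \<in> borel_measurable M"
  shows "(\<lambda>z. \<chi> i. f i z) \<in> borel_measurable M"
proof (rule borel_measurable_euclidean_space[THEN iffD2], rule ballI)
  fix b :: "real ^ 'n" assume "b \<in> Basis"
  then obtain i where "b = axis i 1" by (auto simp: Basis_vec_def)
  then show "(\<lambda>z. (\<chi> i. f i z) \<bullet> b) \<in> borel_measurable M"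
    using assms by (simp add: inner_axis)
qed

lemma wrap_cell_measurable[measurable]: "wrap_cell \<in> borel_measurable borel"
proof -
  have [measurable]: "(\<lambda>z::'a spacetime. fst z) \<in> borel_measurable borel" "(\<lambda>z::'a spacetime. snd z) \<in> borel_measurable borel"
    by (auto intro!: borel_measurable_continuous_onI continuous_intros)
  have [measurable]: "(\<lambda>z::'a spacetime. snd z $ i) \<in> borel_measurable borel" for i
    by (rule measurable_vec_nth) measurable
  have [measurable]: "(\<lambda>z::'a spacetime. \<chi> i. snd z $ i - of_int \<lfloor>snd z $ i\<rfloor>) \<in> borel_measurable borel"
    by (rule borel_measurable_vec_lambda) measurable
  have "wrap_cell = (\<lambda>z::'a spacetime. (fst z, \<chi> i. snd z $ i - of_int \<lfloor>snd z $ i\<rfloor>))"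
    by (auto simp: wrap_cell_def lattice_def floor_vec_def minus_prod_def vec_eq_iff)
  also have "\<dots> \<in> borel_measurable borel" by measurable
  finally show ?thesis .
qed

lemma floor_vec_lattice: "floor_vec (z + lattice k) = floor_vec z + k"
proof -
  have e: "z + lattice k - lattice (floor_vec z + k) = z - lattice (floor_vec z)"
    by (simp add: lattice_def vec_eq_iff prod_eq_iff)
  have "z + lattice k - lattice (floor_vec z + k) \<in> slab" unfolding e using slab_lattice_iff[of z "floor_vec z"] by simp
  then show ?thesis unfolding slab_lattice_iff by simp
qed

lemma wrap_cell_lattice: "wrap_cell (z + lattice k) = wrap_cell z"
  unfolding wrap_cell_def floor_vec_lattice by (simp add: lattice_def vec_eq_iff prod_eq_iff)

lemma wrap_cell_slab: "z \<in> slab \<Longrightarrow> wrap_cell z = z"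
proof -
  have 0: "lattice (0 :: int ^ 'a) = 0" by (simp add: lattice_def zero_prod_def vec_eq_iff)
  assume "z \<in> slab"
  then have "floor_vec z = 0" using slab_lattice_iff[of z 0] by (simp add: 0)
  then show ?thesis by (simp add: wrap_cell_def 0)
qed

lemma lattice_periodicI:
  assumes "\<And>z k. f (z + lattice k) = f z"
  shows "space_periodic f"
  unfolding space_periodic_def
proof (intro allI impI)
  fix t x and k :: "real ^ 'a" assume k: "\<forall>i. k $ i \<in> \<int>"
  have "of_int \<lfloor>k $ i\<rfloor> = k $ i" for i using k by (metis Ints_cases floor_of_int)
  then have "(\<chi> i. of_int \<lfloor>k $ i\<rfloor>) = k" by (simp only: vec_eq_iff vec_lambda_beta) simp
  then have "(t, x + k) = (t, x) + lattice (\<chi> i. \<lfloor>k $ i\<rfloor>)" by (simp add: lattice_def)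
  then show "f (t, x + k) = f (t, x)" using assms by simp
qed

lemma time_measurable: "{z::'n::finite spacetime. fst z \<in> {0<..<T}} \<in> sets borel"
  using open_vimage_fst[of "{0<..<T}"] by (intro borel_open) (simp add: vimage_def)

text \<open>A Borel version on the fundamental domain, continued periodically, is exactly periodic and agrees
  with \<open>f\<close> almost everywhere on each translate.\<close>

lemma representative:
  fixes f :: "'n::finite spacetime \<Rightarrow> real"
  assumes per: "space_periodic f" and m: "set_borel_measurable lebesgue (cylinder T) f"
  obtains g where "g \<in> borel_measurable borel" "space_periodic g" "\<And>z. fst z \<notin> {0<..<T} \<Longrightarrow> g z = 0"
    "AE z in lebesgue. fst z \<in> {0<..<T} \<longrightarrow> f z = g z"
proof -
  obtain f0 where f0[measurable]: "f0 \<in> borel_measurable lborel"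
    and ae: "AE z in lborel. indicator (cylinder T) z *\<^sub>R f z = f0 z"
    using completion_ex_borel_measurable_real[OF m[unfolded set_borel_measurable_def]] by blast
  define g where "g z = indicator {z. fst z \<in> {0<..<T}} z * f0 (wrap_cell z)" for z
  have "AE z in lebesgue. z \<in> cylinder T \<longrightarrow> f z = f0 (wrap_cell z)"
    using AE_completion[OF ae] by eventually_elim (auto simp: cylinder_iff wrap_cell_slab)
  then have 1: "AE z in lebesgue. fst z \<in> {0<..<T} \<longrightarrow> f z = f0 (wrap_cell z)"
    by (rule AE_periodic) (simp add: wrap_cell_lattice periodic_lattice[OF per])
  show ?thesis
  proof (rule that[of g])
    have [measurable]: "{z::'n spacetime. fst z \<in> {0<..<T}} \<in> sets borel" by (rule time_measurable)
    have [measurable]: "f0 \<in> borel_measurable borel" using f0 by simp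
    show "g \<in> borel_measurable borel" unfolding g_def[abs_def] by measurable
    show "space_periodic g"
      by (rule lattice_periodicI) (simp add: g_def wrap_cell_lattice indicator_def, simp add: lattice_def)
    show "g z = 0" if "fst z \<notin> {0<..<T}" for z using that by (simp add: g_def)
    show "AE z in lebesgue. fst z \<in> {0<..<T} \<longrightarrow> f z = g z"
      using 1 by eventually_elim (simp add: g_def)
  qed
qed

section \<open>Transfer between a field and its representative\<close>

lemma cylinder_integral:
  fixes F G :: "'n::finite spacetime \<Rightarrow> 'b::euclidean_space"
  assumes [measurable]: "G \<in> borel_measurable borel" and z0: "\<And>z. fst z \<notin> {0<..<T} \<Longrightarrow> G z = 0"
    and ae: "AE z in lebesgue. fst z \<in> {0<..<T} \<longrightarrow> F z = G z"
  shows "(LINT z:cylinder T|lebesgue. F z) = (LINT z:slab|lborel. G z)"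
proof -
  have G: "(\<lambda>z. indicator slab z *\<^sub>R G z) \<in> borel_measurable lborel" by measurable
  have e: "AE z in lebesgue. indicator slab z *\<^sub>R G z = indicator (cylinder T) z *\<^sub>R F z"
    using ae by eventually_elim (use z0 in \<open>auto simp: indicator_def cylinder_iff\<close>)
  have "(LINT z:cylinder T|lebesgue. F z) = (LINT z|lebesgue. indicator slab z *\<^sub>R G z)"
    unfolding set_lebesgue_integral_def
    by (rule integral_cong_AE[OF borel_measurable_AE[OF measurable_completion[OF G] e] measurable_completion[OF G]])
       (use e in eventually_elim, simp)
  also have "\<dots> = (LINT z:slab|lborel. G z)"
    unfolding set_lebesgue_integral_def by (rule integral_completion[OF G])
  finally show ?thesis .
qed

lemma locally_integrable_transfer:
  fixes F G :: "'n::finite spacetime \<Rightarrow> 'b::euclidean_space"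
  assumes [measurable]: "G \<in> borel_measurable borel" and i: "set_integrable lborel slab G"
    and ae: "AE z in lebesgue. fst z \<in> {0<..<T} \<longrightarrow> F z = G z"
  shows "locally_integrable T F"
  unfolding locally_integrable_def
proof (intro allI impI)
  fix a b :: real assume ab: "0 < a" "b < T"
  let ?S = "{a..b} \<times> (unit_cell :: (real^'n) set)"
  have G: "(\<lambda>z. indicator ?S z *\<^sub>R G z) \<in> borel_measurable lborel" by measurable
  have e: "AE z in lebesgue. indicator ?S z *\<^sub>R G z = indicator ?S z *\<^sub>R F z"
    using ae by eventually_elim (use ab in \<open>auto simp: indicator_def\<close>)
  have "set_integrable lborel ?S G"
    by (rule set_integrable_subset[OF i]) (auto simp: slab_def)
  then have "integrable lebesgue (\<lambda>z. indicator ?S z *\<^sub>R G z)"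
    unfolding set_integrable_def using integrable_completion[OF G] by simp
  then show "set_integrable lebesgue ?S F"
    unfolding set_integrable_def
    using integrable_cong_AE[OF measurable_completion[OF G] borel_measurable_AE[OF measurable_completion[OF G] e] e] by simp
qed

lemma Lq_norm_cube:
  assumes "Lq_norm 3 S F \<le> ennreal c" "0 \<le> c"
  shows "(\<integral>\<^sup>+z\<in>S. ennreal (norm (F z) ^ 3) \<partial>lebesgue) \<le> ennreal (c ^ 3)"
proof -
  define I where "I = (\<integral>\<^sup>+z\<in>S. ennreal (norm (F z) powr 3) \<partial>lebesgue)"
  have L: "Lq_norm 3 S F = (if I = \<infinity> then \<infinity> else ennreal (enn2real I powr (1 / 3)))"
    by (simp add: Lq_norm_def I_def Let_def)
  have I: "I \<noteq> \<infinity>"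
  proof
    assume "I = \<infinity>"
    then have "Lq_norm 3 S F = \<infinity>" using L by simp
    then show False using assms(1) by (simp add: top_unique)
  qed
  then have "enn2real I powr (1 / 3) \<le> c" using L assms by simp
  then have "(enn2real I powr (1 / 3)) ^ 3 \<le> c ^ 3" by (intro power_mono) auto
  moreover have "(enn2real I powr (1 / 3)) ^ 3 = enn2real I"
    by (cases "enn2real I = 0") (simp_all add: powr_realpow[symmetric] powr_powr)
  ultimately have "ennreal (enn2real I) \<le> ennreal (c ^ 3)" by (intro ennreal_leI) simp
  then have "I \<le> ennreal (c ^ 3)" using I by (simp add: less_top)
  then show ?thesis by (simp add: I_def)
qed

lemma in_besov_bound:
  fixes f g :: "'n::finite spacetime \<Rightarrow> 'b::euclidean_space"
  assumes b: "in_besov 3 \<gamma> T f" and ae: "AE z in lebesgue. fst z \<in> {0<..<T} \<longrightarrow> f z = g z"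
    and [measurable]: "g \<in> borel_measurable borel" and z0: "\<And>z. fst z \<notin> {0<..<T} \<Longrightarrow> g z = 0"
  shows "set_integrable lborel slab (\<lambda>z. norm (g z) ^ 3)"
    and "\<exists>M\<ge>0. besov_bound T M \<gamma> g"
proof -
  define N where "N = enn2real (besov_norm 3 \<gamma> T f)"
  have fin: "besov_norm 3 \<gamma> T f < \<infinity>" using b by (simp add: in_besov_def)
  then have N: "besov_norm 3 \<gamma> T f = ennreal N" "0 \<le> N" by (simp_all add: N_def less_top)
  have "Lq_norm 3 (cylinder T) f \<le> ennreal N" unfolding N(1)[symmetric] besov_norm_def by simp
  from Lq_norm_cube[OF this N(2)]
  have "(\<integral>\<^sup>+z\<in>cylinder T. ennreal (norm (f z) ^ 3) \<partial>lebesgue) \<le> ennreal (N ^ 3)" .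
  also have "(\<integral>\<^sup>+z\<in>cylinder T. ennreal (norm (f z) ^ 3) \<partial>lebesgue) = (\<integral>\<^sup>+z. ennreal (norm (indicator slab z *\<^sub>R norm (g z) ^ 3)) \<partial>lebesgue)"
    by (rule nn_integral_cong_AE)
       (use ae in eventually_elim, use z0 in \<open>auto simp: indicator_def cylinder_iff\<close>)
  also have "\<dots> = (\<integral>\<^sup>+z. ennreal (norm (indicator slab z *\<^sub>R norm (g z) ^ 3)) \<partial>lborel)"
    by (rule nn_integral_completion)
  finally show "set_integrable lborel slab (\<lambda>z. norm (g z) ^ 3)"
    unfolding set_integrable_def integrable_iff_bounded
    by (auto intro: le_less_trans)
  have "besov_bound T (N ^ 3) \<gamma> g"
    unfolding besov_bound_def
  proof
    fix \<xi> :: "'n spacetime"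
    let ?S = "{z \<in> cylinder T. fst (z + \<xi>) \<in> {0<..<T}}"
    show "(\<integral>\<^sup>+z. ennreal (norm (g (z + \<xi>) - g z) ^ 3) *
      indicator {z \<in> slab. fst z \<in> {0<..<T} \<and> fst (z + \<xi>) \<in> {0<..<T}} z \<partial>lborel)
      \<le> ennreal (N ^ 3 * norm \<xi> powr (3 * \<gamma>))"
    proof (cases "\<xi> = 0")
      case False
      define w where "w = norm \<xi> powr \<gamma>"
      have w: "0 < w" using False by (simp add: w_def)
      let ?L = "Lq_norm 3 ?S (\<lambda>z. f (z + \<xi>) - f z)"
      have "?L / ennreal w \<le> (SUP \<xi>\<in>UNIV - {0}. Lq_norm 3 {z \<in> cylinder T. fst (z + \<xi>) \<in> {0<..<T}} (\<lambda>z. f (z + \<xi>) - f z) / ennreal (norm \<xi> powr \<gamma>))"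
        unfolding w_def by (rule SUP_upper) (use False in simp)
      also have "\<dots> \<le> ennreal N" unfolding N(1)[symmetric] besov_norm_def by simp
      finally have "?L / ennreal w * ennreal w \<le> ennreal N * ennreal w" by (rule mult_right_mono) simp
      then have "?L \<le> ennreal (N * w)"
        using w N by (simp add: ennreal_divide_times ennreal_mult)
      from Lq_norm_cube[OF this] have "(\<integral>\<^sup>+z\<in>?S. ennreal (norm (f (z + \<xi>) - f z) ^ 3) \<partial>lebesgue) \<le> ennreal ((N * w) ^ 3)"
        using w N by simp
      also have "(N * w) ^ 3 = N ^ 3 * norm \<xi> powr (3 * \<gamma>)"
        using False by (simp add: power_mult_distrib w_def powr_power mult.commute)
      also have "(\<integral>\<^sup>+z\<in>?S. ennreal (norm (f (z + \<xi>) - f z) ^ 3) \<partial>lebesgue)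
        = (\<integral>\<^sup>+z. ennreal (norm (g (z + \<xi>) - g z) ^ 3) *
      indicator {z \<in> slab. fst z \<in> {0<..<T} \<and> fst (z + \<xi>) \<in> {0<..<T}} z \<partial>lebesgue)"
        by (rule nn_integral_cong_AE)
           (use ae AE_lebesgue_shift[OF ae, of \<xi>] in eventually_elim, auto simp: indicator_def cylinder_iff)
      finally show ?thesis by (simp only: nn_integral_completion)
    qed simp
  qed
  then show "\<exists>M\<ge>0. besov_bound T M \<gamma> g" using N by (intro exI[of _ "N ^ 3"]) simp
qed

lemma besov_bound_mono: "besov_bound T M \<gamma> f \<Longrightarrow> M \<le> M' \<Longrightarrow> besov_bound T M' \<gamma> f"
  unfolding besov_bound_def
  by (meson ennreal_leI mult_right_mono order_trans powr_ge_zero)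

lemma test_pairing:
  assumes "\<phi> \<in> test_functions T"
  shows "g * dt \<phi> z + F \<bullet> grad \<phi> z = (g, F) \<bullet> nabla \<phi> z"
    and "dt \<phi> z = fst (nabla \<phi> z)" "grad \<phi> z = snd (nabla \<phi> z)"
proof -
  have d: "\<phi> differentiable (at z)"
    using assms smooth_differentiable by (auto simp: test_functions_def)
  show t: "dt \<phi> z = fst (nabla \<phi> z)"
    unfolding dt_def nabla_inner[OF d, symmetric] by (simp add: inner_prod_def)
  show x: "grad \<phi> z = snd (nabla \<phi> z)"
    unfolding grad_def nabla_inner[OF d, symmetric] by (simp add: inner_prod_def inner_axis vec_eq_iff)
  show "g * dt \<phi> z + F \<bullet> grad \<phi> z = (g, F) \<bullet> nabla \<phi> z"
    by (simp add: t x inner_prod_def)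
qed

lemma test_function_c1_torus:
  assumes "\<phi> \<in> test_functions T"
  obtains a b where "0 < a" "b < T" "c1_torus a b \<phi> (nabla \<phi>)"
proof -
  obtain a b where ab: "0 < a" "b < T" "\<forall>t x. t \<notin> {a..b} \<longrightarrow> \<phi> (t, x) = 0"
    and s: "smooth \<phi>" "space_periodic \<phi>"
    using assms by (auto simp: test_functions_def)
  have "\<phi> z = 0" if "fst z \<notin> {a..b}" for z
    using ab(3) that by (metis prod.collapse)
  then have "c1_torus a b \<phi> (nabla \<phi>)"
    using s smooth_c1 by (auto simp: c1_torus_def)
  then show ?thesis using that ab by blast
qed

lemma weak_bound_of_balance:
  fixes G :: "'n::finite spacetime \<Rightarrow> real"
  assumes bal: "distributional_balance T g F" and m[measurable]: "G \<in> borel_measurable borel" "H \<in> borel_measurable borel"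
    and z0: "\<And>z. fst z \<notin> {0<..<T} \<Longrightarrow> G z = 0 \<and> H z = 0"
    and ae: "AE z in lebesgue. fst z \<in> {0<..<T} \<longrightarrow> g z = G z \<and> F z = H z"
  shows "weak_bound T 0 (\<lambda>z. (G z, H z))"
  unfolding weak_bound_def
proof (intro ballI allI impI)
  fix \<phi> :: "'n spacetime \<Rightarrow> real" and B
  assume \<phi>: "\<phi> \<in> test_functions T"
  obtain a b where c: "c1_torus a b \<phi> (nabla \<phi>)" using test_function_c1_torus[OF \<phi>] by metis
  have [measurable]: "nabla \<phi> \<in> borel_measurable borel" using c1_torusD(7)[OF c] .
  have "(LINT z:cylinder T|lebesgue. g z * dt \<phi> z + F z \<bullet> grad \<phi> z) = (LINT z:slab|lborel. (G z, H z) \<bullet> nabla \<phi> z)"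
  proof (rule cylinder_integral)
    show "(\<lambda>z. (G z, H z) \<bullet> nabla \<phi> z) \<in> borel_measurable borel" by measurable
    show "(G z, H z) \<bullet> nabla \<phi> z = 0" if "fst z \<notin> {0<..<T}" for z
      using z0[OF that] by (simp add: zero_prod_def[symmetric])
    show "AE z in lebesgue. fst z \<in> {0<..<T} \<longrightarrow> g z * dt \<phi> z + F z \<bullet> grad \<phi> z = (G z, H z) \<bullet> nabla \<phi> z"
      using ae by eventually_elim (simp add: test_pairing(1)[OF \<phi>])
  qed
  then show "\<bar>LINT z:slab|lborel. (G z, H z) \<bullet> nabla \<phi> z\<bar> \<le> 0 * B"
    using bal \<phi> by (simp add: distributional_balance_def)
qed

text \<open>The total variation is bounded by the sum of the two total masses.\<close>

lemma weak_bound_of_measure: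
  fixes v H :: "'n::finite spacetime \<Rightarrow> real ^ 'n"
  assumes dv: "div_is_finite_measure T v" and m[measurable]: "H \<in> borel_measurable borel"
    and z0: "\<And>z. fst z \<notin> {0<..<T} \<Longrightarrow> H z = 0"
    and ae: "AE z in lebesgue. fst z \<in> {0<..<T} \<longrightarrow> v z = H z"
  shows "\<exists>\<Lambda>\<ge>0. weak_bound T \<Lambda> (\<lambda>z. (0, H z))"
proof -
  obtain \<mu>1 \<mu>2 where \<mu>: "finite_measure_on_cylinder T \<mu>1" "finite_measure_on_cylinder T \<mu>2"
    and rep: "\<And>\<phi>. \<phi> \<in> test_functions T \<Longrightarrow> - (LINT z:cylinder T|lebesgue. v z \<bullet> grad \<phi> z) = (LINT z|\<mu>1. \<phi> z) - (LINT z|\<mu>2. \<phi> z)"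
    using dv by (auto simp: div_is_finite_measure_def)
  define \<Lambda> where "\<Lambda> = measure \<mu>1 (space \<mu>1) + measure \<mu>2 (space \<mu>2)"
  have bound: "\<bar>LINT z|\<mu>. \<phi> z\<bar> \<le> measure \<mu> (space \<mu>) * B"
    if "finite_measure_on_cylinder T \<mu>" and B: "\<And>z. \<bar>\<phi> z\<bar> \<le> B" and \<phi>: "\<phi> \<in> borel_measurable borel"
    for \<mu> :: "'n spacetime measure" and \<phi> B
  proof -
    interpret finite_measure \<mu> using that(1) by (simp add: finite_measure_on_cylinder_def)
    have "\<phi> \<in> borel_measurable \<mu>"
      using \<phi> that(1) by (simp add: finite_measure_on_cylinder_def cong: measurable_cong_sets)
    then have "integrable \<mu> \<phi>" by (rule integrable_const_bound[of _ B, rotated]) (use B in auto)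
    from Bochner_Integration.integral_norm_bound_integral[OF this, of "\<lambda>_. B"] B
    show ?thesis by simp
  qed
  have "weak_bound T \<Lambda> (\<lambda>z. (0, H z))"
    unfolding weak_bound_def
  proof (intro ballI allI impI)
    fix \<phi> :: "'n spacetime \<Rightarrow> real" and B
    assume \<phi>: "\<phi> \<in> test_functions T" and B: "\<forall>z. \<bar>\<phi> z\<bar> \<le> B"
    obtain a b where c: "c1_torus a b \<phi> (nabla \<phi>)" using test_function_c1_torus[OF \<phi>] by metis
    have [measurable]: "nabla \<phi> \<in> borel_measurable borel" using c1_torusD(7)[OF c] .
    have "(LINT z:cylinder T|lebesgue. v z \<bullet> grad \<phi> z) = (LINT z:slab|lborel. (0, H z) \<bullet> nabla \<phi> z)"
    proof (rule cylinder_integral)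
      show "(\<lambda>z. (0::real, H z) \<bullet> nabla \<phi> z) \<in> borel_measurable borel" by measurable
      show "(0::real, H z) \<bullet> nabla \<phi> z = 0" if "fst z \<notin> {0<..<T}" for z
        using z0[OF that] by (simp add: zero_prod_def[symmetric])
      show "AE z in lebesgue. fst z \<in> {0<..<T} \<longrightarrow> v z \<bullet> grad \<phi> z = (0, H z) \<bullet> nabla \<phi> z"
        using ae by eventually_elim (simp add: test_pairing(3)[OF \<phi>] inner_prod_def)
    qed
    then have "\<bar>LINT z:slab|lborel. (0, H z) \<bullet> nabla \<phi> z\<bar> \<le> measure \<mu>1 (space \<mu>1) * B + measure \<mu>2 (space \<mu>2) * B"
    proof -
      have "\<bar>LINT z|\<mu>1. \<phi> z\<bar> \<le> measure \<mu>1 (space \<mu>1) * B" "\<bar>LINT z|\<mu>2. \<phi> z\<bar> \<le> measure \<mu>2 (space \<mu>2) * B"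
        using bound[OF \<mu>(1)] bound[OF \<mu>(2)] B c1_torusD(6)[OF c] by blast+
      moreover assume "(LINT z:cylinder T|lebesgue. v z \<bullet> grad \<phi> z) = (LINT z:slab|lborel. (0, H z) \<bullet> nabla \<phi> z)"
      ultimately show ?thesis using rep[OF \<phi>] by linarith
    qed
    then show "\<bar>LINT z:slab|lborel. (0, H z) \<bullet> nabla \<phi> z\<bar> \<le> \<Lambda> * B" by (simp add: \<Lambda>_def distrib_right)
  qed
  moreover have "0 \<le> \<Lambda>" by (simp add: \<Lambda>_def)
  ultimately show ?thesis by blast
qed

lemma cylinder_not_null:
  assumes "0 < T"
  shows "\<not> (AE z in lebesgue. z \<notin> (cylinder T :: 'n::finite spacetime set))"
proof
  assume ae: "AE z in lebesgue. z \<notin> (cylinder T :: 'n spacetime set)"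
  let ?U = "{0<..<T} \<times> box 0 (1 :: real ^ 'n)"
  have sub: "?U \<subseteq> cylinder T"
    by (auto simp: cylinder_def unit_cell_def mem_box_cart less_imp_le)
  have "AE z in lebesgue. z \<notin> ?U" using ae by eventually_elim (use sub in blast)
  then have "?U \<in> null_sets lebesgue"
  proof (subst (asm) AE_iff_null_sets[symmetric])
    have "?U \<in> sets lborel" unfolding sets_lborel by (intro borel_open open_Times) auto
    then show "?U \<in> sets lebesgue" by (rule sets_completionI_sets)
  qed
  then have "negligible ?U" by (simp add: negligible_iff_null_sets)
  moreover have "open ?U" by (intro open_Times) auto
  moreover have "(T / 2, \<chi> i. 1 / 2) \<in> ?U" using assms by (auto simp: mem_box_cart)
  ultimately show False using open_not_negligible[of ?U] by blast
qed

section \<open>Local conservation of energy\<close>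

lemma set_borel_measurable_nth:
  fixes f :: "'a \<Rightarrow> real ^ 'n::finite"
  assumes "set_borel_measurable M A f"
  shows "set_borel_measurable M A (\<lambda>z. f z $ i)"
  using measurable_vec_nth[OF assms[unfolded set_borel_measurable_def], of i]
  by (simp add: set_borel_measurable_def)

theorem theorem3p2:
  fixes T \<alpha> \<beta> \<rho>low \<rho>up :: real
    and p :: "real \<Rightarrow> real"
    and \<rho> :: "'n::finite spacetime \<Rightarrow> real"
    and u :: "'n spacetime \<Rightarrow> real ^ 'n"
  assumes "0 < T"
    and "euler_solution T p \<rho> u"
    and "0 \<le> \<alpha>" "\<alpha> \<le> 1" "0 \<le> \<beta>" "\<beta> \<le> 1"
    and "\<beta> > max (1 - 2 * \<alpha>) ((1 - \<alpha>) / 2)"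
    and "in_besov 3 \<alpha> T u"
    and "in_besov 3 \<beta> T \<rho>"
    and "in_besov 3 \<beta> T (\<lambda>z. \<rho> z *\<^sub>R u z)"
    and "0 \<le> \<rho>low"
    and "AE z in lebesgue. z \<in> cylinder T \<longrightarrow> \<rho>low \<le> \<rho> z \<and> \<rho> z \<le> \<rho>up"
    and "div_is_finite_measure T u"
    and "continuous_on {\<rho>low..\<rho>up} p"
    and "pressure_potential_defined p \<rho>low \<rho>up"
  shows "distributional_balance T
    (\<lambda>z. 1 / 2 * \<rho> z * (norm (u z))\<^sup>2 + pressure_potential p (\<rho> z))
    (\<lambda>z. (1 / 2 * \<rho> z * (norm (u z))\<^sup>2 + p (\<rho> z) + pressure_potential p (\<rho> z)) *\<^sub>R u z)"
proof -
  note T = assms(1) and euler = assms(2) and bu = assms(8) and br = assms(9) and bm = assms(10)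
    and low = assms(11) and bd = assms(12) and dv = assms(13) and pc = assms(14) and pd = assms(15)
  have exps: "0 < \<alpha>" "0 < \<beta>" "1 < 2 * \<alpha> + \<beta>" "1 < \<alpha> + 2 * \<beta>"
    using assms(3-7) by (cases "\<alpha> = 0"; auto)+
  have lu: "\<rho>low \<le> \<rho>up"
  proof (rule ccontr)
    assume "\<not> \<rho>low \<le> \<rho>up"
    then have "AE z in lebesgue. z \<notin> (cylinder T :: 'n spacetime set)"
      using bd by (auto elim!: eventually_mono)
    then show False using cylinder_not_null[OF T, where 'n = 'n] by blast
  qed
  have pu: "space_periodic u" and p\<rho>: "space_periodic \<rho>"
    using bu br by (auto simp: in_besov_def)
  define time where "time = {z::'n spacetime. fst z \<in> {0<..<T}}"
  have time[measurable]: "time \<in> sets borel" unfolding time_def by (rule time_measurable)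

  have "\<exists>g. g \<in> borel_measurable borel \<and> space_periodic g \<and> (\<forall>z. fst z \<notin> {0<..<T} \<longrightarrow> g z = 0) \<and>
    (AE z in lebesgue. fst z \<in> {0<..<T} \<longrightarrow> u z $ i = g z)" for i
  proof -
    have 1: "space_periodic (\<lambda>z. u z $ i)" using pu by (simp add: space_periodic_def)
    have 2: "set_borel_measurable lebesgue (cylinder T) (\<lambda>z. u z $ i)"
      using bu by (intro set_borel_measurable_nth) (simp add: in_besov_def)
    show ?thesis by (rule representative[OF 1 2]) blast
  qed
  then have "\<forall>i. \<exists>g. g \<in> borel_measurable borel \<and> space_periodic g \<and> (\<forall>z. fst z \<notin> {0<..<T} \<longrightarrow> g z = 0) \<and>
    (AE z in lebesgue. fst z \<in> {0<..<T} \<longrightarrow> u z $ i = g z)"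
    by (intro allI)
  from choice[OF this] obtain g where gs: "\<forall>i. g i \<in> borel_measurable borel \<and> space_periodic (g i) \<and>
    (\<forall>z. fst z \<notin> {0<..<T} \<longrightarrow> g i z = 0) \<and> (AE z in lebesgue. fst z \<in> {0<..<T} \<longrightarrow> u z $ i = g i z)"
    by blast
  have g: "g i \<in> borel_measurable borel" "space_periodic (g i)"
    "fst z \<notin> {0<..<T} \<Longrightarrow> g i z = 0" "AE z in lebesgue. fst z \<in> {0<..<T} \<longrightarrow> u z $ i = g i z" for i z
    using gs[THEN spec, of i] by blast+
  define v where "v z = (\<chi> i. g i z)" for z
  have vm[measurable]: "v \<in> borel_measurable borel"
    unfolding v_def[abs_def] by (rule borel_measurable_vec_lambda) (rule g)
  have vp: "space_periodic v" using g(2) by (simp add: v_def space_periodic_def)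
  have v0: "v z = 0" if "fst z \<notin> {0<..<T}" for z using g(3)[OF that] by (simp add: v_def vec_eq_iff)
  have "AE z in lebesgue. \<forall>i. fst z \<in> {0<..<T} \<longrightarrow> u z $ i = g i z"
    unfolding AE_all_countable using g(4) by blast
  then have vae: "AE z in lebesgue. fst z \<in> {0<..<T} \<longrightarrow> u z = v z"
    by eventually_elim (simp add: v_def vec_eq_iff)

  have "set_borel_measurable lebesgue (cylinder T) \<rho>" using br by (simp add: in_besov_def)
  then have "\<exists>g. g \<in> borel_measurable borel \<and> space_periodic g \<and>
    (AE z in lebesgue. fst z \<in> {0<..<T} \<longrightarrow> \<rho> z = g z)"
    by (rule representative[OF p\<rho>]) blast
  then obtain r0 where r0[measurable]: "r0 \<in> borel_measurable borel" and r0p: "space_periodic r0"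
    and r0ae: "AE z in lebesgue. fst z \<in> {0<..<T} \<longrightarrow> \<rho> z = r0 z"
    by blast
  \<comment> \<open>Clipping extends the pressure and its potential to continuous bounded functions
    on the whole line and makes the bounds on the density hold everywhere.\<close>
  define clip where "clip x = max \<rho>low (min \<rho>up x)" for x
  have clip: "clip x \<in> {\<rho>low..\<rho>up}" "x \<in> {\<rho>low..\<rho>up} \<Longrightarrow> clip x = x" for x using lu by (auto simp: clip_def)
  have clipc: "continuous_on UNIV clip" unfolding clip_def[abs_def] by (intro continuous_intros)
  have clipm[measurable]: "clip \<in> borel_measurable borel" using clipc by (rule borel_measurable_continuous_onI)
  define r where "r z = indicator time z * clip (r0 z)" for z
  have rm[measurable]: "r \<in> borel_measurable borel" unfolding r_def[abs_def] by measurable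
  have indp: "indicator time (t, x) = (indicator time (t, y) :: real)" for t x y by (simp add: time_def indicator_def)
  have rp: "space_periodic r"
    using r0p unfolding space_periodic_def r_def by (metis indp)
  have r_off: "r z = 0" if "fst z \<notin> {0<..<T}" for z using that by (simp add: r_def time_def)
  have r_in: "r z \<in> {\<rho>low..\<rho>up}" if "fst z \<in> {0<..<T}" for z using that clip by (simp add: r_def time_def)
  have "AE z in lebesgue. fst z \<in> {0<..<T} \<longrightarrow> \<rho>low \<le> \<rho> z \<and> \<rho> z \<le> \<rho>up"
    by (rule AE_periodic[OF bd]) (simp add: periodic_lattice[OF p\<rho>])
  then have rae: "AE z in lebesgue. fst z \<in> {0<..<T} \<longrightarrow> \<rho> z = r z"
    using r0ae by eventually_elim (simp add: r_def time_def clip)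
  have ae: "AE z in lebesgue. fst z \<in> {0<..<T} \<longrightarrow> u z = v z \<and> \<rho> z = r z"
    using vae rae by eventually_elim simp
  have rb: "0 \<le> r z" "r z \<le> \<rho>up" for z
    using r_in[of z] r_off[of z] low lu by (cases "fst z \<in> {0<..<T}"; simp)+

  define p' where "p' x = p (clip x)" for x
  define pot where "pot x = pressure_potential p (clip x)" for x
  have c': "continuous_on UNIV p'" "continuous_on UNIV pot"
    unfolding p'_def[abs_def] pot_def[abs_def]
    using clip(1) by (auto intro!: continuous_on_compose2[OF pc clipc]
        continuous_on_compose2[OF pressure_potential_continuous[OF low lu pc pd] clipc])
  have m'[measurable]: "p' \<in> borel_measurable borel" "pot \<in> borel_measurable borel"
    using c' by (auto intro: borel_measurable_continuous_onI)
  have "\<exists>L. \<forall>x\<in>{\<rho>low..\<rho>up}. \<bar>f x\<bar> \<le> L" if "continuous_on {\<rho>low..\<rho>up} f" for f :: "real \<Rightarrow> real"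
    using compact_imp_bounded[OF compact_continuous_image[OF that]] by (fastforce simp: bounded_iff)
  note bdd = this
  obtain L1 where L1: "\<forall>x\<in>{\<rho>low..\<rho>up}. \<bar>p x\<bar> \<le> L1" using bdd[OF pc] by blast
  obtain L2 where L2: "\<forall>x\<in>{\<rho>low..\<rho>up}. \<bar>pressure_potential p x\<bar> \<le> L2"
    using bdd[OF pressure_potential_continuous[OF low lu pc pd]] by blast
  note L12 = L1 L2
  define L where "L = \<bar>L1\<bar> + \<bar>L2\<bar>"
  have L: "\<bar>p' x\<bar> \<le> L" "\<bar>pot x\<bar> \<le> L" for x
    using L12(1)[rule_format, OF clip(1)[of x]] L12(2)[rule_format, OF clip(1)[of x]]
    by (auto simp: p'_def pot_def L_def)
  have in_range: "p' (r z) = p (r z)" "pot (r z) = pressure_potential p (r z)" if "fst z \<in> {0<..<T}" for z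
    using clip(2)[OF r_in[OF that]] by (simp_all add: p'_def pot_def)
  define q where "q z = indicator time z * p' (r z)" for z
  have qm[measurable]: "q \<in> borel_measurable borel" unfolding q_def[abs_def] by measurable
  have qp: "space_periodic q" using rp unfolding space_periodic_def q_def by (metis indp)
  have q_off: "q z = 0" if "fst z \<notin> {0<..<T}" for z using that by (simp add: q_def time_def)
  have q_in: "q z = p' (r z)" if "fst z \<in> {0<..<T}" for z using that by (simp add: q_def time_def)
  have qb: "\<bar>q z\<bar> \<le> L" for z using L(1)[of "r z"] order_trans[OF abs_ge_zero L(1)] by (simp add: q_def indicator_def)

  have mae: "AE z in lebesgue. fst z \<in> {0<..<T} \<longrightarrow> \<rho> z *\<^sub>R u z = r z *\<^sub>R v z"
    using ae by eventually_elim simp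
  have rvm: "(\<lambda>z. r z *\<^sub>R v z) \<in> borel_measurable borel" by measurable
  have rv0: "r z *\<^sub>R v z = 0" if "fst z \<notin> {0<..<T}" for z using v0[OF that] by simp
  obtain Mu where Mu: "0 \<le> Mu" "besov_bound T Mu \<alpha> v" using in_besov_bound(2)[OF bu vae vm v0] by blast
  obtain Mr where Mr: "0 \<le> Mr" "besov_bound T Mr \<beta> r" using in_besov_bound(2)[OF br rae rm r_off] by blast
  obtain Mm where Mm: "0 \<le> Mm" "besov_bound T Mm \<beta> (\<lambda>z. r z *\<^sub>R v z)"
    using in_besov_bound(2)[OF bm mae rvm rv0] by blast
  have M: "0 \<le> Mu + Mr + Mm" "besov_bound T (Mu + Mr + Mm) \<alpha> v" "besov_bound T (Mu + Mr + Mm) \<beta> r"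
    "besov_bound T (Mu + Mr + Mm) \<beta> (\<lambda>z. r z *\<^sub>R v z)"
    using Mu(1) Mr(1) Mm(1) by (auto intro: besov_bound_mono[OF Mu(2)] besov_bound_mono[OF Mr(2)] besov_bound_mono[OF Mm(2)])
  have v3: "set_integrable lborel slab (\<lambda>z. norm (v z) ^ 3)"
    by (rule in_besov_bound(1)[OF bu vae vm v0])
  obtain \<Lambda> where \<Lambda>: "0 \<le> \<Lambda>" "weak_bound T \<Lambda> (\<lambda>z. (0, v z))"
    using weak_bound_of_measure[OF dv vm v0 vae] by blast
  have mass: "weak_bound T 0 (\<lambda>z. (r z, r z *\<^sub>R v z))"
  proof (rule weak_bound_of_balance)
    show "distributional_balance T \<rho> (\<lambda>z. \<rho> z *\<^sub>R u z)" using euler by (simp add: euler_solution_def)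
    show "AE z in lebesgue. fst z \<in> {0<..<T} \<longrightarrow> \<rho> z = r z \<and> \<rho> z *\<^sub>R u z = r z *\<^sub>R v z"
      using ae by eventually_elim simp
  qed (use r_off in \<open>measurable, simp\<close>)
  have mom: "weak_bound T 0 (\<lambda>z. (r z * v z $ i, (r z * v z $ i) *\<^sub>R v z + q z *\<^sub>R axis i 1))" for i
  proof (rule weak_bound_of_balance)
    have [measurable]: "(\<lambda>z. v z $ i) \<in> borel_measurable borel" by (rule measurable_vec_nth) measurable
    show "distributional_balance T (\<lambda>z. \<rho> z * u z $ i) (\<lambda>z. (\<rho> z * u z $ i) *\<^sub>R u z + p (\<rho> z) *\<^sub>R axis i 1)"
      using euler by (simp add: euler_solution_def)
    show "(\<lambda>z. r z * v z $ i) \<in> borel_measurable borel" "(\<lambda>z. (r z * v z $ i) *\<^sub>R v z + q z *\<^sub>R axis i 1) \<in> borel_measurable borel"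
      by measurable
    show "r z * v z $ i = 0 \<and> (r z * v z $ i) *\<^sub>R v z + q z *\<^sub>R axis i 1 = 0" if "fst z \<notin> {0<..<T}" for z
      using r_off[OF that] q_off[OF that] by simp
    show "AE z in lebesgue. fst z \<in> {0<..<T} \<longrightarrow> \<rho> z * u z $ i = r z * v z $ i \<and>
        (\<rho> z * u z $ i) *\<^sub>R u z + p (\<rho> z) *\<^sub>R axis i 1 = (r z * v z $ i) *\<^sub>R v z + q z *\<^sub>R axis i 1"
      using ae by eventually_elim (simp add: q_in in_range)
  qed
  interpret torus_flow T \<alpha> \<beta> \<rho>up \<Lambda> "Mu + Mr + Mm" r q v
  proof unfold_locales
    show "\<exists>B. \<forall>z. \<bar>q z\<bar> \<le> B" using qb by blast
    show "r z = 0 \<and> q z = 0 \<and> v z = 0" if "fst z \<notin> {0<..<T}" for z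
      using r_off[OF that] q_off[OF that] v0[OF that] by simp
  qed (fact T M \<Lambda> exps rm qm vm rp qp vp rb v3 mass mom)+

  let ?E = "\<lambda>z. 1 / 2 * \<rho> z * (norm (u z))\<^sup>2 + pressure_potential p (\<rho> z)"
  let ?F = "\<lambda>z. (1 / 2 * \<rho> z * (norm (u z))\<^sup>2 + p (\<rho> z) + pressure_potential p (\<rho> z)) *\<^sub>R u z"
  define E where "E z = indicator time z * (1 / 2 * r z * (norm (v z))\<^sup>2 + pot (r z))" for z
  define F where "F z = (1 / 2 * r z * (norm (v z))\<^sup>2 + p' (r z) + pot (r z)) *\<^sub>R v z" for z
  have Em: "E \<in> borel_measurable borel" and Fm: "F \<in> borel_measurable borel"
    unfolding E_def[abs_def] F_def[abs_def] by measurable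
  have Eae: "AE z in lebesgue. fst z \<in> {0<..<T} \<longrightarrow> ?E z = E z" and Fae: "AE z in lebesgue. fst z \<in> {0<..<T} \<longrightarrow> ?F z = F z"
    using ae by (eventually_elim, simp add: E_def F_def time_def in_range)+
  have kin: "\<bar>1 / 2 * r z * (norm (v z))\<^sup>2\<bar> \<le> \<rho>up / 2 * (norm (v z))\<^sup>2" for z
    using rb[of z] by (simp add: abs_mult abs_of_nonneg mult_right_mono)
  have L0: "0 \<le> L" using order_trans[OF abs_ge_zero L(1)] .
  have Ei: "set_integrable lborel slab E"
  proof (rule slab_integrable[where c = "\<rho>up + L", OF Em])
    show "norm (E z) \<le> (\<rho>up + L) * (1 + norm (v z) ^ 3)" for z
    proof -
      have "norm (E z) \<le> \<bar>1 / 2 * r z * (norm (v z))\<^sup>2\<bar> + \<bar>pot (r z)\<bar>"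
        using abs_triangle_ineq[of "1 / 2 * r z * (norm (v z))\<^sup>2" "pot (r z)"]
        by (cases "z \<in> time") (simp_all add: E_def)
      also have "\<dots> \<le> \<rho>up / 2 * (2 * (1 + norm (v z) ^ 3)) + L * (1 + norm (v z) ^ 3)"
        using kin[of z] velocity_le_cube(2)[of z] R0 const_le_cube[of 1 L z] L0 L(2)[of "r z"]
        by (intro add_mono order_trans[OF kin] mult_left_mono) (auto simp: power2_eq_square)
      also have "\<dots> = (\<rho>up + L) * (1 + norm (v z) ^ 3)" by (simp add: field_simps)
      finally show ?thesis .
    qed
    show "E z = 0" if "fst z \<notin> {0<..<T}" for z using that by (simp add: E_def time_def)
  qed
  have Fi: "set_integrable lborel slab F"
  proof (rule slab_integrable[where c = "\<rho>up + 2 * L", OF Fm])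
    show "norm (F z) \<le> (\<rho>up + 2 * L) * (1 + norm (v z) ^ 3)" for z
    proof -
      let ?n = "norm (v z)"
      have "norm (F z) \<le> (\<rho>up / 2 * ?n\<^sup>2 + L + L) * ?n"
        unfolding F_def norm_scaleR using kin[of z] L(1)[of "r z"] L(2)[of "r z"]
        by (intro mult_right_mono) auto
      also have "\<dots> = \<rho>up / 2 * ?n ^ 3 + 2 * L * ?n" by (simp add: power2_eq_square power3_eq_cube algebra_simps)
      also have "\<dots> \<le> \<rho>up * (1 + ?n ^ 3) + 2 * L * (1 + ?n ^ 3)"
        using velocity_le_cube(1)[of z] R0 L0 by (intro add_mono mult_left_mono mult_mono) auto
      finally show ?thesis by (simp add: distrib_right)
    qed
    show "F z = 0" if "fst z \<notin> {0<..<T}" for z using v0[OF that] by (simp add: F_def)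
  qed
  have bal: "(LINT z:cylinder T|lebesgue. ?E z * dt \<phi> z + ?F z \<bullet> grad \<phi> z) = 0" if \<phi>: "\<phi> \<in> test_functions T" for \<phi>
  proof -
    obtain a b where ab: "0 < a" "b < T" and c: "c1_torus a b \<phi> (nabla \<phi>)" using test_function_c1_torus[OF \<phi>] by metis
    have nz: "nabla \<phi> z = 0" if "fst z \<notin> {0<..<T}" for z
      by (rule c1_torusD(5)[OF c]) (use that ab in auto)
    have sq: "(\<Sum>i\<in>UNIV. v z $ i * v z $ i) = (norm (v z))\<^sup>2" and ip: "(\<Sum>j\<in>UNIV. v z $ j * snd (nabla \<phi> z) $ j) = v z \<bullet> snd (nabla \<phi> z)" for z
      by (simp_all add: power2_norm_eq_inner inner_vec_def)
    have eq: "(E z, F z) \<bullet> nabla \<phi> z = energy_integrand (nabla \<phi>) pot p' z" for z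
    proof (cases "fst z \<in> {0<..<T}")
      case True
      then show ?thesis
        by (simp add: energy_integrand_def sq ip inner_prod_def E_def F_def time_def)
    next
      case False
      then have "nabla \<phi> z = 0" by (rule nz)
      then show ?thesis by (simp add: energy_integrand_def)
    qed
    have [measurable]: "nabla \<phi> \<in> borel_measurable borel" "E \<in> borel_measurable borel" "F \<in> borel_measurable borel"
      using c1_torusD(7)[OF c] Em Fm by auto
    have "(LINT z:cylinder T|lebesgue. ?E z * dt \<phi> z + ?F z \<bullet> grad \<phi> z) = (LINT z:slab|lborel. (E z, F z) \<bullet> nabla \<phi> z)"
    proof (rule cylinder_integral)
      show "(\<lambda>z. (E z, F z) \<bullet> nabla \<phi> z) \<in> borel_measurable borel" by measurable
      show "(E z, F z) \<bullet> nabla \<phi> z = 0" if "fst z \<notin> {0<..<T}" for z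
        using nz[OF that] by simp
      show "AE z in lebesgue. fst z \<in> {0<..<T} \<longrightarrow> ?E z * dt \<phi> z + ?F z \<bullet> grad \<phi> z = (E z, F z) \<bullet> nabla \<phi> z"
        using Eae Fae by eventually_elim (metis test_pairing(1)[OF \<phi>])
    qed
    also have "\<dots> = (LINT z:slab|lborel. energy_integrand (nabla \<phi>) pot p' z)" unfolding eq ..
    also have "\<dots> = 0"
    proof (rule energy_balance[OF c ab m'(2,1) L(2,1), where J = "{\<rho>low..\<rho>up}"])
      show "r z \<in> {\<rho>low..\<rho>up} \<and> q z = p' (r z)" if "fst z \<in> {0<..<T}" for z
        using r_in[OF that] q_in[OF that] by blast
      fix \<delta> :: real assume "0 < \<delta>"
      from pressure_approximation[OF low lu pc pd this]
      show "\<exists>P P1 P2 P3 Q. potential_pair P P1 P2 P3 Q \<and> (\<forall>x\<in>{\<rho>low..\<rho>up}. \<bar>p' x - Q x\<bar> \<le> \<delta> \<and> \<bar>pot x - P x\<bar> \<le> \<delta>)"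
        by (simp only: p'_def pot_def clip(2) cong: ball_cong)
    qed
    finally show ?thesis .
  qed
  show ?thesis
    unfolding distributional_balance_def
    using locally_integrable_transfer[OF Em Ei Eae] locally_integrable_transfer[OF Fm Fi Fae] bal by blast
qed

end
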